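(* Let $A$ be a locally Frobenius $k$-algebra of shape $\Lambda$. If $M$ is a coherent $A$-module, then $\mathrm{Ext}_A^s(M,A)=0$ for all $s>0$. Hence $A$ is injective in the category of coherent $A$-modules. More generally, the vanishing $\mathrm{Ext}_A^s(M,A)=0$ for $s>0$ holds if $M$ is a coproduct of coherent $A$-modules.
   Context: $k$ is a field; all rings, algebras, modules and homomorphisms are unital. "$A$-module" means left $A$-module throughout, or right $A$-module throughout. $\mathrm{Ext}_A$ is computed in the category of all $A$-modules. Frobenius notions: a finite dimensional $k$-algebra $R$ is Frobenius if there is a linear form $\theta\colon R\to k$ (a Frobenius form) such that the bilinear form $(x,y)\mapsto\theta(xy)$ is nondegenerate; it is symmetric if $\theta$ can be chosen so that this bilinear form is symmetric. For a homomorphism of $k$-algebras $B\to C$, the extension $C:B$ is a Frobenius extension if there are a $B$-bimodule homomorphism $\Phi\colon C\to B$ and elements $x_i,y_i\in C$ ($1\le i\le n$) with $\sum_i y_i\Phi(x_ic)=c=\sum_i\Phi(cy_i)x_i$ for all $c\in C$; it is a free Frobenius extension if moreover $C$ is free as a left and as a right $B$-module. Shape: $(\Lambda,\preccurlyeq,\lambda_0)$ is an infinite partially ordered set such that any two elements have a common upper bound, $\lambda_0$ is a unique initial element, and for every $\lambda\in\Lambda$ there is $\lambda'\in\Lambda$ with $\lambda\preccurlyeq\lambda'$, $\lambda\ne\lambda'$. A (necessarily infinite dimensional) $k$-algebra $A$ is locally Frobenius of shape $\Lambda$ if: (a) there is a $\Lambda$-directed system of symmetric Frobenius $k$-algebras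 $A(\lambda)$ ($\lambda\in\Lambda$), augmented over $k$, with proper inclusion homomorphisms (of augmented algebras) $A(\lambda')\hookrightarrow A(\lambda'')$ for $\lambda'\preccurlyeq\lambda''$, $\lambda'\neq\lambda''$, with $A(\lambda_0)=k$ and $A=\bigcup_{\lambda\in\Lambda}A(\lambda)$; (b) each inclusion makes $A(\lambda''):A(\lambda')$ a free Frobenius extension. A module is pseudo-coherent if every finitely generated submodule is finitely presented, and coherent if it is finitely generated and pseudo-coherent. *)

theory Defs
  imports "HOL-Algebra.Algebra"
begin

section \<open>Modules over a not necessarily commutative ring\<close>

text \<open>
  The library locale \<^locale>\<open>module\<close> requires a commutative ring of scalars. The record type is
  reused; as in the library, its multiplication and unit play no role for modules.
\<close>

locale left_module = R?: ring R + M?: abelian_group M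
  for R :: "('a, 'e) ring_scheme" (structure) and M :: "('a, 'm) module" (structure) +
  assumes smult_closed [simp, intro]:
      "\<lbrakk>a \<in> carrier R; x \<in> carrier M\<rbrakk> \<Longrightarrow> a \<odot>\<^bsub>M\<^esub> x \<in> carrier M"
    and smult_l_distr:
      "\<lbrakk>a \<in> carrier R; b \<in> carrier R; x \<in> carrier M\<rbrakk> \<Longrightarrow>
       (a \<oplus>\<^bsub>R\<^esub> b) \<odot>\<^bsub>M\<^esub> x = a \<odot>\<^bsub>M\<^esub> x \<oplus>\<^bsub>M\<^esub> b \<odot>\<^bsub>M\<^esub> x"
    and smult_r_distr:
      "\<lbrakk>a \<in> carrier R; x \<in> carrier M; y \<in> carrier M\<rbrakk> \<Longrightarrow>
       a \<odot>\<^bsub>M\<^esub> (x \<oplus>\<^bsub>M\<^esub> y) = a \<odot>\<^bsub>M\<^esub> x \<oplus>\<^bsub>M\<^esub> a \<odot>\<^bsub>M\<^esub> y"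
    and smult_assoc1:
      "\<lbrakk>a \<in> carrier R; b \<in> carrier R; x \<in> carrier M\<rbrakk> \<Longrightarrow>
       (a \<otimes>\<^bsub>R\<^esub> b) \<odot>\<^bsub>M\<^esub> x = a \<odot>\<^bsub>M\<^esub> (b \<odot>\<^bsub>M\<^esub> x)"
    and smult_one [simp]:
      "x \<in> carrier M \<Longrightarrow> \<one>\<^bsub>R\<^esub> \<odot>\<^bsub>M\<^esub> x = x"

text \<open>Right modules over a ring are left modules over the opposite ring.\<close>

definition opposite :: "('a, 'b) monoid_scheme \<Rightarrow> ('a, 'b) monoid_scheme" where
  "opposite R = R\<lparr>monoid.mult := \<lambda>x y. y \<otimes>\<^bsub>R\<^esub> x\<rparr>"

definition regular :: "('a, 'b) ring_scheme \<Rightarrow> ('a, 'a) module" where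
  "regular R =
     \<lparr>carrier = carrier R, monoid.mult = monoid.mult R, monoid.one = \<one>\<^bsub>R\<^esub>, ring.zero = \<zero>\<^bsub>R\<^esub>,
      ring.add = ring.add R, smult = monoid.mult R\<rparr>"

text \<open>Homomorphisms are extensional, so that equality of homomorphisms is equality on the carrier.\<close>

definition mod_hom ::
  "('a, 'e) ring_scheme \<Rightarrow> ('a, 'm) module \<Rightarrow> ('a, 'n) module \<Rightarrow> ('m \<Rightarrow> 'n) set" where
  "mod_hom R M N = {f \<in> carrier M \<rightarrow>\<^sub>E carrier N.
     (\<forall>x\<in>carrier M. \<forall>y\<in>carrier M. f (x \<oplus>\<^bsub>M\<^esub> y) = f x \<oplus>\<^bsub>N\<^esub> f y) \<and>
     (\<forall>a\<in>carrier R. \<forall>x\<in>carrier M. f (a \<odot>\<^bsub>M\<^esub> x) = a \<odot>\<^bsub>N\<^esub> f x)}"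

definition mod_iso ::
  "('a, 'e) ring_scheme \<Rightarrow> ('a, 'm) module \<Rightarrow> ('a, 'n) module \<Rightarrow> bool" where
  "mod_iso R M N \<longleftrightarrow> (\<exists>f\<in>mod_hom R M N. bij_betw f (carrier M) (carrier N))"

definition direct_sum :: "'i set \<Rightarrow> ('i \<Rightarrow> ('a, 'm) module) \<Rightarrow> ('a, 'i \<Rightarrow> 'm) module" where
  "direct_sum I M =
     \<lparr>carrier = {f \<in> (\<Pi>\<^sub>E i\<in>I. carrier (M i)). finite {i \<in> I. f i \<noteq> \<zero>\<^bsub>M i\<^esub>}},
      monoid.mult = undefined, monoid.one = undefined,
      ring.zero = (\<lambda>i\<in>I. \<zero>\<^bsub>M i\<^esub>),
      ring.add = (\<lambda>f g. \<lambda>i\<in>I. f i \<oplus>\<^bsub>M i\<^esub> g i),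
      smult = (\<lambda>a f. \<lambda>i\<in>I. a \<odot>\<^bsub>M i\<^esub> f i)\<rparr>"

definition free_module :: "('a, 'e) ring_scheme \<Rightarrow> 'i set \<Rightarrow> ('a, 'i \<Rightarrow> 'a) module" where
  "free_module R I = direct_sum I (\<lambda>_. regular R)"

definition lin_span :: "('a, 'e) ring_scheme \<Rightarrow> ('a, 'm) module \<Rightarrow> 'm set \<Rightarrow> 'm set" where
  "lin_span R M G =
     {(\<Oplus>\<^bsub>M\<^esub>x\<in>F. c x \<odot>\<^bsub>M\<^esub> x) | F c. finite F \<and> F \<subseteq> G \<and> c \<in> F \<rightarrow> carrier R}"

definition is_basis :: "('a, 'e) ring_scheme \<Rightarrow> ('a, 'm) module \<Rightarrow> 'm set \<Rightarrow> bool" where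
  "is_basis R M G \<longleftrightarrow> G \<subseteq> carrier M \<and> lin_span R M G = carrier M \<and>
     (\<forall>F c. finite F \<and> F \<subseteq> G \<and> c \<in> F \<rightarrow> carrier R \<and> (\<Oplus>\<^bsub>M\<^esub>x\<in>F. c x \<odot>\<^bsub>M\<^esub> x) = \<zero>\<^bsub>M\<^esub>
        \<longrightarrow> (\<forall>x\<in>F. c x = \<zero>\<^bsub>R\<^esub>))"

definition is_free :: "('a, 'e) ring_scheme \<Rightarrow> ('a, 'm) module \<Rightarrow> bool" where
  "is_free R M \<longleftrightarrow> left_module R M \<and> (\<exists>G. is_basis R M G)"


section \<open>Finiteness conditions\<close>

definition finitely_generated :: "('a, 'e) ring_scheme \<Rightarrow> ('a, 'm) module \<Rightarrow> bool" where
  "finitely_generated R M \<longleftrightarrow> (\<exists>S. finite S \<and> S \<subseteq> carrier M \<and> lin_span R M S = carrier M)"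

definition finitely_presented :: "('a, 'e) ring_scheme \<Rightarrow> ('a, 'm) module \<Rightarrow> bool" where
  "finitely_presented R M \<longleftrightarrow>
     (\<exists>(n::nat) f. f \<in> mod_hom R (free_module R {..<n}) M \<and>
        f ` carrier (free_module R {..<n}) = carrier M \<and>
        finitely_generated R ((free_module R {..<n})
          \<lparr>carrier := {x \<in> carrier (free_module R {..<n}). f x = \<zero>\<^bsub>M\<^esub>}\<rparr>))"

definition pseudo_coherent :: "('a, 'e) ring_scheme \<Rightarrow> ('a, 'm) module \<Rightarrow> bool" where
  "pseudo_coherent R M \<longleftrightarrow>
     (\<forall>H. submodule H R M \<and> finitely_generated R (M\<lparr>carrier := H\<rparr>)
        \<longrightarrow> finitely_presented R (M\<lparr>carrier := H\<rparr>))"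

definition coherent :: "('a, 'e) ring_scheme \<Rightarrow> ('a, 'm) module \<Rightarrow> bool" where
  "coherent R M \<longleftrightarrow> left_module R M \<and> finitely_generated R M \<and> pseudo_coherent R M"


section \<open>Projective resolutions and Ext\<close>

text \<open>
  A module \<open>P\<close> is projective if it is a direct summand of a free module. Taking the free module
  on the set underlying \<open>P\<close> is no restriction: if \<open>P\<close> is a summand of any free module, then the
  surjection onto \<open>P\<close> from the free module on its elements splits.
\<close>

definition projective_module :: "('a, 'e) ring_scheme \<Rightarrow> ('a, 'p) module \<Rightarrow> bool" where
  "projective_module R P \<longleftrightarrow> left_module R P \<and>
     (\<exists>i\<in>mod_hom R P (free_module R (carrier P)).
      \<exists>r\<in>mod_hom R (free_module R (carrier P)) P. \<forall>x\<in>carrier P. r (i x) = x)"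

text \<open>\<open>\<dots> \<rightarrow> P 2 \<rightarrow> P 1 \<rightarrow> P 0 \<rightarrow> M \<rightarrow> 0\<close> with \<open>d n : P (n + 1) \<rightarrow> P n\<close> and \<open>e : P 0 \<rightarrow> M\<close>\<close>

definition projective_resolution ::
  "('a, 'e) ring_scheme \<Rightarrow> ('a, 'm) module \<Rightarrow>
   (nat \<Rightarrow> ('a, 'p) module) \<Rightarrow> (nat \<Rightarrow> 'p \<Rightarrow> 'p) \<Rightarrow> ('p \<Rightarrow> 'm) \<Rightarrow> bool" where
  "projective_resolution R M P d e \<longleftrightarrow>
     (\<forall>n. projective_module R (P n)) \<and>
     (\<forall>n. d n \<in> mod_hom R (P (Suc n)) (P n)) \<and>
     e \<in> mod_hom R (P 0) M \<and>
     e ` carrier (P 0) = carrier M \<and>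
     d 0 ` carrier (P (Suc 0)) = {x \<in> carrier (P 0). e x = \<zero>\<^bsub>M\<^esub>} \<and>
     (\<forall>n. d (Suc n) ` carrier (P (Suc (Suc n))) =
            {x \<in> carrier (P (Suc n)). d n x = \<zero>\<^bsub>P n\<^esub>})"

definition hom_group ::
  "('a, 'e) ring_scheme \<Rightarrow> ('a, 'm) module \<Rightarrow> ('a, 'n) module \<Rightarrow> ('m \<Rightarrow> 'n) monoid" where
  "hom_group R M N =
     \<lparr>carrier = mod_hom R M N,
      monoid.mult = (\<lambda>f g. \<lambda>x\<in>carrier M. f x \<oplus>\<^bsub>N\<^esub> g x),
      monoid.one = (\<lambda>x\<in>carrier M. \<zero>\<^bsub>N\<^esub>)\<rparr>"

definition cocycles ::
  "('a, 'e) ring_scheme \<Rightarrow> (nat \<Rightarrow> ('a, 'p) module) \<Rightarrow> (nat \<Rightarrow> 'p \<Rightarrow> 'p) \<Rightarrow>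
   ('a, 'n) module \<Rightarrow> nat \<Rightarrow> ('p \<Rightarrow> 'n) set" where
  "cocycles R P d N s =
     {f \<in> mod_hom R (P s) N. \<forall>x\<in>carrier (P (Suc s)). f (d s x) = \<zero>\<^bsub>N\<^esub>}"

primrec coboundaries ::
  "('a, 'e) ring_scheme \<Rightarrow> (nat \<Rightarrow> ('a, 'p) module) \<Rightarrow> (nat \<Rightarrow> 'p \<Rightarrow> 'p) \<Rightarrow>
   ('a, 'n) module \<Rightarrow> nat \<Rightarrow> ('p \<Rightarrow> 'n) set" where
  "coboundaries R P d N 0 = {\<lambda>x\<in>carrier (P 0). \<zero>\<^bsub>N\<^esub>}"
| "coboundaries R P d N (Suc s) =
     (\<lambda>f. compose (carrier (P (Suc s))) f (d s)) ` mod_hom R (P s) N"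

text \<open>
  The \<open>s\<close>-th cohomology group of \<open>Hom (P, N)\<close>, that is, the group \<open>Ext\<^sup>s (M, N)\<close> computed from
  the projective resolution \<open>(P, d)\<close> of \<open>M\<close>. That every module has a projective resolution (by
  modules whose elements lie in a type depending on the types of \<open>R\<close> and \<open>M\<close> only) is shown at the
  end of this theory.
\<close>

definition Ext_group ::
  "('a, 'e) ring_scheme \<Rightarrow> (nat \<Rightarrow> ('a, 'p) module) \<Rightarrow> (nat \<Rightarrow> 'p \<Rightarrow> 'p) \<Rightarrow>
   ('a, 'n) module \<Rightarrow> nat \<Rightarrow> ('p \<Rightarrow> 'n) set monoid" where
  "Ext_group R P d N s =
     (hom_group R (P s) N)\<lparr>carrier := cocycles R P d N s\<rparr> Mod coboundaries R P d N s"


section \<open>Algebras over a field and Frobenius notions\<close>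

locale k_algebra = K?: field K + module K A + ring A
  for K :: "('k, 'e) ring_scheme" (structure) and A :: "('k, 'a, 'z) module_scheme" (structure) +
  assumes smult_mult_left:
      "\<lbrakk>c \<in> carrier K; x \<in> carrier A; y \<in> carrier A\<rbrakk> \<Longrightarrow>
       (c \<odot>\<^bsub>A\<^esub> x) \<otimes>\<^bsub>A\<^esub> y = c \<odot>\<^bsub>A\<^esub> (x \<otimes>\<^bsub>A\<^esub> y)"
    and smult_mult_right:
      "\<lbrakk>c \<in> carrier K; x \<in> carrier A; y \<in> carrier A\<rbrakk> \<Longrightarrow>
       x \<otimes>\<^bsub>A\<^esub> (c \<odot>\<^bsub>A\<^esub> y) = c \<odot>\<^bsub>A\<^esub> (x \<otimes>\<^bsub>A\<^esub> y)"

definition alg_hom ::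
  "('k, 'e) ring_scheme \<Rightarrow> ('k, 'a) module \<Rightarrow> ('k, 'b) module \<Rightarrow> ('a \<Rightarrow> 'b) set" where
  "alg_hom K A B = {h \<in> ring_hom A B.
     \<forall>c\<in>carrier K. \<forall>x\<in>carrier A. h (c \<odot>\<^bsub>A\<^esub> x) = c \<odot>\<^bsub>B\<^esub> h x}"

definition finite_dimensional :: "('k, 'e) ring_scheme \<Rightarrow> ('k, 'a) module \<Rightarrow> bool" where
  "finite_dimensional K V \<longleftrightarrow> (\<exists>G. finite G \<and> is_basis K V G)"

definition frobenius_form :: "('k, 'e) ring_scheme \<Rightarrow> ('k, 'a) module \<Rightarrow> ('a \<Rightarrow> 'k) \<Rightarrow> bool" where
  "frobenius_form K R \<theta> \<longleftrightarrow> \<theta> \<in> mod_hom K R (regular K) \<and>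
     (\<forall>x\<in>carrier R. (\<forall>y\<in>carrier R. \<theta> (x \<otimes>\<^bsub>R\<^esub> y) = \<zero>\<^bsub>K\<^esub>) \<longrightarrow> x = \<zero>\<^bsub>R\<^esub>) \<and>
     (\<forall>y\<in>carrier R. (\<forall>x\<in>carrier R. \<theta> (x \<otimes>\<^bsub>R\<^esub> y) = \<zero>\<^bsub>K\<^esub>) \<longrightarrow> y = \<zero>\<^bsub>R\<^esub>)"

definition symmetric_frobenius :: "('k, 'e) ring_scheme \<Rightarrow> ('k, 'a) module \<Rightarrow> bool" where
  "symmetric_frobenius K R \<longleftrightarrow> k_algebra K R \<and> finite_dimensional K R \<and>
     (\<exists>\<theta>. frobenius_form K R \<theta> \<and>
        (\<forall>x\<in>carrier R. \<forall>y\<in>carrier R. \<theta> (x \<otimes>\<^bsub>R\<^esub> y) = \<theta> (y \<otimes>\<^bsub>R\<^esub> x)))"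

text \<open>\<open>C\<close> as a left and as a right \<open>B\<close>-module along \<open>\<iota> : B \<rightarrow> C\<close>\<close>

definition left_restriction :: "('b \<Rightarrow> 'c) \<Rightarrow> ('k, 'c) module \<Rightarrow> ('b, 'c) module" where
  "left_restriction \<iota> C =
     \<lparr>carrier = carrier C, monoid.mult = monoid.mult C, monoid.one = \<one>\<^bsub>C\<^esub>, ring.zero = \<zero>\<^bsub>C\<^esub>, ring.add = ring.add C,
      smult = (\<lambda>b c. \<iota> b \<otimes>\<^bsub>C\<^esub> c)\<rparr>"

definition right_restriction :: "('b \<Rightarrow> 'c) \<Rightarrow> ('k, 'c) module \<Rightarrow> ('b, 'c) module" where
  "right_restriction \<iota> C =
     \<lparr>carrier = carrier C, monoid.mult = monoid.mult C, monoid.one = \<one>\<^bsub>C\<^esub>, ring.zero = \<zero>\<^bsub>C\<^esub>, ring.add = ring.add C,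
      smult = (\<lambda>b c. c \<otimes>\<^bsub>C\<^esub> \<iota> b)\<rparr>"

definition bimodule_hom ::
  "('b \<Rightarrow> 'c) \<Rightarrow> ('k, 'b) module \<Rightarrow> ('k, 'c) module \<Rightarrow> ('c \<Rightarrow> 'b) set" where
  "bimodule_hom \<iota> B C = {\<Phi> \<in> carrier C \<rightarrow> carrier B.
     (\<forall>x\<in>carrier C. \<forall>y\<in>carrier C. \<Phi> (x \<oplus>\<^bsub>C\<^esub> y) = \<Phi> x \<oplus>\<^bsub>B\<^esub> \<Phi> y) \<and>
     (\<forall>b\<in>carrier B. \<forall>x\<in>carrier C. \<Phi> (\<iota> b \<otimes>\<^bsub>C\<^esub> x) = b \<otimes>\<^bsub>B\<^esub> \<Phi> x) \<and>
     (\<forall>b\<in>carrier B. \<forall>x\<in>carrier C. \<Phi> (x \<otimes>\<^bsub>C\<^esub> \<iota> b) = \<Phi> x \<otimes>\<^bsub>B\<^esub> b)}"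

definition frobenius_extension ::
  "('k, 'e) ring_scheme \<Rightarrow> ('b \<Rightarrow> 'c) \<Rightarrow> ('k, 'b) module \<Rightarrow> ('k, 'c) module \<Rightarrow> bool" where
  "frobenius_extension K \<iota> B C \<longleftrightarrow>
     k_algebra K B \<and> k_algebra K C \<and> \<iota> \<in> alg_hom K B C \<and>
     (\<exists>\<Phi>\<in>bimodule_hom \<iota> B C. \<exists>(n::nat) x y.
        x \<in> {..<n} \<rightarrow> carrier C \<and> y \<in> {..<n} \<rightarrow> carrier C \<and>
        (\<forall>c\<in>carrier C.
           (\<Oplus>\<^bsub>C\<^esub>i\<in>{..<n}. y i \<otimes>\<^bsub>C\<^esub> \<iota> (\<Phi> (x i \<otimes>\<^bsub>C\<^esub> c))) = c \<and>
           (\<Oplus>\<^bsub>C\<^esub>i\<in>{..<n}. \<iota> (\<Phi> (c \<otimes>\<^bsub>C\<^esub> y i)) \<otimes>\<^bsub>C\<^esub> x i) = c))"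

definition free_frobenius_extension ::
  "('k, 'e) ring_scheme \<Rightarrow> ('b \<Rightarrow> 'c) \<Rightarrow> ('k, 'b) module \<Rightarrow> ('k, 'c) module \<Rightarrow> bool" where
  "free_frobenius_extension K \<iota> B C \<longleftrightarrow> frobenius_extension K \<iota> B C \<and>
     is_free B (left_restriction \<iota> C) \<and> is_free (opposite B) (right_restriction \<iota> C)"


section \<open>Locally Frobenius algebras\<close>

definition is_shape :: "'l set \<Rightarrow> 'l rel \<Rightarrow> 'l \<Rightarrow> bool" where
  "is_shape \<Lambda> r l0 \<longleftrightarrow> infinite \<Lambda> \<and> partial_order_on \<Lambda> r \<and>
     (\<forall>l1\<in>\<Lambda>. \<forall>l2\<in>\<Lambda>. \<exists>l\<in>\<Lambda>. (l1, l) \<in> r \<and> (l2, l) \<in> r) \<and>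
     l0 \<in> \<Lambda> \<and> (\<forall>l\<in>\<Lambda>. (l0, l) \<in> r) \<and>
     (\<forall>l\<in>\<Lambda>. \<exists>l'\<in>\<Lambda>. (l, l') \<in> r \<and> l \<noteq> l')"

text \<open>
  The algebras \<open>A(l)\<close> are the subsets \<open>S l\<close> of \<open>A\<close> with the operations of \<open>A\<close>; \<open>\<epsilon> l\<close> is the
  augmentation of \<open>A(l)\<close>. The condition on \<open>S l0\<close> says that the unit map of \<open>A(l0)\<close> is onto;
  being a ring homomorphism between nonzero rings with domain a field, it is then bijective.
\<close>

definition locally_frobenius ::
  "('k, 'e) ring_scheme \<Rightarrow> 'l set \<Rightarrow> 'l rel \<Rightarrow> 'l \<Rightarrow> ('k, 'a) module \<Rightarrow> bool" where
  "locally_frobenius K \<Lambda> r l0 A \<longleftrightarrow>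
     k_algebra K A \<and> is_shape \<Lambda> r l0 \<and>
     (\<exists>(S :: 'l \<Rightarrow> 'a set) (\<epsilon> :: 'l \<Rightarrow> 'a \<Rightarrow> 'k).
        carrier A = (\<Union>l\<in>\<Lambda>. S l) \<and>
        S l0 = (\<lambda>c. c \<odot>\<^bsub>A\<^esub> \<one>\<^bsub>A\<^esub>) ` carrier K \<and>
        (\<forall>l\<in>\<Lambda>. symmetric_frobenius K (A\<lparr>carrier := S l\<rparr>) \<and>
                \<epsilon> l \<in> alg_hom K (A\<lparr>carrier := S l\<rparr>) (regular K)) \<and>
        (\<forall>l\<in>\<Lambda>. \<forall>l'\<in>\<Lambda>. (l, l') \<in> r \<and> l \<noteq> l' \<longrightarrow>
           S l \<subset> S l' \<and>
           (\<forall>x\<in>S l. \<epsilon> l' x = \<epsilon> l x) \<and>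
           free_frobenius_extension K (\<lambda>x. x) (A\<lparr>carrier := S l\<rparr>) (A\<lparr>carrier := S l'\<rparr>)))"


section \<open>Existence of projective resolutions\<close>

lemma regular_simps [simp]:
  "carrier (regular R) = carrier R" "\<zero>\<^bsub>regular R\<^esub> = \<zero>\<^bsub>R\<^esub>"
  "x \<oplus>\<^bsub>regular R\<^esub> y = x \<oplus>\<^bsub>R\<^esub> y" "x \<odot>\<^bsub>regular R\<^esub> y = x \<otimes>\<^bsub>R\<^esub> y"
  by (simp_all add: regular_def)

lemma free_module_simps:
  "carrier (free_module R I) = {f \<in> I \<rightarrow>\<^sub>E carrier R. finite {i \<in> I. f i \<noteq> \<zero>\<^bsub>R\<^esub>}}"
  "\<zero>\<^bsub>free_module R I\<^esub> = (\<lambda>i\<in>I. \<zero>\<^bsub>R\<^esub>)"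
  "f \<oplus>\<^bsub>free_module R I\<^esub> g = (\<lambda>i\<in>I. f i \<oplus>\<^bsub>R\<^esub> g i)"
  "a \<odot>\<^bsub>free_module R I\<^esub> f = (\<lambda>i\<in>I. a \<otimes>\<^bsub>R\<^esub> f i)"
  by (simp_all add: free_module_def direct_sum_def)

lemma (in ring) left_module_free: "left_module R (free_module R I)"
proof -
  let ?F = "free_module R I"
  have fin_add: "finite {i \<in> I. f i \<oplus> g i \<noteq> \<zero>}"
    if "finite {i \<in> I. f i \<noteq> \<zero>}" "finite {i \<in> I. g i \<noteq> \<zero>}" for f g
    by (rule finite_subset[OF _ finite_UnI[OF that]]) auto
  have fin_smult: "finite {i \<in> I. a \<otimes> f i \<noteq> \<zero>}"
    if "finite {i \<in> I. f i \<noteq> \<zero>}" "a \<in> carrier R" for f a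
    by (rule finite_subset[OF _ that(1)]) (use that(2) in auto)
  have "abelian_group ?F"
  proof (rule abelian_groupI)
    fix f assume f: "f \<in> carrier ?F"
    let ?g = "\<lambda>i\<in>I. \<ominus> f i"
    have "finite {i \<in> I. ?g i \<noteq> \<zero>}"
      by (rule finite_subset[of _ "{i \<in> I. f i \<noteq> \<zero>}"])
        (use f in \<open>auto simp: free_module_simps\<close>)
    then have "?g \<in> carrier ?F"
      using f by (auto simp: free_module_simps PiE_iff)
    moreover have "?g \<oplus>\<^bsub>?F\<^esub> f = \<zero>\<^bsub>?F\<^esub>"
      using f by (auto simp: free_module_simps fun_eq_iff PiE_iff l_neg)
    ultimately show "\<exists>g\<in>carrier ?F. g \<oplus>\<^bsub>?F\<^esub> f = \<zero>\<^bsub>?F\<^esub>" by blast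
  qed (auto simp: free_module_simps fun_eq_iff PiE_iff extensional_def a_assoc fin_add intro: a_comm cong: conj_cong)
  then show ?thesis
    unfolding left_module_def left_module_axioms_def
    by (auto simp: free_module_simps fun_eq_iff PiE_iff extensional_def l_distr r_distr m_assoc
          fin_smult ring_axioms cong: conj_cong)
qed

context left_module
begin

definition lin_ext :: "'i set \<Rightarrow> ('i \<Rightarrow> 'm) \<Rightarrow> ('i \<Rightarrow> 'a) \<Rightarrow> 'm" where
  "lin_ext I e = (\<lambda>f\<in>carrier (free_module R I). \<Oplus>\<^bsub>M\<^esub>i\<in>{i \<in> I. f i \<noteq> \<zero>\<^bsub>R\<^esub>}. f i \<odot>\<^bsub>M\<^esub> e i)"

lemma smult_l_null: "x \<in> carrier M \<Longrightarrow> \<zero>\<^bsub>R\<^esub> \<odot>\<^bsub>M\<^esub> x = \<zero>\<^bsub>M\<^esub>"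
  by (metis M.add.l_cancel_one' R.l_zero R.zero_closed smult_closed smult_l_distr)

lemma smult_r_null: "a \<in> carrier R \<Longrightarrow> a \<odot>\<^bsub>M\<^esub> \<zero>\<^bsub>M\<^esub> = \<zero>\<^bsub>M\<^esub>"
  by (metis M.add.l_cancel_one' M.l_zero M.zero_closed smult_closed smult_r_distr)

lemma lin_ext_eq:
  assumes "f \<in> carrier (free_module R I)" "e \<in> I \<rightarrow> carrier M"
    and "finite T" "{i \<in> I. f i \<noteq> \<zero>\<^bsub>R\<^esub>} \<subseteq> T" "T \<subseteq> I"
  shows "lin_ext I e f = (\<Oplus>\<^bsub>M\<^esub>i\<in>T. f i \<odot>\<^bsub>M\<^esub> e i)"
proof -
  have "(\<Oplus>\<^bsub>M\<^esub>i\<in>{i \<in> I. f i \<noteq> \<zero>\<^bsub>R\<^esub>}. f i \<odot>\<^bsub>M\<^esub> e i) = (\<Oplus>\<^bsub>M\<^esub>i\<in>T. f i \<odot>\<^bsub>M\<^esub> e i)"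
    by (rule M.add.finprod_mono_neutral_cong_left)
      (use assms in \<open>auto simp: free_module_simps PiE_iff smult_l_null Pi_iff subset_iff\<close>)
  with assms(1) show ?thesis by (simp add: lin_ext_def)
qed

lemma finsum_smult:
  assumes "finite T" "a \<in> carrier R" "f \<in> T \<rightarrow> carrier M"
  shows "a \<odot>\<^bsub>M\<^esub> (\<Oplus>\<^bsub>M\<^esub>i\<in>T. f i) = (\<Oplus>\<^bsub>M\<^esub>i\<in>T. a \<odot>\<^bsub>M\<^esub> f i)"
  using assms
proof (induction T rule: finite_induct)
  case (insert x F)
  then have "(\<lambda>i. a \<odot>\<^bsub>M\<^esub> f i) \<in> F \<rightarrow> carrier M" by auto
  with insert show ?case by (simp add: smult_r_distr Pi_iff)
qed (simp add: smult_r_null)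

lemma lin_ext_hom:
  assumes e: "e \<in> I \<rightarrow> carrier M"
  shows "lin_ext I e \<in> mod_hom R (free_module R I) M"
proof -
  let ?F = "free_module R I"
  interpret F: left_module R ?F by (rule R.left_module_free)
  let ?s = "\<lambda>f. {i \<in> I. f i \<noteq> \<zero>\<^bsub>R\<^esub>}"
  have fin: "finite (?s f)" and cl: "\<And>i. i \<in> I \<Longrightarrow> f i \<in> carrier R" if "f \<in> carrier ?F" for f
    using that by (auto simp: free_module_simps PiE_iff)
  have "lin_ext I e f \<in> carrier M" if f: "f \<in> carrier ?F" for f
    by (subst lin_ext_eq[OF f e fin[OF f]]) (use cl[OF f] e in \<open>auto intro!: M.finsum_closed\<close>)
  moreover have "lin_ext I e (f \<oplus>\<^bsub>?F\<^esub> g) = lin_ext I e f \<oplus>\<^bsub>M\<^esub> lin_ext I e g"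
    if f: "f \<in> carrier ?F" and g: "g \<in> carrier ?F" for f g
  proof -
    have T: "finite (?s f \<union> ?s g)" "?s f \<union> ?s g \<subseteq> I" using fin f g by auto
    have "lin_ext I e (f \<oplus>\<^bsub>?F\<^esub> g) = (\<Oplus>\<^bsub>M\<^esub>i\<in>?s f \<union> ?s g. (f \<oplus>\<^bsub>?F\<^esub> g) i \<odot>\<^bsub>M\<^esub> e i)"
      by (rule lin_ext_eq[OF F.a_closed[OF f g] e T(1) _ T(2)]) (auto simp: free_module_simps)
    also have "\<dots> = (\<Oplus>\<^bsub>M\<^esub>i\<in>?s f \<union> ?s g. f i \<odot>\<^bsub>M\<^esub> e i \<oplus>\<^bsub>M\<^esub> g i \<odot>\<^bsub>M\<^esub> e i)"
      by (rule M.finsum_cong') (use cl f g e in \<open>auto simp: free_module_simps smult_l_distr Pi_iff\<close>)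
    also have "\<dots> = (\<Oplus>\<^bsub>M\<^esub>i\<in>?s f \<union> ?s g. f i \<odot>\<^bsub>M\<^esub> e i) \<oplus>\<^bsub>M\<^esub> (\<Oplus>\<^bsub>M\<^esub>i\<in>?s f \<union> ?s g. g i \<odot>\<^bsub>M\<^esub> e i)"
      by (rule M.finsum_addf) (use cl f g e in \<open>auto simp: Pi_iff\<close>)
    also have "\<dots> = lin_ext I e f \<oplus>\<^bsub>M\<^esub> lin_ext I e g"
      by (simp only: lin_ext_eq[OF f e T(1) _ T(2)] lin_ext_eq[OF g e T(1) _ T(2)] Un_upper1 Un_upper2)
    finally show ?thesis .
  qed
  moreover have "lin_ext I e (a \<odot>\<^bsub>?F\<^esub> f) = a \<odot>\<^bsub>M\<^esub> lin_ext I e f"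
    if a: "a \<in> carrier R" and f: "f \<in> carrier ?F" for a f
  proof -
    have "lin_ext I e (a \<odot>\<^bsub>?F\<^esub> f) = (\<Oplus>\<^bsub>M\<^esub>i\<in>?s f. (a \<odot>\<^bsub>?F\<^esub> f) i \<odot>\<^bsub>M\<^esub> e i)"
      by (rule lin_ext_eq[OF F.smult_closed[OF a f] e fin[OF f]]) (use a in \<open>auto simp: free_module_simps\<close>)
    also have "\<dots> = (\<Oplus>\<^bsub>M\<^esub>i\<in>?s f. a \<odot>\<^bsub>M\<^esub> (f i \<odot>\<^bsub>M\<^esub> e i))"
      by (rule M.finsum_cong') (use cl f a e in \<open>auto simp: free_module_simps smult_assoc1 Pi_iff\<close>)
    also have "\<dots> = a \<odot>\<^bsub>M\<^esub> (\<Oplus>\<^bsub>M\<^esub>i\<in>?s f. f i \<odot>\<^bsub>M\<^esub> e i)"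
      by (rule finsum_smult[symmetric]) (use fin cl f a e in \<open>auto simp: Pi_iff\<close>)
    finally show ?thesis using f by (simp add: lin_ext_def)
  qed
  ultimately show ?thesis
    by (auto simp: mod_hom_def lin_ext_def)
qed

end

definition single :: "('a, 'e) ring_scheme \<Rightarrow> 'i set \<Rightarrow> 'i \<Rightarrow> 'i \<Rightarrow> 'a" where
  "single R I i = (\<lambda>j\<in>I. if j = i then \<one>\<^bsub>R\<^esub> else \<zero>\<^bsub>R\<^esub>)"

lemma (in ring) single_closed: "single R I i \<in> carrier (free_module R I)"
  by (auto simp: single_def free_module_simps intro: finite_subset[of _ "{i}"])

lemma (in left_module) lin_ext_single:
  assumes "e \<in> I \<rightarrow> carrier M" "i \<in> I"
  shows "lin_ext I e (single R I i) = e i"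
proof -
  have "lin_ext I e (single R I i) = (\<Oplus>\<^bsub>M\<^esub>j\<in>{i}. single R I i j \<odot>\<^bsub>M\<^esub> e j)"
    by (rule lin_ext_eq[OF R.single_closed assms(1)]) (use assms in \<open>auto simp: single_def\<close>)
  also have "\<dots> = e i"
    using assms by (auto simp: single_def Pi_iff)
  finally show ?thesis .
qed

lemma (in ring) lin_ext_single_id:
  assumes f: "f \<in> carrier (free_module R I)"
  shows "left_module.lin_ext R (free_module R I) I (single R I) f = f"
proof -
  let ?F = "free_module R I"
  interpret F: left_module R ?F by (rule left_module_free)
  have cl: "f i \<in> carrier R" if "i \<in> I" for i
    using f that by (auto simp: free_module_simps PiE_iff)
  have *: "(\<Oplus>\<^bsub>?F\<^esub>i\<in>T. f i \<odot>\<^bsub>?F\<^esub> single R I i) = (\<lambda>i\<in>I. if i \<in> T then f i else \<zero>)"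
    if "finite T" "T \<subseteq> I" for T
    using that
  proof (induction T rule: finite_induct)
    case (insert x T)
    have "(\<lambda>i. f i \<odot>\<^bsub>?F\<^esub> single R I i) \<in> T \<rightarrow> carrier ?F"
      using insert(4) by (intro Pi_I F.smult_closed single_closed cl) auto
    moreover have "f x \<odot>\<^bsub>?F\<^esub> single R I x \<in> carrier ?F"
      using insert(4) by (intro F.smult_closed single_closed cl) auto
    ultimately have "(\<Oplus>\<^bsub>?F\<^esub>i\<in>insert x T. f i \<odot>\<^bsub>?F\<^esub> single R I i)
        = f x \<odot>\<^bsub>?F\<^esub> single R I x \<oplus>\<^bsub>?F\<^esub> (\<lambda>i\<in>I. if i \<in> T then f i else \<zero>)"
      using insert by (simp add: restrict_def)
    also have "\<dots> = (\<lambda>i\<in>I. if i \<in> insert x T then f i else \<zero>)"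
      using insert(2,4) cl by (auto simp: free_module_simps single_def intro!: restrict_ext)
    finally show ?case .
  qed (auto simp: free_module_simps)
  have "F.lin_ext I (single R I) f = (\<Oplus>\<^bsub>?F\<^esub>i\<in>{i \<in> I. f i \<noteq> \<zero>}. f i \<odot>\<^bsub>?F\<^esub> single R I i)"
    using f by (simp add: F.lin_ext_def)
  also have "\<dots> = (\<lambda>i\<in>I. if i \<in> {i \<in> I. f i \<noteq> \<zero>} then f i else \<zero>)"
    using f by (intro *) (auto simp: free_module_simps)
  also have "\<dots> = f"
    using f by (auto simp: free_module_simps fun_eq_iff PiE_iff extensional_def)
  finally show ?thesis .
qed

lemma mod_hom_lin_ext:
  assumes "left_module R M" "left_module R N" "h \<in> mod_hom R M N"
    and "e \<in> I \<rightarrow> carrier M" and f: "f \<in> carrier (free_module R I)"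
  shows "h (left_module.lin_ext R M I e f) = left_module.lin_ext R N I (h \<circ> e) f"
proof -
  interpret M: left_module R M by fact
  interpret N: left_module R N by fact
  have hcl: "h x \<in> carrier N" if "x \<in> carrier M" for x
    using assms(3) that by (auto simp: mod_hom_def PiE_iff)
  have h0: "h \<zero>\<^bsub>M\<^esub> = \<zero>\<^bsub>N\<^esub>"
  proof -
    have "h \<zero>\<^bsub>M\<^esub> \<oplus>\<^bsub>N\<^esub> h \<zero>\<^bsub>M\<^esub> = h \<zero>\<^bsub>M\<^esub>"
    proof -
      have "h (\<zero>\<^bsub>M\<^esub> \<oplus>\<^bsub>M\<^esub> \<zero>\<^bsub>M\<^esub>) = h \<zero>\<^bsub>M\<^esub> \<oplus>\<^bsub>N\<^esub> h \<zero>\<^bsub>M\<^esub>"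
        using assms(3) M.M.zero_closed unfolding mod_hom_def by blast
      then show ?thesis using M.M.l_zero[OF M.M.zero_closed] by simp
    qed
    then show ?thesis
      using hcl[OF M.M.zero_closed] by (simp add: N.M.add.l_cancel_one)
  qed
  have fi: "f i \<in> carrier R" if "i \<in> I" for i
    using f that by (auto simp: free_module_simps PiE_iff)
  have "h (\<Oplus>\<^bsub>M\<^esub>i\<in>T. f i \<odot>\<^bsub>M\<^esub> e i) = (\<Oplus>\<^bsub>N\<^esub>i\<in>T. f i \<odot>\<^bsub>N\<^esub> (h \<circ> e) i)"
    if "finite T" "T \<subseteq> I" for T
    using that
  proof (induction T rule: finite_induct)
    case (insert x T)
    have 1: "(\<lambda>i. f i \<odot>\<^bsub>M\<^esub> e i) \<in> T \<rightarrow> carrier M" "f x \<odot>\<^bsub>M\<^esub> e x \<in> carrier M"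
      using insert fi assms(4) by (auto simp: Pi_iff subset_iff)
    have 2: "(\<lambda>i. f i \<odot>\<^bsub>N\<^esub> (h \<circ> e) i) \<in> T \<rightarrow> carrier N" "f x \<odot>\<^bsub>N\<^esub> (h \<circ> e) x \<in> carrier N"
      using insert fi assms(4) hcl by (auto simp: Pi_iff subset_iff)
    have 3: "h (f x \<odot>\<^bsub>M\<^esub> e x) = f x \<odot>\<^bsub>N\<^esub> (h \<circ> e) x"
      using insert fi assms(3,4) by (auto simp: mod_hom_def Pi_iff)
    have "h (\<Oplus>\<^bsub>M\<^esub>i\<in>insert x T. f i \<odot>\<^bsub>M\<^esub> e i)
        = h ((f x \<odot>\<^bsub>M\<^esub> e x) \<oplus>\<^bsub>M\<^esub> (\<Oplus>\<^bsub>M\<^esub>i\<in>T. f i \<odot>\<^bsub>M\<^esub> e i))"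
      using insert 1 by simp
    also have "\<dots> = h (f x \<odot>\<^bsub>M\<^esub> e x) \<oplus>\<^bsub>N\<^esub> h (\<Oplus>\<^bsub>M\<^esub>i\<in>T. f i \<odot>\<^bsub>M\<^esub> e i)"
      using assms(3) 1(2) M.M.finsum_closed[OF 1(1)] by (simp add: mod_hom_def)
    also have "\<dots> = (\<Oplus>\<^bsub>N\<^esub>i\<in>insert x T. f i \<odot>\<^bsub>N\<^esub> (h \<circ> e) i)"
      using insert 2 3 by simp
    finally show ?case .
  qed (simp add: h0)
  then show ?thesis
    using f by (simp add: M.lin_ext_def N.lin_ext_def free_module_simps)
qed

lemma (in ring) projective_free: "projective_module R (free_module R I)"
proof -
  let ?F = "free_module R I"
  let ?P = "free_module R (carrier ?F)"
  interpret F: left_module R ?F by (rule left_module_free)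
  interpret P: left_module R ?P by (rule left_module_free)
  let ?r = "F.lin_ext (carrier ?F) (\<lambda>x. x)"
  let ?i = "P.lin_ext I (single R (carrier ?F) \<circ> single R I)"
  have r: "?r \<in> mod_hom R ?P ?F" by (rule F.lin_ext_hom) auto
  have e: "single R (carrier ?F) \<circ> single R I \<in> I \<rightarrow> carrier ?P"
    using single_closed by auto
  have "?r (?i x) = x" if x: "x \<in> carrier ?F" for x
  proof -
    have "?r (?i x) = F.lin_ext I (?r \<circ> (single R (carrier ?F) \<circ> single R I)) x"
      by (rule mod_hom_lin_ext[OF P.left_module_axioms F.left_module_axioms r e x])
    also have "?r \<circ> (single R (carrier ?F) \<circ> single R I) = single R I"
      by (simp add: fun_eq_iff F.lin_ext_single single_closed)
    finally show ?thesis by (simp only: lin_ext_single_id[OF x])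
  qed
  then show ?thesis
    unfolding projective_module_def
    by (intro conjI F.left_module_axioms bexI[OF _ P.lin_ext_hom[OF e]] bexI[OF _ r] ballI)
qed

lemma (in left_module) free_cover:
  assumes H: "submodule H R M" and e: "e ` I = H"
  shows "\<exists>h\<in>mod_hom R (free_module R I) M. h ` carrier (free_module R I) = H"
proof (rule bexI[of _ "lin_ext I e"])
  interpret H: submodule H R M by fact
  have HM: "H \<subseteq> carrier M" using H.subset by simp
  then have e': "e \<in> I \<rightarrow> carrier M" using e by auto
  show "lin_ext I e \<in> mod_hom R (free_module R I) M" by (rule lin_ext_hom[OF e'])
  have sumH: "(\<Oplus>\<^bsub>M\<^esub>i\<in>T. c i \<odot>\<^bsub>M\<^esub> e i) \<in> H" if "finite T" "T \<subseteq> I" "c \<in> T \<rightarrow> carrier R" for T c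
    using that
  proof (induction T rule: finite_induct)
    case (insert x T)
    have "e x \<in> H" using insert(4) e by auto
    then have "c x \<odot>\<^bsub>M\<^esub> e x \<in> H" using insert(5) by (intro H.smult_closed) auto
    moreover have "(\<lambda>i. c i \<odot>\<^bsub>M\<^esub> e i) \<in> T \<rightarrow> carrier M"
      using insert e' by (auto simp: Pi_iff subset_iff)
    moreover have "(\<Oplus>\<^bsub>M\<^esub>i\<in>T. c i \<odot>\<^bsub>M\<^esub> e i) \<in> H" using insert by auto
    ultimately have "c x \<odot>\<^bsub>M\<^esub> e x \<oplus>\<^bsub>M\<^esub> (\<Oplus>\<^bsub>M\<^esub>i\<in>T. c i \<odot>\<^bsub>M\<^esub> e i) \<in> H"
        "(\<Oplus>\<^bsub>M\<^esub>i\<in>insert x T. c i \<odot>\<^bsub>M\<^esub> e i) = c x \<odot>\<^bsub>M\<^esub> e x \<oplus>\<^bsub>M\<^esub> (\<Oplus>\<^bsub>M\<^esub>i\<in>T. c i \<odot>\<^bsub>M\<^esub> e i)"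
      using insert(1,2) HM H.m_closed by (simp_all add: subset_iff)
    then show ?case by simp
  qed (use H.one_closed in simp)
  show "lin_ext I e ` carrier (free_module R I) = H"
  proof
    show "lin_ext I e ` carrier (free_module R I) \<subseteq> H"
      using sumH by (auto simp: lin_ext_def free_module_simps PiE_iff)
    show "H \<subseteq> lin_ext I e ` carrier (free_module R I)"
    proof
      fix x assume "x \<in> H"
      then obtain i where "i \<in> I" "x = e i" using e by auto
      then show "x \<in> lin_ext I e ` carrier (free_module R I)"
        using lin_ext_single[OF e'] R.single_closed by (metis image_eqI)
    qed
  qed
qed

lemma submodule_kernel:
  assumes "left_module R M" "left_module R N" "h \<in> mod_hom R M N"
  shows "submodule {x \<in> carrier M. h x = \<zero>\<^bsub>N\<^esub>} R M"
proof -
  interpret M: left_module R M by fact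
  interpret N: left_module R N by fact
  have add: "h (x \<oplus>\<^bsub>M\<^esub> y) = h x \<oplus>\<^bsub>N\<^esub> h y" if "x \<in> carrier M" "y \<in> carrier M" for x y
    using assms(3) that by (simp add: mod_hom_def)
  have sm: "h (a \<odot>\<^bsub>M\<^esub> x) = a \<odot>\<^bsub>N\<^esub> h x" if "a \<in> carrier R" "x \<in> carrier M" for a x
    using assms(3) that by (simp add: mod_hom_def)
  have cl: "h x \<in> carrier N" if "x \<in> carrier M" for x
    using assms(3) that by (auto simp: mod_hom_def)
  have h0: "h \<zero>\<^bsub>M\<^esub> = \<zero>\<^bsub>N\<^esub>"
    by (metis M.R.zero_closed M.M.zero_closed M.smult_r_null N.smult_l_null cl sm M.smult_l_null)
  have inv: "h (\<ominus>\<^bsub>M\<^esub> x) = \<zero>\<^bsub>N\<^esub>" if "x \<in> carrier M" "h x = \<zero>\<^bsub>N\<^esub>" for x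
    by (metis M.M.a_inv_closed M.M.l_neg N.M.r_zero add cl h0 that)
  show ?thesis
    by (intro submodule.intro subgroup.intro)
      (auto simp: submodule_axioms_def add sm h0 inv N.smult_r_null simp flip: a_inv_def)
qed

text \<open>Names for the generators of the successive free modules of a resolution\<close>

datatype ('a, 'm) generator = Base 'm | Combination "(('a, 'm) generator \<times> 'a) list"

lemma (in ring) free_module_generators:
  fixes I :: "('a, 'm) generator set"
  shows "\<exists>g :: (('a, 'm) generator \<Rightarrow> 'a) \<Rightarrow> ('a, 'm) generator. inj_on g (carrier (free_module R I))"
proof -
  let ?F = "carrier (free_module R I)"
  let ?G = "\<lambda>f. (\<lambda>i. (i, f i)) ` {i \<in> I. f i \<noteq> \<zero>}"
  have "\<exists>g. \<forall>f\<in>?F. set (g f) = ?G f"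
    by (intro bchoice ballI) (simp add: free_module_simps finite_list)
  then obtain g where g: "\<And>f. f \<in> ?F \<Longrightarrow> set (g f) = ?G f" by blast
  have "inj_on (\<lambda>f. Combination (g f)) ?F"
  proof (rule inj_onI)
    fix f f' assume f: "f \<in> ?F" and f': "f' \<in> ?F" and "Combination (g f) = Combination (g f')"
    then have "set (g f) = set (g f')" by simp
    then have *: "?G f = ?G f'" by (simp only: g[OF f] g[OF f'])
    have "f i = f' i" for i
    proof (cases "i \<in> I")
      case True
      have "f' i = f i" if "f i \<noteq> \<zero>"
      proof -
        have "(i, f i) \<in> ?G f'" unfolding *[symmetric] using True that by simp
        then show ?thesis by (simp add: image_iff)
      qed
      moreover have "f i = f' i" if "f' i \<noteq> \<zero>"
      proof -
        have "(i, f' i) \<in> ?G f" unfolding * using True that by simp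
        then show ?thesis by (simp add: image_iff)
      qed
      ultimately show ?thesis by metis
    next
      case False
      then show ?thesis using f f' by (auto simp: free_module_simps PiE_iff extensional_def)
    qed
    then show "f = f'" by blast
  qed
  then show ?thesis by (rule exI[where x = "\<lambda>f. Combination (g f)"])
qed

lemma (in ring) free_cover_submodule:
  fixes I :: "('a, 'm) generator set"
  assumes "submodule H R (free_module R I)"
  shows "\<exists>(J :: ('a, 'm) generator set) h.
    h \<in> mod_hom R (free_module R J) (free_module R I) \<and> h ` carrier (free_module R J) = H"
proof -
  interpret F: left_module R "free_module R I" by (rule left_module_free)
  interpret H: submodule H R "free_module R I" by fact
  obtain g :: "(('a, 'm) generator \<Rightarrow> 'a) \<Rightarrow> ('a, 'm) generator"
    where "inj_on g (carrier (free_module R I))"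
    using free_module_generators by blast
  then have "inj_on g H" using H.subset inj_on_subset by fastforce
  then have "inv_into H g ` (g ` H) = H" by simp
  from F.free_cover[OF assms this] show ?thesis by blast
qed

theorem projective_resolution_exists:
  fixes R :: "('a, 'e) ring_scheme" and M :: "('a, 'm) module"
  assumes "left_module R M"
  shows "\<exists>(P :: nat \<Rightarrow> ('a, ('a, 'm) generator \<Rightarrow> 'a) module) d e. projective_resolution R M P d e"
proof -
  interpret M: left_module R M by fact
  let ?F = "\<lambda>I :: ('a, 'm) generator set. free_module R I"
  let ?ker = "\<lambda>I J h. {x \<in> carrier (?F J). h x = \<zero>\<^bsub>?F I\<^esub>}"
  note lm = M.R.left_module_free
  have sub: "submodule (carrier M) R M"
    by (intro submodule.intro subgroup.intro)
      (auto simp: submodule_axioms_def simp flip: a_inv_def)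
  have base: "(\<lambda>g. case g of Base x \<Rightarrow> x | _ \<Rightarrow> undefined) ` (Base ` carrier M) = carrier M"
    by (auto simp: image_image)
  from M.free_cover[OF sub base]
  obtain e and I0 :: "('a, 'm) generator set"
    where e: "e \<in> mod_hom R (?F I0) M" "e ` carrier (?F I0) = carrier M"
    by auto
  obtain I1 d0 where d0: "d0 \<in> mod_hom R (?F I1) (?F I0)"
      "d0 ` carrier (?F I1) = {x \<in> carrier (?F I0). e x = \<zero>\<^bsub>M\<^esub>}"
    using M.R.free_cover_submodule[OF submodule_kernel[OF lm M.left_module_axioms e(1)]] by blast
  define good where "good = (\<lambda>(n::nat) (I, J, h). h \<in> mod_hom R (?F J) (?F I) \<and>
     (n = 0 \<longrightarrow> I = I0 \<and> h ` carrier (?F J) = {x \<in> carrier (?F I0). e x = \<zero>\<^bsub>M\<^esub>}))"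
  define step where "step = (\<lambda>(n::nat) (I, J, h) (I', J', h').
     I' = J \<and> h' ` carrier (?F J') = ?ker I J h)"
  have "\<exists>s. \<forall>n. good n (s n) \<and> step n (s n) (s (Suc n))"
  proof (rule dependent_nat_choice)
    show "\<exists>x. good 0 x" using d0 by (auto simp: good_def)
    fix x n assume x: "good n x"
    obtain I J h where [simp]: "x = (I, J, h)" by (cases x)
    have "h \<in> mod_hom R (?F J) (?F I)" using x by (simp add: good_def)
    from M.R.free_cover_submodule[OF submodule_kernel[OF lm lm this]]
    obtain J' h' where "h' \<in> mod_hom R (?F J') (?F J)" "h' ` carrier (?F J') = ?ker I J h"
      by blast
    then have "good (Suc n) (J, J', h') \<and> step n x (J, J', h')"
      by (simp add: good_def step_def)
    then show "\<exists>y. good (Suc n) y \<and> step n x y" by blast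
  qed
  then obtain s where s: "\<And>n. good n (s n)" "\<And>n. step n (s n) (s (Suc n))" by blast
  define I where "I n = fst (s n)" for n
  define d where "d n = snd (snd (s n))" for n
  have sn: "s n = (I n, I (Suc n), d n)" for n
    using s(2)[of n] by (cases "s n"; cases "s (Suc n)") (auto simp: step_def I_def d_def)
  have "projective_resolution R M (\<lambda>n. ?F (I n)) d e"
    using s e unfolding sn good_def step_def projective_resolution_def
    by (auto simp: M.R.projective_free)
  then show ?thesis by blast
qed

end

theory Submission
  imports Defs
begin

text \<open>
  Finitely many elements of \<open>A\<close> lie in some \<open>B = A(\<lambda>)\<close>, and \<open>A\<close> is a union of free \<open>B\<close>-modules.
  Hence the kernel of a map \<open>A\<^sup>m \<rightarrow> A\<^sup>n\<close> whose matrix has entries in \<open>B\<close> is generated by its finite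
  dimensional part over \<open>B\<close>: \<open>A\<close> is coherent, and coherent modules have resolutions by finitely
  generated free modules. Moreover a map \<open>A\<^sup>m \<rightarrow> A\<close> that vanishes on this kernel factors through
  \<open>A\<^sup>m \<rightarrow> A\<^sup>n\<close>: on matrices over \<open>B\<close>, this is the duality of row and column spaces given by the
  Frobenius form. So cocycles on a finite free resolution are coboundaries, and comparison of
  projective resolutions carries this over to arbitrary ones. Direct sums of resolutions give the
  statement on coproducts. All this is symmetric under passing to the opposite algebra.
\<close>

section \<open>Linear maps and submodules\<close>

text \<open>A map from A^m to A^n of left modules is right multiplication by a matrix, so its
  entries stand to the right of the unknowns. Passing to coordinates over B therefore takes a basis
  of a larger A(l') as a right B-module, with coefficients on the right: writing x as the sum of the
  e * y_e with y_e over B turns x * M = 0 into y_e * M = 0 for each e. Over the opposite algebra the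
  sides swap, and freeness as a left module takes over. Two obstacles shape the rest. Ext is
  computed from an arbitrary projective resolution, living in an arbitrary type, so its vanishing is
  phrased as a property of a resolution that can be carried along a homotopy equivalence. And
  injectivity is not deduced from the vanishing of Ext^1 on a cokernel, which would have to be
  formed and shown coherent; it comes directly from the extension of maps between finite free
  modules.\<close>

text \<open>Linearity without the extensionality imposed by \<^const>\<open>mod_hom\<close>, so that maps compose freely\<close>

definition linear_map ::
  "('a, 'e) ring_scheme \<Rightarrow> ('a, 'm) module \<Rightarrow> ('a, 'n) module \<Rightarrow> ('m \<Rightarrow> 'n) \<Rightarrow> bool" where
  "linear_map R M N f \<longleftrightarrow> f \<in> carrier M \<rightarrow> carrier N \<and>
     (\<forall>x\<in>carrier M. \<forall>y\<in>carrier M. f (x \<oplus>\<^bsub>M\<^esub> y) = f x \<oplus>\<^bsub>N\<^esub> f y) \<and>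
     (\<forall>a\<in>carrier R. \<forall>x\<in>carrier M. f (a \<odot>\<^bsub>M\<^esub> x) = a \<odot>\<^bsub>N\<^esub> f x)"

lemma mod_hom_iff: "f \<in> mod_hom R M N \<longleftrightarrow> linear_map R M N f \<and> f \<in> extensional (carrier M)"
  by (auto simp: mod_hom_def linear_map_def PiE_iff)

lemma linear_mapD:
  assumes "linear_map R M N f"
  shows "x \<in> carrier M \<Longrightarrow> f x \<in> carrier N"
    and "x \<in> carrier M \<Longrightarrow> y \<in> carrier M \<Longrightarrow> f (x \<oplus>\<^bsub>M\<^esub> y) = f x \<oplus>\<^bsub>N\<^esub> f y"
    and "a \<in> carrier R \<Longrightarrow> x \<in> carrier M \<Longrightarrow> f (a \<odot>\<^bsub>M\<^esub> x) = a \<odot>\<^bsub>N\<^esub> f x"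
  using assms by (auto simp: linear_map_def)

lemma linear_map_comp:
  "linear_map R L M f \<Longrightarrow> linear_map R M N g \<Longrightarrow> linear_map R L N (\<lambda>x. g (f x))"
  by (auto simp: linear_map_def Pi_iff)

lemma linear_map_id: "linear_map R M M (\<lambda>x. x)"
  by (simp add: linear_map_def)

lemma mod_hom_restrict:
  assumes "left_module R M" "linear_map R M N f"
  shows "restrict f (carrier M) \<in> mod_hom R M N"
proof -
  interpret left_module R M by fact
  show ?thesis using assms(2) by (auto simp: mod_hom_iff linear_map_def)
qed

lemma left_module_direct_sum:
  assumes "ring R" "\<And>i. i \<in> I \<Longrightarrow> left_module R (M i)"
  shows "left_module R (direct_sum I M)"
proof -
  interpret ring R by fact
  let ?F = "direct_sum I M"
  have mods: "left_module R (M i)" if "i \<in> I" for i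
    using assms that by simp
  have ab: "abelian_group (M i)" if "i \<in> I" for i
    using mods[OF that] by (simp add: left_module_def)
  note simps = direct_sum_def PiE_iff
  have fin_add: "finite {i \<in> I. f i \<oplus>\<^bsub>M i\<^esub> g i \<noteq> \<zero>\<^bsub>M i\<^esub>}"
    if "finite {i \<in> I. f i \<noteq> \<zero>\<^bsub>M i\<^esub>}" "finite {i \<in> I. g i \<noteq> \<zero>\<^bsub>M i\<^esub>}" for f g
    by (rule finite_subset[OF _ finite_UnI[OF that]])
      (auto simp: abelian_monoid.l_zero abelian_group.axioms(1)[OF ab] abelian_monoid.zero_closed)
  have fin_smult: "finite {i \<in> I. a \<odot>\<^bsub>M i\<^esub> f i \<noteq> \<zero>\<^bsub>M i\<^esub>}"
    if "finite {i \<in> I. f i \<noteq> \<zero>\<^bsub>M i\<^esub>}" "a \<in> carrier R" for f a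
    by (rule finite_subset[OF _ that(1)]) (auto simp: left_module.smult_r_null[OF mods that(2)])
  have add_closed: "x \<oplus>\<^bsub>M i\<^esub> y \<in> carrier (M i)" if "i \<in> I" "x \<in> carrier (M i)" "y \<in> carrier (M i)" for i x y
    using abelian_monoid.a_closed[OF abelian_group.axioms(1)[OF ab[OF that(1)]] that(2,3)] .
  have "abelian_group ?F"
  proof (rule abelian_groupI)
    fix f assume f: "f \<in> carrier ?F"
    let ?g = "\<lambda>i\<in>I. \<ominus>\<^bsub>M i\<^esub> f i"
    have "\<ominus>\<^bsub>M i\<^esub> f i = \<zero>\<^bsub>M i\<^esub>" if "i \<in> I" "f i = \<zero>\<^bsub>M i\<^esub>" for i
    proof -
      interpret Mi: abelian_group "M i" by (rule ab[OF that(1)])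
      show ?thesis unfolding that(2) by (rule Mi.minus_equality) simp_all
    qed
    then have "{i \<in> I. ?g i \<noteq> \<zero>\<^bsub>M i\<^esub>} \<subseteq> {i \<in> I. f i \<noteq> \<zero>\<^bsub>M i\<^esub>}" by auto
    then have "finite {i \<in> I. ?g i \<noteq> \<zero>\<^bsub>M i\<^esub>}"
      by (rule finite_subset) (use f in \<open>simp add: direct_sum_def\<close>)
    then have "?g \<in> carrier ?F"
      using f by (auto simp: simps abelian_group.a_inv_closed[OF ab])
    moreover have "?g \<oplus>\<^bsub>?F\<^esub> f = \<zero>\<^bsub>?F\<^esub>"
      using f by (auto simp: simps fun_eq_iff abelian_group.l_neg[OF ab])
    ultimately show "\<exists>g\<in>carrier ?F. g \<oplus>\<^bsub>?F\<^esub> f = \<zero>\<^bsub>?F\<^esub>" by blast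
  next
    fix f g h assume "f \<in> carrier ?F" "g \<in> carrier ?F" "h \<in> carrier ?F"
    then show "f \<oplus>\<^bsub>?F\<^esub> g \<oplus>\<^bsub>?F\<^esub> h = f \<oplus>\<^bsub>?F\<^esub> (g \<oplus>\<^bsub>?F\<^esub> h)"
      by (auto simp: simps fun_eq_iff abelian_monoid.a_assoc[OF abelian_group.axioms(1)[OF ab]])
  next
    fix f g assume "f \<in> carrier ?F" "g \<in> carrier ?F"
    then show "f \<oplus>\<^bsub>?F\<^esub> g = g \<oplus>\<^bsub>?F\<^esub> f"
      by (auto simp: simps fun_eq_iff abelian_monoid.a_comm[OF abelian_group.axioms(1)[OF ab]])
  next
    fix f assume "f \<in> carrier ?F"
    then show "\<zero>\<^bsub>?F\<^esub> \<oplus>\<^bsub>?F\<^esub> f = f"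
      by (auto simp: simps fun_eq_iff extensional_def abelian_monoid.l_zero[OF abelian_group.axioms(1)[OF ab]])
  next
    fix f g assume "f \<in> carrier ?F" "g \<in> carrier ?F"
    then show "f \<oplus>\<^bsub>?F\<^esub> g \<in> carrier ?F"
      by (auto simp: simps add_closed fin_add cong: conj_cong)
  next
    show "\<zero>\<^bsub>?F\<^esub> \<in> carrier ?F"
      using abelian_monoid.zero_closed[OF abelian_group.axioms(1)[OF ab]]
      by (auto simp: simps cong: conj_cong)
  qed
  moreover have "left_module_axioms R ?F"
    unfolding left_module_axioms_def
    by (auto simp: simps fun_eq_iff extensional_def fin_smult
        left_module.smult_closed[OF mods] left_module.smult_l_distr[OF mods]
        left_module.smult_r_distr[OF mods] left_module.smult_assoc1[OF mods]
        left_module.smult_one[OF mods] cong: conj_cong)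
  ultimately show ?thesis
    by (simp add: left_module_def ring_axioms)
qed

lemma left_module_regular: "ring R \<Longrightarrow> left_module R (regular R)"
proof -
  assume "ring R"
  then interpret ring R .
  have "abelian_group (regular R)"
    by (rule abelian_groupI) (auto simp: a_ac intro: l_neg)
  then show ?thesis
    by (simp add: left_module_def ring_axioms left_module_axioms_def l_distr r_distr m_assoc)
qed

text \<open>The same additive structure occurs in several records: a ring and its regular module, a
  module and its submodules, an algebra and its restrictions of scalars. This moves finite sums
  between them.\<close>

lemma finsum_same_add:
  assumes "abelian_monoid M" "abelian_monoid N" "carrier M \<subseteq> carrier N" "\<zero>\<^bsub>M\<^esub> = \<zero>\<^bsub>N\<^esub>"
    and add: "\<And>x y. x \<in> carrier M \<Longrightarrow> y \<in> carrier M \<Longrightarrow> x \<oplus>\<^bsub>M\<^esub> y = x \<oplus>\<^bsub>N\<^esub> y"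
    and "finite T" "f \<in> T \<rightarrow> carrier M"
  shows "finsum M f T = finsum N f T"
proof -
  interpret M: abelian_monoid M by fact
  interpret N: abelian_monoid N by fact
  show ?thesis using assms(6,7)
  proof (induction T rule: finite_induct)
    case (insert x T)
    then have "f \<in> T \<rightarrow> carrier M" "f x \<in> carrier M" by auto
    moreover from this have "f \<in> T \<rightarrow> carrier N" "f x \<in> carrier N" using assms(3) by auto
    ultimately show ?case using insert by (simp add: add flip: insert.IH)
  qed (simp add: assms(4))
qed

lemma finsum_regular:
  assumes "ring R" "finite T" "f \<in> T \<rightarrow> carrier R"
  shows "finsum (regular R) f T = finsum R f T"
proof -
  interpret ring R by fact
  interpret M: left_module R "regular R" by (rule left_module_regular) fact
  show ?thesis
    by (rule finsum_same_add[OF M.M.abelian_monoid_axioms abelian_monoid_axioms]) (use assms in auto)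
qed

text \<open>Closure under negatives, which the library notion of submodule contains, comes for free:
  -x is (-1) times x.\<close>

lemma left_module_submoduleI:
  assumes "left_module R M" "H \<subseteq> carrier M" "\<zero>\<^bsub>M\<^esub> \<in> H"
    and "\<And>x y. x \<in> H \<Longrightarrow> y \<in> H \<Longrightarrow> x \<oplus>\<^bsub>M\<^esub> y \<in> H"
    and "\<And>a x. a \<in> carrier R \<Longrightarrow> x \<in> H \<Longrightarrow> a \<odot>\<^bsub>M\<^esub> x \<in> H"
  shows "submodule H R M"
proof -
  interpret left_module R M by fact
  have neg: "\<ominus>\<^bsub>M\<^esub> x \<in> H" if x: "x \<in> H" for x
  proof -
    have xM: "x \<in> carrier M" using x assms(2) by auto
    have "(\<ominus>\<^bsub>R\<^esub> \<one>\<^bsub>R\<^esub>) \<odot>\<^bsub>M\<^esub> x \<oplus>\<^bsub>M\<^esub> x = (\<ominus>\<^bsub>R\<^esub> \<one>\<^bsub>R\<^esub> \<oplus>\<^bsub>R\<^esub> \<one>\<^bsub>R\<^esub>) \<odot>\<^bsub>M\<^esub> x"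
      using xM by (simp add: smult_l_distr)
    also have "\<dots> = \<zero>\<^bsub>M\<^esub>" using xM by (simp add: R.l_neg smult_l_null)
    finally have "(\<ominus>\<^bsub>R\<^esub> \<one>\<^bsub>R\<^esub>) \<odot>\<^bsub>M\<^esub> x = \<ominus>\<^bsub>M\<^esub> x"
      using xM by (simp add: M.minus_equality)
    then show ?thesis using assms(5)[OF _ x] by (metis R.a_inv_closed R.one_closed)
  qed
  show ?thesis
    by (intro submodule.intro subgroup.intro)
      (use assms neg in \<open>auto simp: submodule_axioms_def simp flip: a_inv_def\<close>)
qed

lemma submoduleD:
  assumes "submodule H R M"
  shows "H \<subseteq> carrier M" "\<zero>\<^bsub>M\<^esub> \<in> H"
    and "x \<in> H \<Longrightarrow> y \<in> H \<Longrightarrow> x \<oplus>\<^bsub>M\<^esub> y \<in> H"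
    and "a \<in> carrier R \<Longrightarrow> x \<in> H \<Longrightarrow> a \<odot>\<^bsub>M\<^esub> x \<in> H"
    and "x \<in> H \<Longrightarrow> \<ominus>\<^bsub>M\<^esub> x \<in> H"
proof -
  interpret submodule H R M by fact
  show "H \<subseteq> carrier M" "\<zero>\<^bsub>M\<^esub> \<in> H" using subset one_closed by auto
  show "x \<in> H \<Longrightarrow> y \<in> H \<Longrightarrow> x \<oplus>\<^bsub>M\<^esub> y \<in> H" using m_closed by auto
  show "a \<in> carrier R \<Longrightarrow> x \<in> H \<Longrightarrow> a \<odot>\<^bsub>M\<^esub> x \<in> H" by auto
  show "x \<in> H \<Longrightarrow> \<ominus>\<^bsub>M\<^esub> x \<in> H" using m_inv_closed by (auto simp: a_inv_def)
qed

lemma linear_map_zero: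
  assumes "left_module R M" "left_module R N" "linear_map R M N f"
  shows "f \<zero>\<^bsub>M\<^esub> = \<zero>\<^bsub>N\<^esub>"
proof -
  interpret M: left_module R M by fact
  interpret N: left_module R N by fact
  have "f \<zero>\<^bsub>M\<^esub> = \<zero>\<^bsub>R\<^esub> \<odot>\<^bsub>N\<^esub> f \<zero>\<^bsub>M\<^esub>"
    using linear_mapD(3)[OF assms(3), of "\<zero>\<^bsub>R\<^esub>" "\<zero>\<^bsub>M\<^esub>"] by (simp add: M.smult_l_null)
  then show ?thesis using linear_mapD(1)[OF assms(3)] by (simp add: N.smult_l_null)
qed

lemma linear_map_minus:
  assumes "left_module R M" "left_module R N" "linear_map R M N f" "x \<in> carrier M" "y \<in> carrier M"
  shows "f (x \<ominus>\<^bsub>M\<^esub> y) = f x \<ominus>\<^bsub>N\<^esub> f y"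
proof -
  interpret M: left_module R M by fact
  interpret N: left_module R N by fact
  note f = linear_mapD[OF assms(3)]
  have "f (\<ominus>\<^bsub>M\<^esub> y) \<oplus>\<^bsub>N\<^esub> f y = \<zero>\<^bsub>N\<^esub>"
    using f(2)[of "\<ominus>\<^bsub>M\<^esub> y" y] assms(5) linear_map_zero[OF assms(1-3)] by (simp add: M.l_neg)
  then have "f (\<ominus>\<^bsub>M\<^esub> y) = \<ominus>\<^bsub>N\<^esub> f y"
    using f(1) assms(5) by (metis M.a_inv_closed N.minus_equality)
  then show ?thesis using f assms by (simp add: a_minus_def)
qed

lemma linear_map_finsum:
  assumes "left_module R M" "left_module R N" "linear_map R M N f"
    and "finite T" "x \<in> T \<rightarrow> carrier M"
  shows "f (\<Oplus>\<^bsub>M\<^esub>i\<in>T. x i) = (\<Oplus>\<^bsub>N\<^esub>i\<in>T. f (x i))"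
proof -
  interpret M: left_module R M by fact
  interpret N: left_module R N by fact
  note f = linear_mapD[OF assms(3)]
  show ?thesis using assms(4,5)
  proof (induction T rule: finite_induct)
    case empty then show ?case using linear_map_zero[OF assms(1-3)] by simp
  next
    case (insert i T)
    then have x: "x \<in> T \<rightarrow> carrier M" "x i \<in> carrier M" by auto
    then have fx: "(\<lambda>i. f (x i)) \<in> T \<rightarrow> carrier N" "f (x i) \<in> carrier N"
      by (auto intro!: f(1))
    have "f (\<Oplus>\<^bsub>M\<^esub>i\<in>insert i T. x i) = f (x i) \<oplus>\<^bsub>N\<^esub> f (\<Oplus>\<^bsub>M\<^esub>i\<in>T. x i)"
      by (simp only: M.M.finsum_insert[OF insert(1,2) x] f(2)[OF x(2) M.M.finsum_closed[OF x(1)]])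
    then show ?case
      by (simp only: insert(3)[OF x(1)] N.M.finsum_insert[OF insert(1,2) fx])
  qed
qed

lemma linear_map_diff:
  assumes "left_module R M" "left_module R N" "linear_map R M N f" "linear_map R M N g"
  shows "linear_map R M N (\<lambda>x. f x \<ominus>\<^bsub>N\<^esub> g x)"
proof -
  interpret M: left_module R M by fact
  interpret N: left_module R N by fact
  note f = linear_mapD[OF assms(3)] and g = linear_mapD[OF assms(4)]
  have sm: "a \<odot>\<^bsub>N\<^esub> (\<ominus>\<^bsub>N\<^esub> y) = \<ominus>\<^bsub>N\<^esub> (a \<odot>\<^bsub>N\<^esub> y)" if "a \<in> carrier R" "y \<in> carrier N" for a y
  proof -
    have "a \<odot>\<^bsub>N\<^esub> (\<ominus>\<^bsub>N\<^esub> y) \<oplus>\<^bsub>N\<^esub> a \<odot>\<^bsub>N\<^esub> y = \<zero>\<^bsub>N\<^esub>"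
      using that by (simp flip: N.smult_r_distr add: N.M.l_neg N.smult_r_null)
    then show ?thesis using that by (metis N.M.a_inv_closed N.minus_equality N.smult_closed)
  qed
  have "f x \<oplus>\<^bsub>N\<^esub> f y \<ominus>\<^bsub>N\<^esub> (g x \<oplus>\<^bsub>N\<^esub> g y) = (f x \<ominus>\<^bsub>N\<^esub> g x) \<oplus>\<^bsub>N\<^esub> (f y \<ominus>\<^bsub>N\<^esub> g y)"
    if "x \<in> carrier M" "y \<in> carrier M" for x y
    using f(1)[OF that(1)] f(1)[OF that(2)] g(1)[OF that(1)] g(1)[OF that(2)]
    by (simp add: a_minus_def N.minus_add N.M.a_ac)
  then show ?thesis
    using f g by (auto simp: linear_map_def a_minus_def N.smult_r_distr sm)
qed

lemma linear_map_add:
  assumes "left_module R M" "left_module R N" "linear_map R M N f" "linear_map R M N g"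
  shows "linear_map R M N (\<lambda>x. f x \<oplus>\<^bsub>N\<^esub> g x)"
proof -
  interpret M: left_module R M by fact
  interpret N: left_module R N by fact
  note f = linear_mapD[OF assms(3)] and g = linear_mapD[OF assms(4)]
  show ?thesis
    using f g by (auto simp: linear_map_def N.smult_r_distr N.M.a_ac)
qed

lemma submodule_finsum:
  assumes "left_module R M" "submodule H R M" "finite T" "x \<in> T \<rightarrow> H"
  shows "(\<Oplus>\<^bsub>M\<^esub>i\<in>T. x i) \<in> H"
proof -
  interpret M: left_module R M by fact
  note H = submoduleD[OF assms(2)]
  show ?thesis using assms(3,4)
  proof (induction T rule: finite_induct)
    case empty then show ?case using H by simp
  next
    case (insert i T)
    then have "x \<in> T \<rightarrow> carrier M" "x i \<in> carrier M" using H(1) by auto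
    with insert H(3) show ?case by simp
  qed
qed

lemma left_module_submodule:
  assumes "left_module R M" "submodule H R M"
  shows "left_module R (M\<lparr>carrier := H\<rparr>)"
proof -
  interpret M: left_module R M by fact
  note H = submoduleD[OF assms(2)]
  have HM: "x \<in> H \<Longrightarrow> x \<in> carrier M" for x using H(1) by auto
  have "abelian_group (M\<lparr>carrier := H\<rparr>)"
    by (rule abelian_groupI)
      (use H HM in \<open>auto simp: M.M.a_ac intro!: bexI[of _ "\<ominus>\<^bsub>M\<^esub> x" for x] M.M.r_neg\<close>)
  then show ?thesis
    using H HM by (simp add: left_module_def M.ring_axioms left_module_axioms_def M.smult_l_distr
        M.smult_r_distr M.smult_assoc1)
qed

lemma finsum_submodule:
  assumes "left_module R M" "submodule H R M" "finite T" "x \<in> T \<rightarrow> H"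
  shows "(\<Oplus>\<^bsub>M\<lparr>carrier := H\<rparr>\<^esub>i\<in>T. x i) = (\<Oplus>\<^bsub>M\<^esub>i\<in>T. x i)"
proof -
  interpret M: left_module R M by fact
  interpret H: left_module R "M\<lparr>carrier := H\<rparr>" by (rule left_module_submodule[OF assms(1,2)])
  show ?thesis
    by (rule finsum_same_add[OF H.M.abelian_monoid_axioms M.M.abelian_monoid_axioms])
      (use assms submoduleD(1)[OF assms(2)] in auto)
qed

lemma submodule_image:
  assumes "left_module R M" "left_module R N" "linear_map R M N f" "submodule H R M"
  shows "submodule (f ` H) R N"
proof (rule left_module_submoduleI[OF assms(2)])
  note f = linear_mapD[OF assms(3)] and H = submoduleD[OF assms(4)]
  have HM: "x \<in> H \<Longrightarrow> x \<in> carrier M" for x using H(1) by auto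
  show "f ` H \<subseteq> carrier N" using f HM by auto
  show "\<zero>\<^bsub>N\<^esub> \<in> f ` H" using linear_map_zero[OF assms(1-3)] H(2) by (metis image_eqI)
  show "x \<oplus>\<^bsub>N\<^esub> y \<in> f ` H" if "x \<in> f ` H" "y \<in> f ` H" for x y
    using that f(2) HM H(3) by (auto simp flip: f(2))
  show "a \<odot>\<^bsub>N\<^esub> x \<in> f ` H" if "a \<in> carrier R" "x \<in> f ` H" for a x
    using that HM H(4) by (auto simp flip: f(3))
qed

lemma submodule_carrier: "left_module R M \<Longrightarrow> submodule (carrier M) R M"
proof -
  assume "left_module R M"
  then interpret left_module R M .
  show ?thesis by (rule left_module_submoduleI[OF \<open>left_module R M\<close>]) auto
qed

lemma submodule_vimage:
  assumes "left_module R M" "left_module R N" "linear_map R M N f" "submodule H R N"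
  shows "submodule {x \<in> carrier M. f x \<in> H} R M"
proof (rule left_module_submoduleI[OF assms(1)])
  interpret M: left_module R M by fact
  note f = linear_mapD[OF assms(3)] and H = submoduleD[OF assms(4)]
  show "\<zero>\<^bsub>M\<^esub> \<in> {x \<in> carrier M. f x \<in> H}" using linear_map_zero[OF assms(1-3)] H(2) by simp
qed (use linear_mapD[OF assms(3)] submoduleD[OF assms(4)] assms(1) in
    \<open>auto simp: left_module_def left_module.smult_closed abelian_group_def abelian_monoid.a_closed\<close>)

lemma submodule_ker:
  assumes "left_module R M" "left_module R N" "linear_map R M N f"
  shows "submodule {x \<in> carrier M. f x = \<zero>\<^bsub>N\<^esub>} R M"
proof -
  interpret N: left_module R N by fact
  have "submodule {\<zero>\<^bsub>N\<^esub>} R N"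
    by (rule left_module_submoduleI[OF assms(2)]) (auto simp: N.smult_r_null)
  from submodule_vimage[OF assms this] show ?thesis by simp
qed

section \<open>Lifting along surjections and comparison of resolutions\<close>

lemma linear_map_lin_ext:
  assumes "left_module R M" "e \<in> I \<rightarrow> carrier M"
  shows "linear_map R (free_module R I) M (left_module.lin_ext R M I e)"
  using left_module.lin_ext_hom[OF assms] by (simp add: mod_hom_iff)

text \<open>The identity of the free module is the extension of its own unit vectors, and linear
  maps commute with \<open>lin_ext\<close>.\<close>

lemma linear_map_free_eq:
  assumes "left_module R M" "linear_map R (free_module R I) M f" "x \<in> carrier (free_module R I)"
  shows "f x = left_module.lin_ext R M I (\<lambda>i. f (single R I i)) x"
proof -
  interpret M: left_module R M by fact
  let ?F = "free_module R I"
  have F: "left_module R ?F" by (rule M.R.left_module_free)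
  have "restrict f (carrier ?F) \<in> mod_hom R ?F M" by (rule mod_hom_restrict[OF F assms(2)])
  moreover have "single R I \<in> I \<rightarrow> carrier ?F" using M.R.single_closed by auto
  ultimately
  have "restrict f (carrier ?F) x = M.lin_ext I (restrict f (carrier ?F) \<circ> single R I) x"
    using mod_hom_lin_ext[OF F assms(1) _ _ assms(3), of _ "single R I"]
    by (simp only: M.R.lin_ext_single_id[OF assms(3)])
  moreover have "restrict f (carrier ?F) \<circ> single R I = (\<lambda>i. f (single R I i))"
    by (auto simp: fun_eq_iff M.R.single_closed)
  ultimately show ?thesis using assms(3) by simp
qed

lemma linear_map_free_ext:
  assumes "left_module R M" "linear_map R (free_module R I) M f" "linear_map R (free_module R I) M g"
    and "\<And>i. i \<in> I \<Longrightarrow> f (single R I i) = g (single R I i)" and x: "x \<in> carrier (free_module R I)"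
  shows "f x = g x"
proof -
  interpret M: left_module R M by fact
  have "M.lin_ext I (\<lambda>i. f (single R I i)) x = M.lin_ext I (\<lambda>i. g (single R I i)) x"
    using assms(4) linear_mapD(1)[OF assms(3) M.R.single_closed] x
    by (auto intro!: M.M.finsum_cong' simp: M.lin_ext_def free_module_simps PiE_iff)
  then show ?thesis
    by (simp add: linear_map_free_eq[OF assms(1,2) x] linear_map_free_eq[OF assms(1,3) x])
qed

text \<open>Only the values at the unit vectors need preimages under \<open>g\<close>; any choice of
  these extends linearly, and the two composites agree because they agree on unit vectors.\<close>

lemma lift_free:
  assumes L: "left_module R L" and N: "left_module R N"
    and f: "linear_map R (free_module R I) N f" and g: "linear_map R L N g"
    and sub: "f ` carrier (free_module R I) \<subseteq> g ` carrier L"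
  shows "\<exists>h. linear_map R (free_module R I) L h \<and> (\<forall>x\<in>carrier (free_module R I). g (h x) = f x)"
proof -
  interpret L: left_module R L by fact
  have "\<forall>i\<in>I. \<exists>y\<in>carrier L. g y = f (single R I i)"
  proof
    fix i
    have "f (single R I i) \<in> g ` carrier L"
      by (rule subsetD[OF sub imageI[OF L.R.single_closed]])
    then show "\<exists>y\<in>carrier L. g y = f (single R I i)" by (elim imageE) auto
  qed
  then obtain l where "\<forall>i\<in>I. l i \<in> carrier L" "\<forall>i\<in>I. g (l i) = f (single R I i)"
    by metis
  then have l: "l i \<in> carrier L" "g (l i) = f (single R I i)" if "i \<in> I" for i
    using that by simp_all
  then have lI: "l \<in> I \<rightarrow> carrier L" by auto
  have h: "linear_map R (free_module R I) L (L.lin_ext I l)" by (rule linear_map_lin_ext[OF L lI])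
  have "g (L.lin_ext I l x) = f x" if "x \<in> carrier (free_module R I)" for x
    by (rule linear_map_free_ext[OF N linear_map_comp[OF h g] f _ that])
      (simp add: L.lin_ext_single[OF lI] l)
  with h show ?thesis by blast
qed

text \<open>A projective module is a retract of a free one: lift \<open>f\<close> composed with the
  retraction, then precompose with the section.\<close>

lemma lift_projective:
  assumes P: "projective_module R P" and L: "left_module R L" and N: "left_module R N"
    and f: "linear_map R P N f" and g: "linear_map R L N g"
    and sub: "f ` carrier P \<subseteq> g ` carrier L"
  shows "\<exists>h. linear_map R P L h \<and> (\<forall>x\<in>carrier P. g (h x) = f x)"
proof -
  let ?F = "free_module R (carrier P)"
  obtain i r where i: "linear_map R P ?F i" and r: "linear_map R ?F P r"
    and ri: "\<And>x. x \<in> carrier P \<Longrightarrow> r (i x) = x"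
    using P by (auto simp: projective_module_def mod_hom_iff)
  have "(\<lambda>x. f (r x)) ` carrier ?F \<subseteq> g ` carrier L"
    using sub linear_mapD(1)[OF r] by blast
  then obtain h where h: "linear_map R ?F L h" "\<And>x. x \<in> carrier ?F \<Longrightarrow> g (h x) = f (r x)"
    using lift_free[OF L N linear_map_comp[OF r f] g] by blast
  show ?thesis
    using linear_map_comp[OF i h(1)] h(2) linear_mapD(1)[OF i] ri by auto
qed

lemma projective_resolutionD:
  assumes "projective_resolution R M P d e"
  shows "projective_module R (P n)" "left_module R (P n)"
    and "linear_map R (P (Suc n)) (P n) (d n)" "linear_map R (P 0) M e"
    and "e ` carrier (P 0) = carrier M"
    and "d 0 ` carrier (P (Suc 0)) = {x \<in> carrier (P 0). e x = \<zero>\<^bsub>M\<^esub>}"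
    and "d (Suc n) ` carrier (P (Suc (Suc n))) = {x \<in> carrier (P (Suc n)). d n x = \<zero>\<^bsub>P n\<^esub>}"
    and "x \<in> carrier (P (Suc 0)) \<Longrightarrow> e (d 0 x) = \<zero>\<^bsub>M\<^esub>"
    and "y \<in> carrier (P (Suc (Suc n))) \<Longrightarrow> d n (d (Suc n) y) = \<zero>\<^bsub>P n\<^esub>"
proof -
  note a = assms[unfolded projective_resolution_def mod_hom_iff]
  show "projective_module R (P n)" "linear_map R (P (Suc n)) (P n) (d n)" "linear_map R (P 0) M e"
    "e ` carrier (P 0) = carrier M"
    using a by simp_all
  show "left_module R (P n)" using a by (simp add: projective_module_def)
  show 0: "d 0 ` carrier (P (Suc 0)) = {x \<in> carrier (P 0). e x = \<zero>\<^bsub>M\<^esub>}" using a by simp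
  show 1: "d (Suc n) ` carrier (P (Suc (Suc n))) = {x \<in> carrier (P (Suc n)). d n x = \<zero>\<^bsub>P n\<^esub>}"
    using a by simp
  show "x \<in> carrier (P (Suc 0)) \<Longrightarrow> e (d 0 x) = \<zero>\<^bsub>M\<^esub>"
    using 0 by blast
  show "y \<in> carrier (P (Suc (Suc n))) \<Longrightarrow> d n (d (Suc n) y) = \<zero>\<^bsub>P n\<^esub>"
    using 1 by blast
qed

text \<open>Comparison theorem for projective resolutions: the identity of \<open>M\<close> lifts to
  a chain map, constructed degree by degree. The two resolutions may live in different
  types.\<close>

lemma comparison_map:
  fixes P :: "nat \<Rightarrow> ('a, 'p) module" and Q :: "nat \<Rightarrow> ('a, 'q) module"
  assumes M: "left_module R M" and P: "projective_resolution R M P d e"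
    and Q: "projective_resolution R M Q \<delta> \<epsilon>"
  shows "\<exists>\<psi>. (\<forall>n. linear_map R (P n) (Q n) (\<psi> n)) \<and>
    (\<forall>x\<in>carrier (P 0). \<epsilon> (\<psi> 0 x) = e x) \<and>
    (\<forall>n. \<forall>x\<in>carrier (P (Suc n)). \<delta> n (\<psi> (Suc n) x) = \<psi> n (d n x))"
proof -
  note P = projective_resolutionD[OF P] and Q = projective_resolutionD[OF Q]
  \<comment> \<open>The inclusion of images in \<open>good\<close> is exactly the hypothesis needed
    to lift once more. In degree 0 it follows from compatibility with the augmentations, later from
    exactness of \<open>Q\<close>.\<close>
  define good where "good n \<psi> \<longleftrightarrow> linear_map R (P n) (Q n) \<psi> \<and>
    (\<lambda>x. \<psi> (d n x)) ` carrier (P (Suc n)) \<subseteq> \<delta> n ` carrier (Q (Suc n)) \<and>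
    (n = 0 \<longrightarrow> (\<forall>x\<in>carrier (P 0). \<epsilon> (\<psi> x) = e x))" for n \<psi>
  define step where "step n \<psi> \<psi>' \<longleftrightarrow> (\<forall>x\<in>carrier (P (Suc n)). \<delta> n (\<psi>' x) = \<psi> (d n x))"
    for n and \<psi> \<psi>' :: "'p \<Rightarrow> 'q"
  have "\<exists>\<psi>. \<forall>n. good n (\<psi> n) \<and> step n (\<psi> n) (\<psi> (Suc n))"
  proof (rule dependent_nat_choice)
    have "e ` carrier (P 0) \<subseteq> \<epsilon> ` carrier (Q 0)" using P(5) Q(5) by simp
    then obtain \<psi> where \<psi>: "linear_map R (P 0) (Q 0) \<psi>" "\<And>x. x \<in> carrier (P 0) \<Longrightarrow> \<epsilon> (\<psi> x) = e x"
      using lift_projective[OF P(1) Q(2) M P(4) Q(4)] by blast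
    have "good 0 \<psi>"
      using \<psi> Q(6) P(8) linear_mapD(1)[OF P(3)] linear_mapD(1)[OF \<psi>(1)] by (auto simp: good_def)
    then show "\<exists>\<psi>. good 0 \<psi>" by blast
  next
    fix \<psi> n assume good: "good n \<psi>"
    then have lin: "linear_map R (P n) (Q n) \<psi>" by (simp add: good_def)
    have "(\<lambda>x. \<psi> (d n x)) ` carrier (P (Suc n)) \<subseteq> \<delta> n ` carrier (Q (Suc n))"
      using good by (simp add: good_def)
    then obtain \<psi>' where \<psi>': "linear_map R (P (Suc n)) (Q (Suc n)) \<psi>'"
        "\<And>x. x \<in> carrier (P (Suc n)) \<Longrightarrow> \<delta> n (\<psi>' x) = \<psi> (d n x)"
      using lift_projective[OF P(1) Q(2) Q(2) linear_map_comp[OF P(3) lin] Q(3)] by blast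
    have "\<psi>' (d (Suc n) x) \<in> \<delta> (Suc n) ` carrier (Q (Suc (Suc n)))" if x: "x \<in> carrier (P (Suc (Suc n)))" for x
    proof -
      have "d (Suc n) x \<in> carrier (P (Suc n))" using linear_mapD(1)[OF P(3) x] .
      moreover from this have "\<delta> n (\<psi>' (d (Suc n) x)) = \<zero>\<^bsub>Q n\<^esub>"
        using \<psi>'(2) P(9)[OF x] linear_map_zero[OF P(2) Q(2) lin] by simp
      ultimately show ?thesis using Q(7) linear_mapD(1)[OF \<psi>'(1)] by blast
    qed
    then have "good (Suc n) \<psi>' \<and> step n \<psi> \<psi>'"
      using \<psi>' by (auto simp: good_def step_def)
    then show "\<exists>\<psi>'. good (Suc n) \<psi>' \<and> step n \<psi> \<psi>'" by blast
  qed
  then show ?thesis by (auto simp: good_def step_def)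
qed

text \<open>A chain endomorphism that covers the zero map of \<open>M\<close> is null-homotopic. It
  is meant for the difference of the identity and a composite of two comparison maps. The homotopy
  formula is recorded in positive degrees, those where Ext is to vanish.\<close>

lemma null_homotopy:
  fixes P :: "nat \<Rightarrow> ('a, 'p) module"
  assumes M: "left_module R M" and P: "projective_resolution R M P d e"
    and \<alpha>: "\<And>n. linear_map R (P n) (P n) (\<alpha> n)" "\<And>x. x \<in> carrier (P 0) \<Longrightarrow> e (\<alpha> 0 x) = \<zero>\<^bsub>M\<^esub>"
      "\<And>n x. x \<in> carrier (P (Suc n)) \<Longrightarrow> d n (\<alpha> (Suc n) x) = \<alpha> n (d n x)"
  shows "\<exists>h. (\<forall>n. linear_map R (P n) (P (Suc n)) (h n)) \<and>
    (\<forall>n. \<forall>x\<in>carrier (P (Suc n)). \<alpha> (Suc n) x = d (Suc n) (h (Suc n) x) \<oplus>\<^bsub>P (Suc n)\<^esub> h n (d n x))"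
proof -
  note P = projective_resolutionD[OF P]
  \<comment> \<open>In degree 0, \<open>d 0\<close> composed with \<open>h\<close> is all of
    \<open>\<alpha> 0\<close>. In higher degrees this holds on boundaries only, and that is enough
    to make \<alpha> - h d a cycle one degree up, hence liftable.\<close>
  define good where "good n h \<longleftrightarrow> linear_map R (P n) (P (Suc n)) h \<and>
    (\<forall>x\<in>carrier (P (Suc n)). d n (h (d n x)) = \<alpha> n (d n x))" for n h
  define step where "step n h h' \<longleftrightarrow>
      (\<forall>x\<in>carrier (P (Suc n)). d (Suc n) (h' x) = \<alpha> (Suc n) x \<ominus>\<^bsub>P (Suc n)\<^esub> h (d n x))"
    for n and h h' :: "'p \<Rightarrow> 'p"
  have "\<exists>h. \<forall>n. good n (h n) \<and> step n (h n) (h (Suc n))"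
  proof (rule dependent_nat_choice)
    have "\<alpha> 0 ` carrier (P 0) \<subseteq> d 0 ` carrier (P (Suc 0))"
      using P(6) \<alpha>(2) linear_mapD(1)[OF \<alpha>(1)] by auto
    then obtain h where "linear_map R (P 0) (P (Suc 0)) h" "\<And>x. x \<in> carrier (P 0) \<Longrightarrow> d 0 (h x) = \<alpha> 0 x"
      using lift_projective[OF P(1) P(2) P(2) \<alpha>(1) P(3)] by blast
    then have "good 0 h" using linear_mapD(1)[OF P(3)] by (auto simp: good_def)
    then show "\<exists>h. good 0 h" by blast
  next
    fix h n assume good: "good n h"
    interpret P: left_module R "P (Suc n)" by (rule P(2))
    interpret Pn: left_module R "P n" by (rule P(2))
    have lin: "linear_map R (P n) (P (Suc n)) h" using good by (simp add: good_def)
    let ?f = "\<lambda>x. \<alpha> (Suc n) x \<ominus>\<^bsub>P (Suc n)\<^esub> h (d n x)"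
    have f: "linear_map R (P (Suc n)) (P (Suc n)) ?f"
      by (rule linear_map_diff[OF P(2) P(2) \<alpha>(1) linear_map_comp[OF P(3) lin]])
    have "?f x \<in> d (Suc n) ` carrier (P (Suc (Suc n)))" if x: "x \<in> carrier (P (Suc n))" for x
    proof -
      have dx: "d n x \<in> carrier (P n)" using linear_mapD(1)[OF P(3) x] .
      have hdx: "h (d n x) \<in> carrier (P (Suc n))" using linear_mapD(1)[OF lin dx] .
      have "d n (?f x) = d n (\<alpha> (Suc n) x) \<ominus>\<^bsub>P n\<^esub> d n (h (d n x))"
        by (rule linear_map_minus[OF P(2) P(2) P(3) linear_mapD(1)[OF \<alpha>(1) x] hdx])
      also have "\<dots> = \<zero>\<^bsub>P n\<^esub>"
        using good x \<alpha>(3)[OF x] linear_mapD(1)[OF \<alpha>(1) dx] by (simp add: good_def Pn.M.r_neg a_minus_def)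
      finally show ?thesis using linear_mapD(1)[OF f x] P(7) by blast
    qed
    then have "?f ` carrier (P (Suc n)) \<subseteq> d (Suc n) ` carrier (P (Suc (Suc n)))" by blast
    then obtain h' where h': "linear_map R (P (Suc n)) (P (Suc (Suc n))) h'"
        "\<And>x. x \<in> carrier (P (Suc n)) \<Longrightarrow> d (Suc n) (h' x) = ?f x"
      using lift_projective[OF P(1) P(2) P(2) f P(3)] by blast
    have "d (Suc n) (h' (d (Suc n) x)) = \<alpha> (Suc n) (d (Suc n) x)" if x: "x \<in> carrier (P (Suc (Suc n)))" for x
    proof -
      have dx: "d (Suc n) x \<in> carrier (P (Suc n))" using linear_mapD(1)[OF P(3) x] .
      have "h (d n (d (Suc n) x)) = \<zero>\<^bsub>P (Suc n)\<^esub>"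
        using P(9)[OF x] linear_map_zero[OF P(2) P(2) lin] by simp
      then show ?thesis
        using h'(2)[OF dx] linear_mapD(1)[OF \<alpha>(1) dx] by (simp add: a_minus_def)
    qed
    then have "good (Suc n) h' \<and> step n h h'" using h' by (simp add: good_def step_def)
    then show "\<exists>h'. good (Suc n) h' \<and> step n h h'" by blast
  qed
  then obtain h where h: "\<And>n. linear_map R (P n) (P (Suc n)) (h n)"
    "\<And>n x. x \<in> carrier (P (Suc n)) \<Longrightarrow> d (Suc n) (h (Suc n) x) = \<alpha> (Suc n) x \<ominus>\<^bsub>P (Suc n)\<^esub> h n (d n x)"
    by (auto simp: good_def step_def)
  have "\<alpha> (Suc n) x = d (Suc n) (h (Suc n) x) \<oplus>\<^bsub>P (Suc n)\<^esub> h n (d n x)" if x: "x \<in> carrier (P (Suc n))" for n x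
  proof -
    interpret P: left_module R "P (Suc n)" by (rule P(2))
    have "h n (d n x) \<in> carrier (P (Suc n))" "\<alpha> (Suc n) x \<in> carrier (P (Suc n))"
      using linear_mapD(1)[OF h(1)] linear_mapD(1)[OF P(3) x] linear_mapD(1)[OF \<alpha>(1) x] by auto
    then show ?thesis unfolding h(2)[OF x] by (simp add: a_minus_def P.M.a_assoc P.M.l_neg)
  qed
  with h(1) show ?thesis by blast
qed

section \<open>Vanishing of Ext and its independence of the resolution\<close>

text \<open>Exactness of Hom(P, N) in degree \<open>Suc s\<close>; the index \<open>s\<close> is
  that of the coboundary's source. Quotient groups and extensionality are kept out, so that the
  condition can be transported by composing maps.\<close>

definition cocycles_bound ::
  "('a, 'e) ring_scheme \<Rightarrow> (nat \<Rightarrow> ('a, 'p) module) \<Rightarrow> (nat \<Rightarrow> 'p \<Rightarrow> 'p) \<Rightarrow>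
   ('a, 'n) module \<Rightarrow> nat \<Rightarrow> bool" where
  "cocycles_bound R P d N s \<longleftrightarrow>
     (\<forall>f. linear_map R (P (Suc s)) N f \<and> (\<forall>x\<in>carrier (P (Suc (Suc s))). f (d (Suc s) x) = \<zero>\<^bsub>N\<^esub>)
        \<longrightarrow> (\<exists>g. linear_map R (P s) N g \<and> (\<forall>x\<in>carrier (P (Suc s)). f x = g (d s x))))"

text \<open>Let \<psi> : P -> Q and \<phi> : Q -> P be comparison maps. A cocycle \<open>f\<close>
  on \<open>P\<close> pulls back along \<phi> to a cocycle on \<open>Q\<close>, which is a
  coboundary by hypothesis; the homotopy between \<phi>\<psi> and the identity accounts for the rest
  of \<open>f\<close>.\<close>

lemma cocycles_bound_transfer:
  assumes M: "left_module R M" and N: "left_module R N"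
    and PR: "projective_resolution R M P d e" and QR: "projective_resolution R M Q \<delta> \<epsilon>"
    and bound: "cocycles_bound R Q \<delta> N s"
  shows "cocycles_bound R P d N s"
  unfolding cocycles_bound_def
proof (intro allI impI, elim conjE)
  note P = projective_resolutionD[OF PR] and Q = projective_resolutionD[OF QR]
  fix f assume f: "linear_map R (P (Suc s)) N f"
    and cocycle: "\<forall>x\<in>carrier (P (Suc (Suc s))). f (d (Suc s) x) = \<zero>\<^bsub>N\<^esub>"
  obtain \<psi> where \<psi>: "\<And>n. linear_map R (P n) (Q n) (\<psi> n)" "\<And>x. x \<in> carrier (P 0) \<Longrightarrow> \<epsilon> (\<psi> 0 x) = e x"
    "\<And>n x. x \<in> carrier (P (Suc n)) \<Longrightarrow> \<delta> n (\<psi> (Suc n) x) = \<psi> n (d n x)"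
    using comparison_map[OF M PR QR] by blast
  obtain \<phi> where \<phi>: "\<And>n. linear_map R (Q n) (P n) (\<phi> n)" "\<And>x. x \<in> carrier (Q 0) \<Longrightarrow> e (\<phi> 0 x) = \<epsilon> x"
    "\<And>n x. x \<in> carrier (Q (Suc n)) \<Longrightarrow> d n (\<phi> (Suc n) x) = \<phi> n (\<delta> n x)"
    using comparison_map[OF M QR PR] by blast
  note \<psi>c = linear_mapD(1)[OF \<psi>(1)] and \<phi>c = linear_mapD(1)[OF \<phi>(1)] and dc = linear_mapD(1)[OF P(3)]
  define \<alpha> where "\<alpha> n x = x \<ominus>\<^bsub>P n\<^esub> \<phi> n (\<psi> n x)" for n x
  have \<alpha>: "linear_map R (P n) (P n) (\<alpha> n)" for n
    unfolding \<alpha>_def by (rule linear_map_diff[OF P(2) P(2) linear_map_id linear_map_comp[OF \<psi>(1) \<phi>(1)]])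
  have \<alpha>0: "e (\<alpha> 0 x) = \<zero>\<^bsub>M\<^esub>" if x: "x \<in> carrier (P 0)" for x
  proof -
    interpret M: left_module R M by (rule M)
    have "e (\<alpha> 0 x) = e x \<ominus>\<^bsub>M\<^esub> e (\<phi> 0 (\<psi> 0 x))"
      unfolding \<alpha>_def by (rule linear_map_minus[OF P(2) M P(4) x \<phi>c[OF \<psi>c[OF x]]])
    also have "\<dots> = \<zero>\<^bsub>M\<^esub>"
      using linear_mapD(1)[OF P(4) x] \<phi>(2)[OF \<psi>c[OF x]] \<psi>(2)[OF x] by (simp add: M.M.r_neg a_minus_def)
    finally show ?thesis .
  qed
  have "d n (\<alpha> (Suc n) x) = \<alpha> n (d n x)" if x: "x \<in> carrier (P (Suc n))" for n x
    unfolding \<alpha>_def using linear_map_minus[OF P(2) P(2) P(3) x \<phi>c[OF \<psi>c[OF x]]] \<psi>(3)[OF x] \<phi>(3)[OF \<psi>c[OF x]]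
    by simp
  from null_homotopy[where \<alpha> = \<alpha>, OF M PR \<alpha> \<alpha>0 this] obtain h where
    h: "\<And>n. linear_map R (P n) (P (Suc n)) (h n)"
    "\<And>n x. x \<in> carrier (P (Suc n)) \<Longrightarrow> \<alpha> (Suc n) x = d (Suc n) (h (Suc n) x) \<oplus>\<^bsub>P (Suc n)\<^esub> h n (d n x)"
    by blast
  have "f (\<phi> (Suc s) (\<delta> (Suc s) y)) = \<zero>\<^bsub>N\<^esub>" if "y \<in> carrier (Q (Suc (Suc s)))" for y
    using cocycle \<phi>c[OF that] by (simp flip: \<phi>(3)[OF that])
  then obtain g where g: "linear_map R (Q s) N g"
    "\<And>y. y \<in> carrier (Q (Suc s)) \<Longrightarrow> f (\<phi> (Suc s) y) = g (\<delta> s y)"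
    using bound linear_map_comp[OF \<phi>(1) f] unfolding cocycles_bound_def by blast
  \<comment> \<open>From id = \<phi>\<psi> + dh + hd and f d = 0 one gets f = f\<phi>\<psi> + f h d,
    and f\<phi>\<psi> = g\<delta>\<psi> = g\<psi>d. Factoring out \<open>d\<close> leaves this
    map.\<close>
  let ?g = "\<lambda>x. g (\<psi> s x) \<oplus>\<^bsub>N\<^esub> f (h s x)"
  have "linear_map R (P s) N ?g"
    by (rule linear_map_add[OF P(2) N linear_map_comp[OF \<psi>(1) g(1)] linear_map_comp[OF h(1) f]])
  moreover have "f x = ?g (d s x)" if x: "x \<in> carrier (P (Suc s))" for x
  proof -
    interpret N: left_module R N by (rule N)
    interpret PS: left_module R "P (Suc s)" by (rule P(2))
    note hc = linear_mapD(1)[OF h(1)] and fc = linear_mapD(1)[OF f]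
    have \<phi>\<psi>: "\<phi> (Suc s) (\<psi> (Suc s) x) \<in> carrier (P (Suc s))" using \<phi>c[OF \<psi>c[OF x]] .
    have \<alpha>x: "\<alpha> (Suc s) x \<in> carrier (P (Suc s))" using linear_mapD(1)[OF \<alpha> x] .
    have "x = \<phi> (Suc s) (\<psi> (Suc s) x) \<oplus>\<^bsub>P (Suc s)\<^esub> \<alpha> (Suc s) x"
      using x \<phi>\<psi> by (simp add: \<alpha>_def a_minus_def PS.M.a_lcomm PS.M.r_neg)
    then have "f x = f (\<phi> (Suc s) (\<psi> (Suc s) x)) \<oplus>\<^bsub>N\<^esub> f (\<alpha> (Suc s) x)"
      using linear_mapD(2)[OF f \<phi>\<psi> \<alpha>x] by simp
    moreover have "f (\<phi> (Suc s) (\<psi> (Suc s) x)) = g (\<psi> s (d s x))"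
      using g(2)[OF \<psi>c[OF x]] \<psi>(3)[OF x] by simp
    moreover have "f (\<alpha> (Suc s) x) = f (h s (d s x))"
      unfolding h(2)[OF x] using linear_mapD(2)[OF f dc[OF hc[OF x]] hc[OF dc[OF x]]]
        cocycle hc[OF x] fc[OF hc[OF dc[OF x]]] by simp
    ultimately show ?thesis by simp
  qed
  ultimately show "\<exists>g. linear_map R (P s) N g \<and> (\<forall>x\<in>carrier (P (Suc s)). f x = g (d s x))" by blast
qed

lemma comm_group_hom_group:
  assumes M: "left_module R M" and N: "left_module R N"
  shows "comm_group (hom_group R M N)"
proof -
  interpret M: left_module R M by fact
  interpret N: left_module R N by fact
  have eq: "f = g \<longleftrightarrow> (\<forall>x\<in>carrier M. f x = g x)" if "f \<in> mod_hom R M N" "g \<in> mod_hom R M N" for f g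
    using that by (auto simp: mod_hom_iff intro: extensionalityI)
  have cl: "f x \<in> carrier N" if "f \<in> mod_hom R M N" "x \<in> carrier M" for f x
    using that by (auto simp: mod_hom_iff linear_map_def)
  have zero: "(\<lambda>x\<in>carrier M. \<zero>\<^bsub>N\<^esub>) \<in> mod_hom R M N"
    by (auto simp: mod_hom_def N.smult_r_null)
  have add: "(\<lambda>x\<in>carrier M. f x \<oplus>\<^bsub>N\<^esub> g x) \<in> mod_hom R M N" if "f \<in> mod_hom R M N" "g \<in> mod_hom R M N" for f g
    by (rule mod_hom_restrict[OF M linear_map_add[OF M N]]) (use that in \<open>simp_all add: mod_hom_iff\<close>)
  show ?thesis
  proof (rule comm_groupI)
    fix f assume "f \<in> carrier (hom_group R M N)"
    then have f: "f \<in> mod_hom R M N" by (simp add: hom_group_def)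
    let ?g = "\<lambda>x\<in>carrier M. \<zero>\<^bsub>N\<^esub> \<ominus>\<^bsub>N\<^esub> f x"
    have "?g \<in> carrier (hom_group R M N)"
      unfolding hom_group_def partial_object.simps
      by (rule mod_hom_restrict[OF M linear_map_diff[OF M N, of "\<lambda>x. \<zero>\<^bsub>N\<^esub>"]])
        (use f in \<open>simp_all add: mod_hom_iff linear_map_def N.smult_r_null\<close>)
    moreover have "?g \<otimes>\<^bsub>hom_group R M N\<^esub> f = \<one>\<^bsub>hom_group R M N\<^esub>"
      using cl[OF f] by (auto simp: hom_group_def a_minus_def N.M.l_neg intro!: restrict_ext)
    ultimately show "\<exists>g\<in>carrier (hom_group R M N). g \<otimes>\<^bsub>hom_group R M N\<^esub> f = \<one>\<^bsub>hom_group R M N\<^esub>"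
      by blast
  next
    fix f g assume "f \<in> carrier (hom_group R M N)" "g \<in> carrier (hom_group R M N)"
    then show "f \<otimes>\<^bsub>hom_group R M N\<^esub> g = g \<otimes>\<^bsub>hom_group R M N\<^esub> f"
      using cl by (auto simp: hom_group_def N.M.a_comm intro!: restrict_ext)
  next
    fix f g h
    assume "f \<in> carrier (hom_group R M N)" "g \<in> carrier (hom_group R M N)" "h \<in> carrier (hom_group R M N)"
    then show "f \<otimes>\<^bsub>hom_group R M N\<^esub> g \<otimes>\<^bsub>hom_group R M N\<^esub> h = f \<otimes>\<^bsub>hom_group R M N\<^esub> (g \<otimes>\<^bsub>hom_group R M N\<^esub> h)"
      using cl by (auto simp: hom_group_def N.M.a_assoc intro!: restrict_ext)
  next
    fix f assume "f \<in> carrier (hom_group R M N)"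
    then show "\<one>\<^bsub>hom_group R M N\<^esub> \<otimes>\<^bsub>hom_group R M N\<^esub> f = f"
      using cl by (auto simp: hom_group_def mod_hom_iff extensional_def fun_eq_iff)
  qed (auto simp: hom_group_def zero add)
qed

text \<open>Once coboundaries exhaust the cocycles, the Ext group is a group modulo itself, which
  has a single coset.\<close>

lemma trivial_Ext_group:
  assumes N: "left_module R N" and PR: "projective_resolution R M P d e" and "cocycles_bound R P d N s"
  shows "trivial_group (Ext_group R P d N (Suc s))"
proof -
  note P = projective_resolutionD[OF PR]
  interpret N: left_module R N by (rule N)
  let ?H = "hom_group R (P (Suc s)) N" and ?Z = "cocycles R P d N (Suc s)"
  interpret H: comm_group ?H by (rule comm_group_hom_group[OF P(2) N])
  note dc = linear_mapD(1)[OF P(3)]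
  have Z: "subgroup ?Z ?H"
  proof
    show "?Z \<subseteq> carrier ?H" by (auto simp: cocycles_def hom_group_def)
    show "\<one>\<^bsub>?H\<^esub> \<in> ?Z"
      using H.one_closed dc by (auto simp: cocycles_def hom_group_def)
    show "f \<otimes>\<^bsub>?H\<^esub> g \<in> ?Z" if "f \<in> ?Z" "g \<in> ?Z" for f g
      using H.m_closed[of f g] that dc by (auto simp: cocycles_def hom_group_def)
    show "inv\<^bsub>?H\<^esub> f \<in> ?Z" if f: "f \<in> ?Z" for f
    proof -
      have fH: "f \<in> carrier ?H" using f by (simp add: cocycles_def hom_group_def)
      let ?g = "inv\<^bsub>?H\<^esub> f"
      have g: "?g \<in> mod_hom R (P (Suc s)) N" using H.inv_closed[OF fH] by (simp add: hom_group_def)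
      have "?g (d (Suc s) x) = \<zero>\<^bsub>N\<^esub>" if x: "x \<in> carrier (P (Suc (Suc s)))" for x
      proof -
        have "?g (d (Suc s) x) \<in> carrier N" using g dc[OF x] by (auto simp: mod_hom_iff linear_map_def)
        moreover have "(?g \<otimes>\<^bsub>?H\<^esub> f) (d (Suc s) x) = \<zero>\<^bsub>N\<^esub>"
          unfolding H.l_inv[OF fH] using dc[OF x] by (simp add: hom_group_def)
        ultimately show ?thesis
          using f x dc[OF x] by (simp add: hom_group_def cocycles_def)
      qed
      with g show ?thesis by (simp add: cocycles_def)
    qed
  qed
  have "coboundaries R P d N (Suc s) = ?Z"
  proof
    show "coboundaries R P d N (Suc s) \<subseteq> ?Z"
    proof
      fix f assume "f \<in> coboundaries R P d N (Suc s)"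
      then obtain g where g: "linear_map R (P s) N g" and f: "f = compose (carrier (P (Suc s))) g (d s)"
        by (auto simp: mod_hom_iff)
      have "f \<in> mod_hom R (P (Suc s)) N"
        unfolding f compose_def by (rule mod_hom_restrict[OF P(2) linear_map_comp[OF P(3) g]])
      then show "f \<in> ?Z"
        using P(9) dc linear_map_zero[OF P(2) N g] by (simp add: cocycles_def f compose_def)
    qed
    show "?Z \<subseteq> coboundaries R P d N (Suc s)"
    proof
      fix f assume f: "f \<in> ?Z"
      then obtain g where g: "linear_map R (P s) N g" "\<And>x. x \<in> carrier (P (Suc s)) \<Longrightarrow> f x = g (d s x)"
        using assms(3) unfolding cocycles_bound_def cocycles_def mod_hom_iff by blast
      have "f = compose (carrier (P (Suc s))) (restrict g (carrier (P s))) (d s)"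
        using f g(2) dc by (auto simp: cocycles_def mod_hom_iff compose_def extensional_def fun_eq_iff)
      then show "f \<in> coboundaries R P d N (Suc s)"
        using mod_hom_restrict[OF P(2) g(1)] by auto
    qed
  qed
  then have eq: "Ext_group R P d N (Suc s) = ?H\<lparr>carrier := ?Z\<rparr> Mod carrier (?H\<lparr>carrier := ?Z\<rparr>)"
    by (simp add: Ext_group_def)
  interpret Z: group "?H\<lparr>carrier := ?Z\<rparr>" by (rule H.subgroup_imp_group[OF Z])
  interpret E: group "Ext_group R P d N (Suc s)"
    unfolding eq by (rule normal.factorgroup_is_group[OF Z.normal_self])
  have "carrier (Ext_group R P d N (Suc s)) \<subseteq> {carrier (?H\<lparr>carrier := ?Z\<rparr>)}"
    unfolding eq FactGroup_def RCOSETS_def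
    using Z.coset_join2[OF _ Z.subgroup_self] by auto
  then show ?thesis using E.trivial_group_alt by blast
qed

section \<open>Finitely generated submodules\<close>

text \<open>For a submodule \<open>H\<close> this says that \<open>H\<close> is the least submodule
  containing \<open>G\<close>. Minimality lets a property be checked on generators as soon as it
  cuts out a submodule, without handling linear combinations. It is used over the ring and over the
  field alike.\<close>

definition generates ::
  "('a, 'e) ring_scheme \<Rightarrow> ('a, 'm) module \<Rightarrow> 'm set \<Rightarrow> 'm set \<Rightarrow> bool" where
  "generates R M G H \<longleftrightarrow> G \<subseteq> H \<and> (\<forall>U. submodule U R M \<and> G \<subseteq> U \<longrightarrow> H \<subseteq> U)"

lemma generatesD: "generates R M G H \<Longrightarrow> submodule U R M \<Longrightarrow> G \<subseteq> U \<Longrightarrow> H \<subseteq> U"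
  by (simp add: generates_def)

lemma lin_ext_in_submodule:
  assumes M: "left_module R M" and H: "submodule H R M" and e: "e \<in> I \<rightarrow> H"
    and x: "x \<in> carrier (free_module R I)"
  shows "left_module.lin_ext R M I e x \<in> H"
proof -
  interpret M: left_module R M by fact
  have "(\<Oplus>\<^bsub>M\<^esub>i\<in>{i \<in> I. x i \<noteq> \<zero>\<^bsub>R\<^esub>}. x i \<odot>\<^bsub>M\<^esub> e i) \<in> H"
    by (rule submodule_finsum[OF M H]) (use x e submoduleD(4)[OF H] in \<open>auto simp: free_module_simps PiE_iff\<close>)
  then show ?thesis using x by (simp add: M.lin_ext_def)
qed

text \<open>The image is a submodule and contains the generators as the values at unit vectors, so
  minimality gives the larger inclusion.\<close>

lemma lin_ext_image:
  assumes M: "left_module R M" and H: "submodule H R M" and gen: "generates R M (e ` I) H"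
  shows "left_module.lin_ext R M I e ` carrier (free_module R I) = H"
proof
  interpret M: left_module R M by fact
  let ?F = "free_module R I"
  have F: "left_module R ?F" by (rule M.R.left_module_free)
  have eH: "e \<in> I \<rightarrow> H" using gen by (auto simp: generates_def)
  then have eM: "e \<in> I \<rightarrow> carrier M" using submoduleD(1)[OF H] by auto
  show "M.lin_ext I e ` carrier ?F \<subseteq> H"
    using lin_ext_in_submodule[OF M H eH] by auto
  have "submodule (M.lin_ext I e ` carrier ?F) R M"
    by (rule submodule_image[OF F M linear_map_lin_ext[OF M eM] submodule_carrier[OF F]])
  moreover have "e i \<in> M.lin_ext I e ` carrier ?F" if "i \<in> I" for i
    by (rule image_eqI[OF _ M.R.single_closed[of I i]]) (simp add: M.lin_ext_single[OF eM that])
  ultimately show "H \<subseteq> M.lin_ext I e ` carrier ?F"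
    using generatesD[OF gen] by blast
qed

text \<open>The bridge between linear combinations and minimality. For the direction back, the
  coefficients of an element are read off a preimage in the free module on the generators.\<close>

lemma finitely_generated_iff:
  assumes M: "left_module R M" and H: "submodule H R M"
  shows "finitely_generated R (M\<lparr>carrier := H\<rparr>) \<longleftrightarrow> (\<exists>G. finite G \<and> generates R M G H)"
proof
  interpret M: left_module R M by fact
  let ?H = "M\<lparr>carrier := H\<rparr>"
  assume "finitely_generated R ?H"
  then obtain G where G: "finite G" "G \<subseteq> H" "lin_span R ?H G = H"
    by (auto simp: finitely_generated_def)
  have "H \<subseteq> U" if U: "submodule U R M" "G \<subseteq> U" for U
  proof
    fix x assume "x \<in> H"
    then have "x \<in> lin_span R ?H G" using G(3) by simp
    then obtain F c where F: "finite F" "F \<subseteq> G" "c \<in> F \<rightarrow> carrier R"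
        and x: "x = (\<Oplus>\<^bsub>?H\<^esub>y\<in>F. c y \<odot>\<^bsub>M\<^esub> y)"
      by (auto simp: lin_span_def)
    have "(\<lambda>y. c y \<odot>\<^bsub>M\<^esub> y) \<in> F \<rightarrow> H"
      by (intro Pi_I submoduleD(4)[OF H]) (use F G(2) in auto)
    then have "x = (\<Oplus>\<^bsub>M\<^esub>y\<in>F. c y \<odot>\<^bsub>M\<^esub> y)"
      unfolding x by (rule finsum_submodule[OF M H F(1)])
    also have "\<dots> \<in> U"
      by (intro submodule_finsum[OF M U(1) F(1)] Pi_I submoduleD(4)[OF U(1)]) (use F U(2) in auto)
    finally show "x \<in> U" .
  qed
  then have "generates R M G H" using G(2) unfolding generates_def by blast
  then show "\<exists>G. finite G \<and> generates R M G H" using G(1) by blast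
next
  interpret M: left_module R M by fact
  let ?H = "M\<lparr>carrier := H\<rparr>"
  assume "\<exists>G. finite G \<and> generates R M G H"
  then obtain G where G: "finite G" "generates R M G H" by blast
  then have GH: "G \<subseteq> H" by (simp add: generates_def)
  have sum: "(\<Oplus>\<^bsub>?H\<^esub>y\<in>F. c y \<odot>\<^bsub>M\<^esub> y) = (\<Oplus>\<^bsub>M\<^esub>y\<in>F. c y \<odot>\<^bsub>M\<^esub> y)"
    "(\<Oplus>\<^bsub>M\<^esub>y\<in>F. c y \<odot>\<^bsub>M\<^esub> y) \<in> H"
    if "finite F" "F \<subseteq> G" "c \<in> F \<rightarrow> carrier R" for F c
  proof -
    have *: "(\<lambda>y. c y \<odot>\<^bsub>M\<^esub> y) \<in> F \<rightarrow> H"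
      by (intro Pi_I submoduleD(4)[OF H]) (use that GH in auto)
    show "(\<Oplus>\<^bsub>?H\<^esub>y\<in>F. c y \<odot>\<^bsub>M\<^esub> y) = (\<Oplus>\<^bsub>M\<^esub>y\<in>F. c y \<odot>\<^bsub>M\<^esub> y)"
      by (rule finsum_submodule[OF M H that(1) *])
    show "(\<Oplus>\<^bsub>M\<^esub>y\<in>F. c y \<odot>\<^bsub>M\<^esub> y) \<in> H" by (rule submodule_finsum[OF M H that(1) *])
  qed
  have "lin_span R ?H G = H"
  proof
    show "lin_span R ?H G \<subseteq> H" using sum by (auto simp: lin_span_def)
    show "H \<subseteq> lin_span R ?H G"
    proof
      fix x assume "x \<in> H"
      then have "x \<in> M.lin_ext G (\<lambda>y. y) ` carrier (free_module R G)"
        using lin_ext_image[OF M H, of "\<lambda>y. y" G] G(2) by simp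
      then obtain c where c: "c \<in> carrier (free_module R G)" and x: "x = M.lin_ext G (\<lambda>y. y) c"
        by blast
      let ?F = "{y \<in> G. c y \<noteq> \<zero>\<^bsub>R\<^esub>}"
      have F: "finite ?F" "?F \<subseteq> G" "c \<in> ?F \<rightarrow> carrier R" using c by (auto simp: free_module_simps)
      have "x = (\<Oplus>\<^bsub>?H\<^esub>y\<in>?F. c y \<odot>\<^bsub>?H\<^esub> y)"
        using sum(1)[OF F] c by (simp add: x M.lin_ext_def)
      then show "x \<in> lin_span R ?H G" using F unfolding lin_span_def by blast
    qed
  qed
  then show "finitely_generated R ?H"
    unfolding finitely_generated_def using G(1) GH by auto
qed

section \<open>Coordinates and matrices of maps on free modules\<close>

text \<open>The matrix form of a map: the coordinates of the argument stand on the left, the matrix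
  entries on the right. For finite \<open>I\<close> the sum runs over all of \<open>I\<close>,
  whatever the support of \<open>x\<close>.\<close>

lemma linear_map_coord:
  assumes M: "left_module R M" and f: "linear_map R (free_module R I) M f" and I: "finite I"
    and x: "x \<in> carrier (free_module R I)"
  shows "f x = (\<Oplus>\<^bsub>M\<^esub>i\<in>I. x i \<odot>\<^bsub>M\<^esub> f (single R I i))"
proof -
  interpret M: left_module R M by fact
  have "(\<lambda>i. f (single R I i)) \<in> I \<rightarrow> carrier M"
    using linear_mapD(1)[OF f M.R.single_closed] by auto
  then show ?thesis
    unfolding linear_map_free_eq[OF M f x]
    by (rule M.lin_ext_eq[OF x _ I]) auto
qed

lemma linear_map_eval: "j \<in> J \<Longrightarrow> linear_map R (free_module R J) (regular R) (\<lambda>x. x j)"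
  by (auto simp: linear_map_def free_module_simps)

lemma free_module_ext:
  "x \<in> carrier (free_module R I) \<Longrightarrow> y \<in> carrier (free_module R I) \<Longrightarrow> (\<And>i. i \<in> I \<Longrightarrow> x i = y i) \<Longrightarrow> x = y"
  by (auto simp: free_module_simps PiE_iff intro: extensionalityI)

lemma finsum_free_eval:
  assumes R: "ring R" and T: "finite T" and x: "x \<in> T \<rightarrow> carrier (free_module R J)" and j: "j \<in> J"
  shows "(\<Oplus>\<^bsub>free_module R J\<^esub>t\<in>T. x t) j = (\<Oplus>\<^bsub>R\<^esub>t\<in>T. x t j)"
proof -
  have "(\<Oplus>\<^bsub>free_module R J\<^esub>t\<in>T. x t) j = (\<Oplus>\<^bsub>regular R\<^esub>t\<in>T. x t j)"
    by (rule linear_map_finsum[OF ring.left_module_free[OF R] left_module_regular[OF R] linear_map_eval[OF j] T x])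
  also have "\<dots> = (\<Oplus>\<^bsub>R\<^esub>t\<in>T. x t j)"
    by (rule finsum_regular[OF R T]) (use x j in \<open>auto simp: free_module_simps Pi_iff PiE_iff\<close>)
  finally show ?thesis .
qed

section \<open>Finite families of functionals\<close>

lemma separated_subspace_finitely_generated:
  assumes K: "field K" and V: "left_module K V" and T: "finite T"
    and f: "\<And>t. t \<in> T \<Longrightarrow> linear_map K V (regular K) (f t)"
    and W: "submodule W K V" and sep: "\<And>w. w \<in> W \<Longrightarrow> (\<And>t. t \<in> T \<Longrightarrow> f t w = \<zero>\<^bsub>K\<^esub>) \<Longrightarrow> w = \<zero>\<^bsub>V\<^esub>"
  shows "\<exists>G. finite G \<and> generates K V G W"
  using T f W sep
proof (induction T arbitrary: W rule: finite_induct)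
  case empty
  then have "W \<subseteq> {\<zero>\<^bsub>V\<^esub>}" by auto
  then have "generates K V {} W" using submoduleD(2) by (force simp: generates_def)
  then show ?case by blast
next
  case (insert t T)
  interpret K: field K by fact
  interpret V: left_module K V by fact
  note W = submoduleD[OF insert.prems(2)]
  have ft: "linear_map K V (regular K) (f t)" using insert.prems(1) by simp
  note ftD = linear_mapD[OF ft, simplified]
  show ?case
  proof (cases "\<forall>w\<in>W. f t w = \<zero>\<^bsub>K\<^esub>")
    case True
    show ?thesis
    proof (rule insert.IH[OF _ insert.prems(2)])
      fix w assume "w \<in> W" "\<And>t. t \<in> T \<Longrightarrow> f t w = \<zero>\<^bsub>K\<^esub>"
      then show "w = \<zero>\<^bsub>V\<^esub>" using True by (intro insert.prems(3)) auto
    qed (simp add: insert.prems(1))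
  next
    case False
    then obtain w0 where w0: "w0 \<in> W" "f t w0 \<noteq> \<zero>\<^bsub>K\<^esub>" by blast
    have w0V: "w0 \<in> carrier V" using w0 W(1) by auto
    have unit: "f t w0 \<in> Units K" using w0(2) ftD(1)[OF w0V] by (simp add: K.field_Units)
    let ?W = "{w \<in> W. f t w = \<zero>\<^bsub>K\<^esub>}"
    have W': "submodule ?W K V"
    proof (rule left_module_submoduleI[OF V])
      show "\<zero>\<^bsub>V\<^esub> \<in> ?W"
        using W(2) linear_map_zero[OF V left_module_regular[OF K.ring_axioms] ft] by simp
    qed (use W ftD in \<open>auto simp: subset_iff\<close>)
    have "\<exists>G. finite G \<and> generates K V G ?W"
    proof (rule insert.IH[OF _ W'])
      fix w assume "w \<in> ?W" "\<And>t. t \<in> T \<Longrightarrow> f t w = \<zero>\<^bsub>K\<^esub>"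
      then show "w = \<zero>\<^bsub>V\<^esub>" by (intro insert.prems(3)) auto
    qed (simp add: insert.prems(1))
    then obtain G where G: "finite G" "generates K V G ?W" by blast
    have "W \<subseteq> U" if U: "submodule U K V" "Set.insert w0 G \<subseteq> U" for U
    proof
      fix w assume w: "w \<in> W"
      then have wV: "w \<in> carrier V" using W(1) by auto
      \<comment> \<open>Adding \<open>?a\<close> times \<open>w0\<close> projects \<open>w\<close>
        along \<open>w0\<close> into the zero set of \<open>f t\<close>; adding \<open>?b\<close>
        times \<open>w0\<close> undoes this inside \<open>U\<close>.\<close>
      let ?a = "\<ominus>\<^bsub>K\<^esub> (f t w \<otimes>\<^bsub>K\<^esub> inv\<^bsub>K\<^esub> f t w0)"
      let ?b = "f t w \<otimes>\<^bsub>K\<^esub> inv\<^bsub>K\<^esub> f t w0"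
      have b: "?b \<in> carrier K" using ftD(1)[OF wV] K.Units_inv_closed[OF unit] by simp
      then have a: "?a \<in> carrier K" by simp
      have bf: "?b \<otimes>\<^bsub>K\<^esub> f t w0 = f t w"
        using ftD(1)[OF wV] ftD(1)[OF w0V] unit by (simp add: K.m_assoc)
      let ?w = "w \<oplus>\<^bsub>V\<^esub> ?a \<odot>\<^bsub>V\<^esub> w0"
      have "f t ?w = f t w \<oplus>\<^bsub>K\<^esub> ?a \<otimes>\<^bsub>K\<^esub> f t w0"
        using ftD a wV w0V by simp
      also have "?a \<otimes>\<^bsub>K\<^esub> f t w0 = \<ominus>\<^bsub>K\<^esub> f t w"
        using K.l_minus[OF b ftD(1)[OF w0V]] bf by simp
      finally have "f t ?w = \<zero>\<^bsub>K\<^esub>" using ftD(1)[OF wV] by (simp add: K.r_neg)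
      moreover have "?w \<in> W" using W(3)[OF w W(4)[OF a w0(1)]] .
      ultimately have "?w \<in> ?W" by simp
      also have "?W \<subseteq> U" using generatesD[OF G(2) U(1)] U(2) by blast
      finally have "?w \<in> U" .
      moreover have "?b \<odot>\<^bsub>V\<^esub> w0 \<in> U" using submoduleD(4)[OF U(1) b] U(2) by blast
      ultimately have "?w \<oplus>\<^bsub>V\<^esub> ?b \<odot>\<^bsub>V\<^esub> w0 \<in> U" by (rule submoduleD(3)[OF U(1)])
      moreover have "?w \<oplus>\<^bsub>V\<^esub> ?b \<odot>\<^bsub>V\<^esub> w0 = w \<oplus>\<^bsub>V\<^esub> (?a \<oplus>\<^bsub>K\<^esub> ?b) \<odot>\<^bsub>V\<^esub> w0"
        using a b wV w0V by (simp add: V.smult_l_distr V.M.a_assoc)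
      moreover have "\<dots> = w" using b wV w0V by (simp add: K.l_neg V.smult_l_null)
      ultimately show "w \<in> U" by simp
    qed
    moreover have "Set.insert w0 G \<subseteq> W" using w0 G(2) by (auto simp: generates_def)
    ultimately have "generates K V (Set.insert w0 G) W" by (simp add: generates_def)
    then show ?thesis using G(1) by blast
  qed
qed

text \<open>Double annihilator in finite form: if every functional in \<Phi> that kills
  \<open>W\<close> also kills \<open>c\<close>, then finitely many members of \<Phi> cannot
  distinguish \<open>c\<close> from some element of \<open>W\<close>. If moreover they separate
  points, \<open>c\<close> itself lies in \<open>W\<close>. The induction replaces functionals by
  combinations, hence the closure assumption on \<Phi>.\<close>

lemma interpolation_on_subspace:
  assumes K: "field K" and V: "left_module K V" and W: "submodule W K V" and c: "c \<in> carrier V"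
    and lin: "\<And>f. f \<in> \<Phi> \<Longrightarrow> linear_map K V (regular K) f"
    and closed: "\<And>f g a. f \<in> \<Phi> \<Longrightarrow> g \<in> \<Phi> \<Longrightarrow> a \<in> carrier K \<Longrightarrow>
      \<exists>h\<in>\<Phi>. \<forall>v\<in>carrier V. h v = f v \<ominus>\<^bsub>K\<^esub> a \<otimes>\<^bsub>K\<^esub> g v"
    and vanish: "\<And>f. f \<in> \<Phi> \<Longrightarrow> \<forall>w\<in>W. f w = \<zero>\<^bsub>K\<^esub> \<Longrightarrow> f c = \<zero>\<^bsub>K\<^esub>"
    and T: "finite T" and f: "\<And>t. t \<in> T \<Longrightarrow> f t \<in> \<Phi>"
  shows "\<exists>w\<in>W. \<forall>t\<in>T. f t w = f t c"
  using T f
proof (induction T arbitrary: f rule: finite_induct)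
  case empty
  then show ?case using submoduleD(2)[OF W] by auto
next
  case (insert t T)
  interpret K: field K by fact
  interpret V: left_module K V by fact
  have WV: "w \<in> carrier V" if "w \<in> W" for w using submoduleD(1)[OF W] that by auto
  define g where "g = f t"
  have g: "g \<in> \<Phi>" using insert.prems by (simp add: g_def)
  note gD = linear_mapD[OF lin[OF g], simplified]
  show ?case
  proof (cases "\<forall>w\<in>W. g w = \<zero>\<^bsub>K\<^esub>")
    case True
    then have "g c = \<zero>\<^bsub>K\<^esub>" using vanish[OF g] by blast
    moreover have "\<exists>w\<in>W. \<forall>t\<in>T. f t w = f t c" by (rule insert.IH) (use insert.prems in auto)
    ultimately show ?thesis using True by (auto simp: g_def)
  next
    case False
    then obtain w1 where w1: "w1 \<in> W" "g w1 \<noteq> \<zero>\<^bsub>K\<^esub>" by blast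
    then have unit: "g w1 \<in> Units K" using gD(1)[OF WV] by (simp add: K.field_Units)
    define w0 where "w0 = inv\<^bsub>K\<^esub> g w1 \<odot>\<^bsub>V\<^esub> w1"
    have w0: "w0 \<in> W" unfolding w0_def using unit by (intro submoduleD(4)[OF W] w1) simp
    have gw0: "g w0 = \<one>\<^bsub>K\<^esub>" unfolding w0_def using unit gD(3) WV[OF w1(1)] by simp
    have w0V: "w0 \<in> carrier V" using WV w0 .
    \<comment> \<open>As \<open>g w0\<close> is 1, subtracting \<open>f s w0\<close> times
      \<open>g\<close> yields functionals that vanish at \<open>w0\<close>. A point found for them
      by induction can then be moved along \<open>w0\<close> to get the value of \<open>g\<close>
      right without disturbing the others.\<close>
    have "\<exists>f'. \<forall>s\<in>T. f' s \<in> \<Phi> \<and> (\<forall>v\<in>carrier V. f' s v = f s v \<ominus>\<^bsub>K\<^esub> f s w0 \<otimes>\<^bsub>K\<^esub> g v)"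
    proof (rule bchoice, rule ballI)
      fix s assume "s \<in> T"
      then have "f s \<in> \<Phi>" using insert.prems by simp
      from closed[OF this g, of "f s w0"] linear_mapD(1)[OF lin[OF this] w0V]
      show "\<exists>h. h \<in> \<Phi> \<and> (\<forall>v\<in>carrier V. h v = f s v \<ominus>\<^bsub>K\<^esub> f s w0 \<otimes>\<^bsub>K\<^esub> g v)" by auto
    qed
    then obtain f' where f': "\<And>s. s \<in> T \<Longrightarrow> f' s \<in> \<Phi>"
      "\<And>s v. s \<in> T \<Longrightarrow> v \<in> carrier V \<Longrightarrow> f' s v = f s v \<ominus>\<^bsub>K\<^esub> f s w0 \<otimes>\<^bsub>K\<^esub> g v" by blast
    from insert.IH[of f', OF f'(1)] obtain w where w: "w \<in> W" "\<And>s. s \<in> T \<Longrightarrow> f' s w = f' s c" by blast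
    have wV: "w \<in> carrier V" using WV w(1) .
    define a where "a = g c \<ominus>\<^bsub>K\<^esub> g w"
    have a: "a \<in> carrier K" unfolding a_def using gD(1) c wV by simp
    let ?w = "w \<oplus>\<^bsub>V\<^esub> a \<odot>\<^bsub>V\<^esub> w0"
    have aw0: "a \<odot>\<^bsub>V\<^esub> w0 \<in> carrier V" using a w0V by simp
    have "?w \<in> W" using submoduleD(3)[OF W w(1) submoduleD(4)[OF W a w0]] .
    moreover have gw: "g ?w = g c"
    proof -
      have "g ?w = g w \<oplus>\<^bsub>K\<^esub> a" using gD(2)[OF wV aw0] gD(3)[OF a w0V] gw0 a by simp
      also have "\<dots> = g c" unfolding a_def using gD(1)[OF c] gD(1)[OF wV]
        by (simp add: a_minus_def K.a_lcomm K.r_neg)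
      finally show ?thesis .
    qed
    moreover have "f s ?w = f s c" if s: "s \<in> T" for s
    proof -
      have fs: "f s \<in> \<Phi>" using insert.prems s by simp
      note fD = linear_mapD[OF lin[OF fs], simplified] and f'D = linear_mapD[OF lin[OF f'(1)[OF s]], simplified]
      have "f' s w0 = \<zero>\<^bsub>K\<^esub>"
        using f'(2)[OF s w0V] gw0 fD(1)[OF w0V] by (simp add: K.r_neg a_minus_def)
      then have "f' s ?w = f' s w"
        using f'D(2)[OF wV aw0] f'D(3)[OF a w0V] f'D(1)[OF wV] a by simp
      also have "\<dots> = f' s c" by (rule w(2)[OF s])
      finally have eq: "f s ?w \<ominus>\<^bsub>K\<^esub> f s w0 \<otimes>\<^bsub>K\<^esub> g c = f s c \<ominus>\<^bsub>K\<^esub> f s w0 \<otimes>\<^bsub>K\<^esub> g c"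
        using f'(2)[OF s] gw c wV aw0 by simp
      have "f s ?w \<in> carrier K" "f s c \<in> carrier K" "f s w0 \<otimes>\<^bsub>K\<^esub> g c \<in> carrier K"
        using fD(1) gD(1) c wV aw0 w0V by simp_all
      with eq show ?thesis by (simp add: a_minus_def)
    qed
    ultimately show ?thesis by (intro bexI[of _ ?w]) (auto simp: g_def)
  qed
qed

section \<open>Linear equations over a ring with enough Frobenius subalgebras\<close>

lemma k_algebra_left_module:
  fixes A :: "('k, 'a) module"
  assumes "k_algebra K A"
  shows "left_module K A"
proof -
  interpret A: k_algebra K A by fact
  show ?thesis
    by (simp add: left_module_def left_module_axioms_def A.K.ring_axioms A.M.abelian_group_axioms
        A.smult_l_distr A.smult_r_distr A.smult_assoc1)
qed

text \<open>What the linear algebra needs of B = A(l). The finite set \<open>G\<close> carries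
  finite dimension: it tests the form in one variable, while \<open>nondegenerate\<close> is about
  the other. \<open>decomposition\<close> is freeness of the larger algebras as right B-modules, cut
  down to the finitely many basis elements that a given finite set involves; the coefficients stand
  on the right.\<close>

locale frobenius_subalgebra =
  fixes K :: "('k, 'e) ring_scheme" and R :: "('k, 'a) module"
    and B :: "'a set" and \<theta> :: "'a \<Rightarrow> 'k" and G :: "'a set"
  assumes k_algebra: "k_algebra K R"
    and submodule: "submodule B K R"
    and mult_closed: "a \<in> B \<Longrightarrow> b \<in> B \<Longrightarrow> a \<otimes>\<^bsub>R\<^esub> b \<in> B"
    and form: "linear_map K (R\<lparr>carrier := B\<rparr>) (regular K) \<theta>"
    and separating: "finite G" "G \<subseteq> B" "y \<in> B \<Longrightarrow> (\<And>b. b \<in> G \<Longrightarrow> \<theta> (b \<otimes>\<^bsub>R\<^esub> y) = \<zero>\<^bsub>K\<^esub>) \<Longrightarrow> y = \<zero>\<^bsub>R\<^esub>"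
    and nondegenerate: "x \<in> B \<Longrightarrow> (\<And>b. b \<in> B \<Longrightarrow> \<theta> (x \<otimes>\<^bsub>R\<^esub> b) = \<zero>\<^bsub>K\<^esub>) \<Longrightarrow> x = \<zero>\<^bsub>R\<^esub>"
    and decomposition: "finite Y \<Longrightarrow> Y \<subseteq> carrier R \<Longrightarrow>
      \<exists>E c. finite E \<and> E \<subseteq> carrier R \<and> c \<in> Y \<rightarrow> E \<rightarrow> B \<and>
        (\<forall>y\<in>Y. y = (\<Oplus>\<^bsub>R\<^esub>e\<in>E. e \<otimes>\<^bsub>R\<^esub> c y e)) \<and>
        (\<forall>b\<in>E \<rightarrow> B. (\<Oplus>\<^bsub>R\<^esub>e\<in>E. e \<otimes>\<^bsub>R\<^esub> b e) = \<zero>\<^bsub>R\<^esub> \<longrightarrow> (\<forall>e\<in>E. b e = \<zero>\<^bsub>R\<^esub>))"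
begin

lemma field: "field K" and ring: "ring R" and left_module_alg: "left_module K R"
proof -
  interpret k_algebra K R by (rule k_algebra)
  show "field K" "ring R" by (rule K.field_axioms ring_axioms)+
  show "left_module K R" by (rule k_algebra_left_module[OF k_algebra])
qed

sublocale K: field K by (rule field)
sublocale R: ring R by (rule ring)

lemma smult_mult: "c \<in> carrier K \<Longrightarrow> x \<in> carrier R \<Longrightarrow> y \<in> carrier R \<Longrightarrow> (c \<odot>\<^bsub>R\<^esub> x) \<otimes>\<^bsub>R\<^esub> y = c \<odot>\<^bsub>R\<^esub> (x \<otimes>\<^bsub>R\<^esub> y)"
  and mult_smult: "c \<in> carrier K \<Longrightarrow> x \<in> carrier R \<Longrightarrow> y \<in> carrier R \<Longrightarrow> x \<otimes>\<^bsub>R\<^esub> (c \<odot>\<^bsub>R\<^esub> y) = c \<odot>\<^bsub>R\<^esub> (x \<otimes>\<^bsub>R\<^esub> y)"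
  using k_algebra by (auto simp: k_algebra_def k_algebra_axioms_def)

lemma smult_closed: "c \<in> carrier K \<Longrightarrow> x \<in> carrier R \<Longrightarrow> c \<odot>\<^bsub>R\<^esub> x \<in> carrier R"
  using left_module.smult_closed[OF left_module_alg] .

lemma in_carrier: "b \<in> B \<Longrightarrow> b \<in> carrier R"
  using submoduleD(1)[OF submodule] by auto

text \<open>B^I, taken as a vector space over \<open>K\<close> so that the results on functionals
  apply; for finite \<open>I\<close> its elements are elements of R^I.\<close>

definition tuples :: "'i set \<Rightarrow> ('k, 'i \<Rightarrow> 'a) module" where
  "tuples I = direct_sum I (\<lambda>_. R\<lparr>carrier := B\<rparr>)"

lemma left_module_tuples: "left_module K (tuples I)"
  unfolding tuples_def
  by (rule left_module_direct_sum[OF K.ring_axioms left_module_submodule[OF left_module_alg submodule]])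

lemma tuples_simps:
  assumes "finite I"
  shows "carrier (tuples I) = I \<rightarrow>\<^sub>E B" "\<zero>\<^bsub>tuples I\<^esub> = (\<lambda>i\<in>I. \<zero>\<^bsub>R\<^esub>)"
    "x \<oplus>\<^bsub>tuples I\<^esub> y = (\<lambda>i\<in>I. x i \<oplus>\<^bsub>R\<^esub> y i)" "a \<odot>\<^bsub>tuples I\<^esub> x = (\<lambda>i\<in>I. a \<odot>\<^bsub>R\<^esub> x i)"
  using assms by (auto simp: tuples_def direct_sum_def)

lemma tuple_in_free: "finite I \<Longrightarrow> x \<in> carrier (tuples I) \<Longrightarrow> x \<in> carrier (free_module R I)"
  by (auto simp: tuples_simps free_module_simps PiE_iff in_carrier)

text \<open>The field acts through the scalars c * 1 of \<open>R\<close>, so R-linear maps and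
  R-submodules are K-linear ones.\<close>

lemma tuple_smult:
  assumes "finite I" "a \<in> carrier K" "x \<in> carrier (free_module R I)"
  shows "(\<lambda>i\<in>I. a \<odot>\<^bsub>R\<^esub> x i) = (a \<odot>\<^bsub>R\<^esub> \<one>\<^bsub>R\<^esub>) \<odot>\<^bsub>free_module R I\<^esub> x"
  using assms by (auto simp: free_module_simps PiE_iff smult_mult intro!: restrict_ext)

lemma submodule_sum: "finite T \<Longrightarrow> b \<in> T \<rightarrow> B \<Longrightarrow> (\<Oplus>\<^bsub>R\<^esub>t\<in>T. b t) \<in> B"
  by (rule submodule_finsum[OF left_module_alg submodule])

text \<open>Products of coordinates with matrix entries stay in \<open>B\<close> because it is a
  subalgebra.\<close>

lemma linear_map_tuple_closed:
  assumes I: "finite I" and f: "linear_map R (free_module R I) (regular R) f"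
    and fB: "\<And>i. i \<in> I \<Longrightarrow> f (single R I i) \<in> B" and x: "x \<in> carrier (tuples I)"
  shows "f x \<in> B"
proof -
  have x': "x i \<in> B" if "i \<in> I" for i using x I that by (auto simp: tuples_simps)
  have xf: "(\<lambda>i. x i \<otimes>\<^bsub>R\<^esub> f (single R I i)) \<in> I \<rightarrow> B" using x' fB by (auto intro: mult_closed)
  have "f x = (\<Oplus>\<^bsub>regular R\<^esub>i\<in>I. x i \<otimes>\<^bsub>R\<^esub> f (single R I i))"
    using linear_map_coord[OF left_module_regular[OF ring] f I tuple_in_free[OF I x]] by simp
  also have "\<dots> = (\<Oplus>\<^bsub>R\<^esub>i\<in>I. x i \<otimes>\<^bsub>R\<^esub> f (single R I i))"
    by (rule finsum_regular[OF ring I]) (use xf in_carrier in auto)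
  finally show ?thesis using submodule_sum[OF I xf] by simp
qed

text \<open>The kernel is already generated over \<open>R\<close> by the solutions over \<open>B\<close>, a finite dimensional space.\<close>

lemma kernel_finitely_generated:
  assumes I: "finite I" and \<phi>: "linear_map R (free_module R I) (free_module R J) \<phi>"
    and \<phi>B: "\<And>i j. i \<in> I \<Longrightarrow> j \<in> J \<Longrightarrow> \<phi> (single R I i) j \<in> B"
  shows "\<exists>H. finite H \<and> generates R (free_module R I) H
    {x \<in> carrier (free_module R I). \<phi> x = \<zero>\<^bsub>free_module R J\<^esub>}"
proof -
  let ?V = "tuples I" and ?F = "free_module R I" and ?FJ = "free_module R J"
  \<comment> \<open>\<open>?W\<close> is the space of solutions over \<open>B\<close>. The
    functionals \<open>?f\<close> test each coordinate against each element of \<open>G\<close>;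
    they are finitely many and separate B^I.\<close>
  let ?W = "{x \<in> carrier ?V. \<phi> x = \<zero>\<^bsub>?FJ\<^esub>}" and ?f = "\<lambda>(b, i) x. \<theta> (b \<otimes>\<^bsub>R\<^esub> x i)"
  interpret V: left_module K ?V by (rule left_module_tuples)
  interpret F: left_module R ?F by (rule R.left_module_free)
  interpret FJ: left_module R ?FJ by (rule R.left_module_free)
  note simps = tuples_simps[OF I] and VF = tuple_in_free[OF I]
  note \<theta> = linear_mapD[OF form, simplified]
  have sub: "\<And>x y. x \<in> B \<Longrightarrow> y \<in> B \<Longrightarrow> x \<oplus>\<^bsub>R\<^esub> y \<in> B" "\<And>a x. a \<in> carrier K \<Longrightarrow> x \<in> B \<Longrightarrow> a \<odot>\<^bsub>R\<^esub> x \<in> B"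
    using submoduleD[OF submodule] by auto
  have W: "submodule ?W K ?V"
  proof (rule left_module_submoduleI[OF left_module_tuples])
    have "\<zero>\<^bsub>?V\<^esub> = \<zero>\<^bsub>?F\<^esub>" by (simp add: simps free_module_simps)
    then show "\<zero>\<^bsub>?V\<^esub> \<in> ?W"
      using linear_map_zero[OF F.left_module_axioms FJ.left_module_axioms \<phi>] V.M.zero_closed by simp
  next
    fix x y assume xy: "x \<in> ?W" "y \<in> ?W"
    then have "\<phi> (x \<oplus>\<^bsub>?F\<^esub> y) = \<zero>\<^bsub>?FJ\<^esub>" by (simp add: linear_mapD(2)[OF \<phi>] VF)
    moreover have "x \<oplus>\<^bsub>?F\<^esub> y = x \<oplus>\<^bsub>?V\<^esub> y" by (simp add: simps free_module_simps)
    ultimately show "x \<oplus>\<^bsub>?V\<^esub> y \<in> ?W" using xy by simp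
  next
    fix a x assume a: "a \<in> carrier K" and x: "x \<in> ?W"
    then have "\<phi> ((a \<odot>\<^bsub>R\<^esub> \<one>\<^bsub>R\<^esub>) \<odot>\<^bsub>?F\<^esub> x) = \<zero>\<^bsub>?FJ\<^esub>"
      by (simp add: linear_mapD(3)[OF \<phi>] VF smult_closed FJ.smult_r_null)
    moreover have "(a \<odot>\<^bsub>R\<^esub> \<one>\<^bsub>R\<^esub>) \<odot>\<^bsub>?F\<^esub> x = a \<odot>\<^bsub>?V\<^esub> x"
      using x by (simp add: simps tuple_smult[OF I a] VF)
    ultimately show "a \<odot>\<^bsub>?V\<^esub> x \<in> ?W" using a x by simp
  qed auto
  have f: "linear_map K ?V (regular K) (?f t)" if tG: "t \<in> G \<times> I" for t
  proof -
    obtain b i where t: "t = (b, i)" "b \<in> B" "i \<in> I" using tG separating(2) by auto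
    then show ?thesis
      using \<theta> mult_closed by (auto simp: linear_map_def simps PiE_iff R.r_distr in_carrier mult_smult)
  qed
  have sep: "w = \<zero>\<^bsub>?V\<^esub>" if w: "w \<in> ?W" and 0: "\<And>t. t \<in> G \<times> I \<Longrightarrow> ?f t w = \<zero>\<^bsub>K\<^esub>" for w
  proof -
    have "w i = \<zero>\<^bsub>R\<^esub>" if "i \<in> I" for i
    proof (rule separating(3))
      show "w i \<in> B" using w that by (auto simp: simps)
      show "\<theta> (b \<otimes>\<^bsub>R\<^esub> w i) = \<zero>\<^bsub>K\<^esub>" if "b \<in> G" for b using 0[of "(b, i)"] that \<open>i \<in> I\<close> by simp
    qed
    then show ?thesis using w by (auto simp: simps PiE_iff extensional_def fun_eq_iff)
  qed
  have "finite (G \<times> I)" using separating(1) I by simp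
  then have "\<exists>H. finite H \<and> generates K ?V H ?W"
    by (rule separated_subspace_finitely_generated[OF field left_module_tuples _ f W sep])
  then obtain H where H: "finite H" "generates K ?V H ?W" by (elim exE conjE)
  have "x \<in> U" if U: "submodule U R ?F" "H \<subseteq> U" and x: "x \<in> carrier ?F" "\<phi> x = \<zero>\<^bsub>?FJ\<^esub>" for U x
  proof -
    \<comment> \<open>\<open>H\<close> generates \<open>?W\<close> over \<open>K\<close> only; since
      the trace of \<open>U\<close> on B^I is a K-subspace, it already contains all of
      \<open>?W\<close>.\<close>
    have "submodule (U \<inter> carrier ?V) K ?V"
    proof (rule left_module_submoduleI[OF left_module_tuples])
      show "\<zero>\<^bsub>?V\<^esub> \<in> U \<inter> carrier ?V"
        using submoduleD(2)[OF U(1)] V.M.zero_closed by (simp add: simps free_module_simps)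
      show "y \<oplus>\<^bsub>?V\<^esub> z \<in> U \<inter> carrier ?V" if "y \<in> U \<inter> carrier ?V" "z \<in> U \<inter> carrier ?V" for y z
        using submoduleD(3)[OF U(1), of y z] that V.M.a_closed[of y z] by (simp add: simps free_module_simps)
      show "a \<odot>\<^bsub>?V\<^esub> y \<in> U \<inter> carrier ?V" if a: "a \<in> carrier K" and y: "y \<in> U \<inter> carrier ?V" for a y
      proof -
        have "(a \<odot>\<^bsub>R\<^esub> \<one>\<^bsub>R\<^esub>) \<odot>\<^bsub>?F\<^esub> y \<in> U" using submoduleD(4)[OF U(1)] y a by (simp add: smult_closed)
        then show ?thesis using y a V.smult_closed[OF a] by (simp add: simps tuple_smult[OF I a VF])
      qed
    qed auto
    moreover have "H \<subseteq> U \<inter> carrier ?V" using U(2) H(2) by (auto simp: generates_def)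
    ultimately have WU: "?W \<subseteq> U" using generatesD[OF H(2)] by blast
    have xI: "x i \<in> carrier R" if "i \<in> I" for i using x(1) that by (auto simp: free_module_simps)
    then have "finite (x ` I)" "x ` I \<subseteq> carrier R" using I by auto
    from decomposition[OF this] obtain E c where E: "finite E" "E \<subseteq> carrier R" "c \<in> x ` I \<rightarrow> E \<rightarrow> B"
      and sum': "\<forall>y\<in>x ` I. y = (\<Oplus>\<^bsub>R\<^esub>e\<in>E. e \<otimes>\<^bsub>R\<^esub> c y e)"
      and indep': "\<forall>b\<in>E \<rightarrow> B. (\<Oplus>\<^bsub>R\<^esub>e\<in>E. e \<otimes>\<^bsub>R\<^esub> b e) = \<zero>\<^bsub>R\<^esub> \<longrightarrow> (\<forall>e\<in>E. b e = \<zero>\<^bsub>R\<^esub>)"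
      by (elim exE conjE)
    have sum: "x i = (\<Oplus>\<^bsub>R\<^esub>e\<in>E. e \<otimes>\<^bsub>R\<^esub> c (x i) e)" if "i \<in> I" for i
      using bspec[OF sum' imageI[OF that]] .
    have indep: "b e = \<zero>\<^bsub>R\<^esub>"
      if "b \<in> E \<rightarrow> B" "(\<Oplus>\<^bsub>R\<^esub>e\<in>E. e \<otimes>\<^bsub>R\<^esub> b e) = \<zero>\<^bsub>R\<^esub>" "e \<in> E" for b e
      using bspec[OF mp[OF bspec[OF indep' that(1)] that(2)] that(3)] .
    \<comment> \<open>The coefficient of \<open>e\<close> in all coordinates of \<open>x\<close> at
      once, so that \<open>x\<close> is the sum of the \<open>e * y e\<close>. Applying
      \<open>\<phi>\<close> gives a vanishing combination of the \<open>e\<close> with coefficients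
      in \<open>B\<close> on the right, whence each \<open>y e\<close> is itself a solution.\<close>
    define y where "y e = (\<lambda>i\<in>I. c (x i) e)" for e
    have y: "y e \<in> carrier ?V" if "e \<in> E" for e
      using E(3) that by (auto simp: simps y_def)
    have yF: "y e \<in> carrier ?F" if "e \<in> E" for e using VF[OF y[OF that]] .
    have eyF: "(\<lambda>e. e \<odot>\<^bsub>?F\<^esub> y e) \<in> E \<rightarrow> carrier ?F"
      by (intro Pi_I F.smult_closed yF) (use E(2) in auto)
    have x_sum: "x = (\<Oplus>\<^bsub>?F\<^esub>e\<in>E. e \<odot>\<^bsub>?F\<^esub> y e)"
    proof (rule free_module_ext[OF x(1)])
      show "(\<Oplus>\<^bsub>?F\<^esub>e\<in>E. e \<odot>\<^bsub>?F\<^esub> y e) \<in> carrier ?F" using eyF by (rule F.M.finsum_closed)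
      fix i assume i: "i \<in> I"
      have "(\<Oplus>\<^bsub>?F\<^esub>e\<in>E. e \<odot>\<^bsub>?F\<^esub> y e) i = (\<Oplus>\<^bsub>R\<^esub>e\<in>E. (e \<odot>\<^bsub>?F\<^esub> y e) i)"
        by (rule finsum_free_eval[OF ring E(1) eyF i])
      also have "\<dots> = x i" using i by (simp add: free_module_simps y_def flip: sum)
      finally show "x i = (\<Oplus>\<^bsub>?F\<^esub>e\<in>E. e \<odot>\<^bsub>?F\<^esub> y e) i" by simp
    qed
    have \<phi>yj: "\<phi> (y e) j \<in> B" if "e \<in> E" "j \<in> J" for e j
      by (rule linear_map_tuple_closed[OF I linear_map_comp[OF \<phi> linear_map_eval[OF that(2)]] \<phi>B y])
        (use that in auto)
    have "\<phi> (y e) = \<zero>\<^bsub>?FJ\<^esub>" if e: "e \<in> E" for e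
    proof (rule free_module_ext[OF linear_mapD(1)[OF \<phi> yF[OF e]] FJ.M.zero_closed])
      fix j assume j: "j \<in> J"
      note ev = linear_map_comp[OF \<phi> linear_map_eval[OF j]]
      have "\<zero>\<^bsub>R\<^esub> = \<phi> x j" using j by (simp add: x(2) free_module_simps)
      also have "\<dots> = (\<Oplus>\<^bsub>regular R\<^esub>e\<in>E. \<phi> (e \<odot>\<^bsub>?F\<^esub> y e) j)"
        unfolding x_sum
        by (rule linear_map_finsum[OF F.left_module_axioms left_module_regular[OF ring] ev E(1) eyF])
      also have "\<dots> = (\<Oplus>\<^bsub>R\<^esub>e\<in>E. \<phi> (e \<odot>\<^bsub>?F\<^esub> y e) j)"
        by (rule finsum_regular[OF ring E(1)]) (use linear_mapD(1)[OF ev] eyF in auto)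
      also have "\<dots> = (\<Oplus>\<^bsub>R\<^esub>e\<in>E. e \<otimes>\<^bsub>R\<^esub> \<phi> (y e) j)"
      proof (rule R.finsum_cong'[OF refl])
        show "(\<lambda>e. e \<otimes>\<^bsub>R\<^esub> \<phi> (y e) j) \<in> E \<rightarrow> carrier R" using E(2) \<phi>yj[OF _ j] in_carrier by auto
        show "\<phi> (e \<odot>\<^bsub>?F\<^esub> y e) j = e \<otimes>\<^bsub>R\<^esub> \<phi> (y e) j" if "e \<in> E" for e
          using linear_mapD(3)[OF ev _ yF[OF that]] E(2) that by auto
      qed
      finally have "\<phi> (y e) j = \<zero>\<^bsub>R\<^esub>"
        using indep[of "\<lambda>e. \<phi> (y e) j", OF _ _ e] \<phi>yj[OF _ j] by auto
      then show "\<phi> (y e) j = \<zero>\<^bsub>?FJ\<^esub> j" using j by (simp add: free_module_simps)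
    qed
    then have "y e \<in> U" if "e \<in> E" for e using WU y that by auto
    then show "x \<in> U"
      unfolding x_sum
      by (intro submodule_finsum[OF F.left_module_axioms U(1) E(1)] Pi_I submoduleD(4)[OF U(1)]) (use E(2) in auto)
  qed
  moreover have "H \<subseteq> {x \<in> carrier ?F. \<phi> x = \<zero>\<^bsub>?FJ\<^esub>}"
    using H(2) VF by (auto simp: generates_def)
  ultimately have "generates R ?F H {x \<in> carrier ?F. \<phi> x = \<zero>\<^bsub>?FJ\<^esub>}" by (auto simp: generates_def)
  with H(1) show ?thesis by blast
qed

text \<open>
  The functionals on \<open>B\<^sup>I\<close> are the maps \<open>v \<mapsto> \<theta> (\<Sum> x\<^sub>i v\<^sub>i)\<close>; those vanishing on the image of the
  transpose of \<open>\<phi>\<close> come from tuples \<open>x\<close> in the kernel of \<open>\<phi>\<close>.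
\<close>

lemma extension_along:
  assumes I: "finite I" and J: "finite J" and \<phi>: "linear_map R (free_module R I) (free_module R J) \<phi>"
    and \<phi>B: "\<And>i j. i \<in> I \<Longrightarrow> j \<in> J \<Longrightarrow> \<phi> (single R I i) j \<in> B"
    and c: "linear_map R (free_module R I) (regular R) c" and cB: "\<And>i. i \<in> I \<Longrightarrow> c (single R I i) \<in> B"
    and ker: "\<And>x. x \<in> carrier (free_module R I) \<Longrightarrow> \<phi> x = \<zero>\<^bsub>free_module R J\<^esub> \<Longrightarrow> c x = \<zero>\<^bsub>R\<^esub>"
  shows "\<exists>h. linear_map R (free_module R J) (regular R) h \<and> (\<forall>x\<in>carrier (free_module R I). h (\<phi> x) = c x)"
proof -
  let ?V = "tuples I" and ?F = "free_module R I" and ?FJ = "free_module R J"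
  interpret V: left_module K ?V by (rule left_module_tuples)
  interpret KR: left_module K R by (rule left_module_alg)
  interpret F: left_module R ?F by (rule R.left_module_free)
  interpret FJ: left_module R ?FJ by (rule R.left_module_free)
  interpret RR: left_module R "regular R" by (rule left_module_regular[OF ring])
  note simps = tuples_simps[OF I] and VF = tuple_in_free[OF I]
  note \<theta> = linear_mapD[OF form, simplified]
  have sub: "\<And>x y. x \<in> B \<Longrightarrow> y \<in> B \<Longrightarrow> x \<oplus>\<^bsub>R\<^esub> y \<in> B" "\<And>a x. a \<in> carrier K \<Longrightarrow> x \<in> B \<Longrightarrow> a \<odot>\<^bsub>R\<^esub> x \<in> B"
    and zB: "\<zero>\<^bsub>R\<^esub> \<in> B"
    using submoduleD[OF submodule] by auto
  have \<theta>0: "\<theta> \<zero>\<^bsub>R\<^esub> = \<zero>\<^bsub>K\<^esub>"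
    using linear_map_zero[OF left_module_submodule[OF left_module_alg submodule] left_module_regular[OF K.ring_axioms] form]
    by simp
  define p where "p x v = (\<Oplus>\<^bsub>R\<^esub>i\<in>I. x i \<otimes>\<^bsub>R\<^esub> v i)" for x v :: "'b \<Rightarrow> 'a"
  have p_eq: "f x = p x (\<lambda>i. f (single R I i))"
    if f: "linear_map R ?F (regular R) f" and x: "x \<in> carrier ?F" for f x
  proof -
    have "f x = (\<Oplus>\<^bsub>regular R\<^esub>i\<in>I. x i \<otimes>\<^bsub>R\<^esub> f (single R I i))"
      using linear_map_coord[OF RR.left_module_axioms f I x] by simp
    also have "\<dots> = p x (\<lambda>i. f (single R I i))" unfolding p_def
      by (rule finsum_regular[OF ring I])
        (use x linear_mapD(1)[OF f R.single_closed] in \<open>auto simp: free_module_simps PiE_iff\<close>)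
    finally show ?thesis .
  qed
  have p_cong: "p x v = p x v'" if "\<And>i. i \<in> I \<Longrightarrow> v i = v' i" "x \<in> carrier ?V" "v' \<in> I \<rightarrow> B" for x v v'
    unfolding p_def
    by (rule R.finsum_cong') (use that in \<open>auto simp: simps PiE_iff Pi_iff in_carrier\<close>)
  have p_closed: "p x v \<in> B" if "x \<in> carrier ?V" "v \<in> carrier ?V" for x v
    unfolding p_def by (rule submodule_sum[OF I]) (use that in \<open>auto simp: simps intro: mult_closed\<close>)
  have p_add: "p x (v \<oplus>\<^bsub>?V\<^esub> w) = p x v \<oplus>\<^bsub>R\<^esub> p x w" "p (v \<oplus>\<^bsub>?V\<^esub> w) x = p v x \<oplus>\<^bsub>R\<^esub> p w x"
    if xvw: "x \<in> carrier ?V" "v \<in> carrier ?V" "w \<in> carrier ?V" for x v w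
  proof -
    have cl: "x i \<in> carrier R" "v i \<in> carrier R" "w i \<in> carrier R" if "i \<in> I" for i
      using xvw that by (auto simp: simps intro!: in_carrier)
    have "p x (v \<oplus>\<^bsub>?V\<^esub> w) = (\<Oplus>\<^bsub>R\<^esub>i\<in>I. x i \<otimes>\<^bsub>R\<^esub> v i \<oplus>\<^bsub>R\<^esub> x i \<otimes>\<^bsub>R\<^esub> w i)"
      unfolding p_def by (rule R.finsum_cong') (use cl in \<open>auto simp: simps R.r_distr\<close>)
    also have "\<dots> = p x v \<oplus>\<^bsub>R\<^esub> p x w"
      unfolding p_def by (rule R.finsum_addf) (use cl in auto)
    finally show "p x (v \<oplus>\<^bsub>?V\<^esub> w) = p x v \<oplus>\<^bsub>R\<^esub> p x w" .
    have "p (v \<oplus>\<^bsub>?V\<^esub> w) x = (\<Oplus>\<^bsub>R\<^esub>i\<in>I. v i \<otimes>\<^bsub>R\<^esub> x i \<oplus>\<^bsub>R\<^esub> w i \<otimes>\<^bsub>R\<^esub> x i)"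
      unfolding p_def by (rule R.finsum_cong') (use cl in \<open>auto simp: simps R.l_distr\<close>)
    also have "\<dots> = p v x \<oplus>\<^bsub>R\<^esub> p w x"
      unfolding p_def by (rule R.finsum_addf) (use cl in auto)
    finally show "p (v \<oplus>\<^bsub>?V\<^esub> w) x = p v x \<oplus>\<^bsub>R\<^esub> p w x" .
  qed
  have p_smult: "p x (a \<odot>\<^bsub>?V\<^esub> v) = a \<odot>\<^bsub>R\<^esub> p x v" "p (a \<odot>\<^bsub>?V\<^esub> x) v = a \<odot>\<^bsub>R\<^esub> p x v"
    if xv: "x \<in> carrier ?V" "v \<in> carrier ?V" and a: "a \<in> carrier K" for x v a
  proof -
    have cl: "x i \<in> carrier R" "v i \<in> carrier R" if "i \<in> I" for i
      using xv that by (auto simp: simps intro!: in_carrier)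
    show "p x (a \<odot>\<^bsub>?V\<^esub> v) = a \<odot>\<^bsub>R\<^esub> p x v"
      unfolding p_def using cl a
      by (subst KR.finsum_smult[OF I a])
        (auto simp: simps mult_smult smult_closed intro!: R.finsum_cong')
    show "p (a \<odot>\<^bsub>?V\<^esub> x) v = a \<odot>\<^bsub>R\<^esub> p x v"
      unfolding p_def using cl a
      by (subst KR.finsum_smult[OF I a])
        (auto simp: simps smult_mult smult_closed intro!: R.finsum_cong')
  qed
  define \<Phi> where "\<Phi> = (\<lambda>x v. \<theta> (p x v)) ` carrier ?V"
  \<comment> \<open>\<open>dual\<close> consists of the maps R^J -> R with coefficients in
    \<open>B\<close>, and \<open>pull\<close> sends such an \<open>h\<close> to the column of h
    \<circ> \<phi>: its image is the column space of the matrix of \<open>\<phi>\<close> over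
    \<open>B\<close>. The goal becomes that the column \<open>?c\<close> of \<open>c\<close> lies in
    this space.\<close>
  define dual where "dual = {h. linear_map R ?FJ (regular R) h \<and> (\<forall>j\<in>J. h (single R J j) \<in> B)}"
  define pull where "pull h = (\<lambda>i\<in>I. h (\<phi> (single R I i)))" for h :: "('c \<Rightarrow> 'a) \<Rightarrow> 'a"
  let ?c = "\<lambda>i\<in>I. c (single R I i)"
  have dual_closed: "h (\<phi> (single R I i)) \<in> B" if h: "h \<in> dual" and i: "i \<in> I" for h i
  proof (rule linear_map_tuple_closed[where f = h, OF J])
    show "linear_map R ?FJ (regular R) h" "\<And>j. j \<in> J \<Longrightarrow> h (single R J j) \<in> B" using h by (auto simp: dual_def)
    have "\<phi> (single R I i) \<in> carrier ?FJ" using linear_mapD(1)[OF \<phi> R.single_closed] .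
    then show "\<phi> (single R I i) \<in> carrier (tuples J)"
      using \<phi>B[OF i] by (auto simp: tuples_simps[OF J] free_module_simps PiE_iff)
  qed
  have pull_closed: "pull h \<in> carrier ?V" if "h \<in> dual" for h
    using dual_closed[OF that] by (simp add: simps pull_def)
  have p_pull: "p x (pull h) = h (\<phi> x)" if h: "h \<in> dual" and x: "x \<in> carrier ?V" for h x
  proof -
    have "linear_map R ?FJ (regular R) h" using h by (simp add: dual_def)
    from p_eq[OF linear_map_comp[OF \<phi> this] VF[OF x]]
    show ?thesis using p_cong[OF _ x, of "pull h" "\<lambda>i. h (\<phi> (single R I i))"] dual_closed[OF h]
      by (auto simp: pull_def)
  qed
  have W: "submodule (pull ` dual) K ?V"
  proof (rule left_module_submoduleI[OF left_module_tuples])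
    show "pull ` dual \<subseteq> carrier ?V" using pull_closed by auto
    have "(\<lambda>_. \<zero>\<^bsub>R\<^esub>) \<in> dual" by (simp add: dual_def linear_map_def zB)
    then show "\<zero>\<^bsub>?V\<^esub> \<in> pull ` dual" by (rule rev_image_eqI) (simp add: simps pull_def)
  next
    fix v w assume "v \<in> pull ` dual" "w \<in> pull ` dual"
    then obtain h k where h: "h \<in> dual" "v = pull h" and k: "k \<in> dual" "w = pull k" by blast
    have "(\<lambda>x. h x \<oplus>\<^bsub>R\<^esub> k x) \<in> dual"
      using linear_map_add[OF FJ.left_module_axioms RR.left_module_axioms, of h k] h k sub by (simp add: dual_def)
    then show "v \<oplus>\<^bsub>?V\<^esub> w \<in> pull ` dual"
      by (rule rev_image_eqI) (auto simp: simps pull_def h k intro: restrict_ext)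
  next
    fix a v assume a: "a \<in> carrier K" and "v \<in> pull ` dual"
    then obtain h where h: "h \<in> dual" "v = pull h" by blast
    have "linear_map R ?FJ (regular R) (\<lambda>x. a \<odot>\<^bsub>R\<^esub> h x)"
      using h a by (auto simp: dual_def linear_map_def smult_closed KR.smult_r_distr mult_smult Pi_iff)
    then have "(\<lambda>x. a \<odot>\<^bsub>R\<^esub> h x) \<in> dual" using h a sub by (simp add: dual_def)
    then show "a \<odot>\<^bsub>?V\<^esub> v \<in> pull ` dual"
      by (rule rev_image_eqI) (auto simp: simps pull_def h intro: restrict_ext)
  qed
  have lin: "linear_map K ?V (regular K) f" if "f \<in> \<Phi>" for f
    using that \<theta> p_closed p_add(1) p_smult(1) by (auto simp: \<Phi>_def linear_map_def)
  have closed: "\<exists>h\<in>\<Phi>. \<forall>v\<in>carrier ?V. h v = f v \<ominus>\<^bsub>K\<^esub> a \<otimes>\<^bsub>K\<^esub> g v"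
    if fg: "f \<in> \<Phi>" "g \<in> \<Phi>" and a: "a \<in> carrier K" for f g a
  proof -
    obtain x y where x: "x \<in> carrier ?V" "f = (\<lambda>v. \<theta> (p x v))" and y: "y \<in> carrier ?V" "g = (\<lambda>v. \<theta> (p y v))"
      using fg by (auto simp: \<Phi>_def)
    let ?z = "x \<oplus>\<^bsub>?V\<^esub> (\<ominus>\<^bsub>K\<^esub> a) \<odot>\<^bsub>?V\<^esub> y"
    have "\<theta> (p ?z v) = f v \<ominus>\<^bsub>K\<^esub> a \<otimes>\<^bsub>K\<^esub> g v" if v: "v \<in> carrier ?V" for v
    proof -
      have "p ?z v = p x v \<oplus>\<^bsub>R\<^esub> (\<ominus>\<^bsub>K\<^esub> a) \<odot>\<^bsub>R\<^esub> p y v"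
        using p_add(2)[OF v x(1)] p_smult(2)[OF y(1) v] a y(1) by simp
      then have "\<theta> (p ?z v) = f v \<oplus>\<^bsub>K\<^esub> (\<ominus>\<^bsub>K\<^esub> a) \<otimes>\<^bsub>K\<^esub> g v"
        using \<theta> p_closed[OF x(1) v] p_closed[OF y(1) v] a sub(2) by (simp add: x y)
      then show ?thesis
        using K.l_minus[OF a, of "g v"] \<theta>(1)[OF p_closed[OF y(1) v]] by (simp add: a_minus_def y)
    qed
    moreover have "?z \<in> carrier ?V" using x(1) y(1) a by simp
    ultimately show ?thesis by (intro bexI[of _ "\<lambda>v. \<theta> (p ?z v)"]) (auto simp: \<Phi>_def)
  qed
  have cV: "?c \<in> carrier ?V" using cB by (simp add: simps)
  have vanish: "f ?c = \<zero>\<^bsub>K\<^esub>" if f: "f \<in> \<Phi>" and 0: "\<forall>w\<in>pull ` dual. f w = \<zero>\<^bsub>K\<^esub>" for f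
  proof -
    obtain x where x: "x \<in> carrier ?V" "f = (\<lambda>v. \<theta> (p x v))" using f by (auto simp: \<Phi>_def)
    have "\<phi> x = \<zero>\<^bsub>?FJ\<^esub>"
    proof (rule free_module_ext[OF linear_mapD(1)[OF \<phi> VF[OF x(1)]] FJ.M.zero_closed])
      fix j assume j: "j \<in> J"
      have "\<phi> x j = \<zero>\<^bsub>R\<^esub>"
      proof (rule nondegenerate)
        show "\<phi> x j \<in> B"
          by (rule linear_map_tuple_closed[OF I linear_map_comp[OF \<phi> linear_map_eval[OF j]] \<phi>B x(1)])
            (use j in auto)
        fix b assume b: "b \<in> B"
        \<comment> \<open>The j-th coordinate followed by right multiplication by \<open>b\<close>.
          Testing against all of these turns vanishing on the column space into
          \<open>\<theta> (\<phi> x j * b) = 0\<close> for every \<open>b\<close>, which the form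
          detects.\<close>
        let ?h = "\<lambda>y. y j \<otimes>\<^bsub>R\<^esub> b"
        have "linear_map R ?FJ (regular R) ?h"
          using j b by (auto simp: linear_map_def free_module_simps PiE_iff R.l_distr R.m_assoc in_carrier)
        then have h: "?h \<in> dual" using j b zB in_carrier[OF b] by (auto simp: dual_def single_def)
        have "\<theta> (?h (\<phi> x)) = f (pull ?h)" using p_pull[OF h x(1)] by (simp add: x(2))
        then show "\<theta> (\<phi> x j \<otimes>\<^bsub>R\<^esub> b) = \<zero>\<^bsub>K\<^esub>" using bspec[OF 0 imageI[OF h]] by simp
      qed
      then show "\<phi> x j = \<zero>\<^bsub>?FJ\<^esub> j" using j by (simp add: free_module_simps)
    qed
    then have "c x = \<zero>\<^bsub>R\<^esub>" using ker VF[OF x(1)] by simp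
    moreover have "c x = p x ?c"
      using p_eq[OF c VF[OF x(1)]] p_cong[OF _ x(1), of ?c "\<lambda>i. c (single R I i)"] cB by auto
    ultimately show ?thesis by (simp add: x(2) \<theta>0)
  qed
  \<comment> \<open>The functional v -> \<theta>(b * v_i), represented by the tuple with
    \<open>b\<close> in place \<open>i\<close> and zero elsewhere. Letting \<open>b\<close> range
    over \<open>G\<close> gives a finite separating family inside \<open>\<Phi>\<close>.\<close>
  define coord where "coord = (\<lambda>(b, i) v. \<theta> (p (\<lambda>k\<in>I. if i = k then b else \<zero>\<^bsub>R\<^esub>) v))"
  have coord_in: "coord t \<in> \<Phi>" if "t \<in> G \<times> I" for t
    using that separating(2) zB by (auto simp: coord_def \<Phi>_def simps intro!: imageI)
  have coord_eq: "coord (b, i) v = \<theta> (b \<otimes>\<^bsub>R\<^esub> v i)" if "b \<in> B" "i \<in> I" "v \<in> carrier ?V" for b i v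
  proof -
    have cl: "b \<in> carrier R" "\<And>k. k \<in> I \<Longrightarrow> v k \<in> carrier R" using that by (auto simp: simps intro!: in_carrier)
    have "p (\<lambda>k\<in>I. if i = k then b else \<zero>\<^bsub>R\<^esub>) v = (\<Oplus>\<^bsub>R\<^esub>k\<in>I. if i = k then b \<otimes>\<^bsub>R\<^esub> v k else \<zero>\<^bsub>R\<^esub>)"
      unfolding p_def by (rule R.finsum_cong') (use cl in auto)
    also have "\<dots> = b \<otimes>\<^bsub>R\<^esub> v i"
      by (rule R.finsum_singleton) (use that cl I in auto)
    finally show ?thesis by (simp add: coord_def)
  qed
  have fin: "finite (G \<times> I)" using separating(1) I by simp
  have "\<exists>w\<in>pull ` dual. \<forall>t\<in>G \<times> I. coord t w = coord t ?c"
    by (rule interpolation_on_subspace[where \<Phi> = \<Phi>, OF field left_module_tuples W cV])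
      (erule lin | erule (2) closed | erule (1) vanish | rule fin | erule coord_in)+
  then obtain h where h: "h \<in> dual" "\<And>t. t \<in> G \<times> I \<Longrightarrow> coord t (pull h) = coord t ?c"
    by auto
  have hlin: "linear_map R ?FJ (regular R) h" using h(1) by (simp add: dual_def)
  have "h (\<phi> (single R I i)) = c (single R I i)" if i: "i \<in> I" for i
  proof -
    have hi: "h (\<phi> (single R I i)) \<in> B" and ci: "c (single R I i) \<in> B"
      using dual_closed[OF h(1) i] cB[OF i] by auto
    \<comment> \<open>Interpolation gives equality only after applying the functionals
      \<open>coord\<close>; the separating property of \<open>G\<close>, applied to the difference
      of the two values, removes them.\<close>
    let ?d = "h (\<phi> (single R I i)) \<oplus>\<^bsub>R\<^esub> (\<ominus>\<^bsub>R\<^esub> c (single R I i))"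
    have mci: "\<ominus>\<^bsub>R\<^esub> c (single R I i) \<in> B" using submoduleD(5)[OF submodule ci] .
    have "?d = \<zero>\<^bsub>R\<^esub>"
    proof (rule separating(3))
      show "?d \<in> B" using sub(1)[OF hi mci] .
      fix b assume b: "b \<in> G"
      then have bB: "b \<in> B" using separating(2) by auto
      have "\<theta> (b \<otimes>\<^bsub>R\<^esub> h (\<phi> (single R I i))) = \<theta> (b \<otimes>\<^bsub>R\<^esub> c (single R I i))"
        using h(2)[of "(b, i)"] b i coord_eq[OF bB i pull_closed[OF h(1)]] coord_eq[OF bB i cV]
        by (simp add: pull_def)
      moreover have "\<theta> (b \<otimes>\<^bsub>R\<^esub> ?d) = \<theta> (b \<otimes>\<^bsub>R\<^esub> h (\<phi> (single R I i))) \<oplus>\<^bsub>K\<^esub> \<theta> (b \<otimes>\<^bsub>R\<^esub> (\<ominus>\<^bsub>R\<^esub> c (single R I i)))"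
        using \<theta>(2) mult_closed[OF bB hi] mult_closed[OF bB mci] in_carrier bB hi mci by (simp add: R.r_distr)
      moreover have "\<theta> (b \<otimes>\<^bsub>R\<^esub> c (single R I i)) \<oplus>\<^bsub>K\<^esub> \<theta> (b \<otimes>\<^bsub>R\<^esub> (\<ominus>\<^bsub>R\<^esub> c (single R I i))) = \<zero>\<^bsub>K\<^esub>"
        using \<theta>(2)[OF mult_closed[OF bB ci] mult_closed[OF bB mci]] in_carrier[OF bB] in_carrier[OF ci] \<theta>0
        by (simp flip: R.r_distr add: R.r_neg)
      ultimately show "\<theta> (b \<otimes>\<^bsub>R\<^esub> ?d) = \<zero>\<^bsub>K\<^esub>" by simp
    qed
    then show ?thesis using in_carrier[OF hi] in_carrier[OF ci] by (simp add: R.r_right_minus_eq flip: a_minus_def)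
  qed
  then have "h (\<phi> x) = c x" if "x \<in> carrier ?F" for x
    by (rule linear_map_free_ext[OF RR.left_module_axioms linear_map_comp[OF \<phi> hlin] c _ that])
  with hlin show ?thesis by blast
qed

end

section \<open>Direct sums\<close>

lemma direct_sum_simps:
  "carrier (direct_sum I M) = {f \<in> (\<Pi>\<^sub>E i\<in>I. carrier (M i)). finite {i \<in> I. f i \<noteq> \<zero>\<^bsub>M i\<^esub>}}"
  "\<zero>\<^bsub>direct_sum I M\<^esub> = (\<lambda>i\<in>I. \<zero>\<^bsub>M i\<^esub>)"
  "f \<oplus>\<^bsub>direct_sum I M\<^esub> g = (\<lambda>i\<in>I. f i \<oplus>\<^bsub>M i\<^esub> g i)"
  "a \<odot>\<^bsub>direct_sum I M\<^esub> f = (\<lambda>i\<in>I. a \<odot>\<^bsub>M i\<^esub> f i)"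
  by (simp_all add: direct_sum_def)

definition inclusion :: "'i set \<Rightarrow> ('i \<Rightarrow> ('a, 'm) module) \<Rightarrow> 'i \<Rightarrow> 'm \<Rightarrow> 'i \<Rightarrow> 'm" where
  "inclusion I M i y = (\<lambda>k\<in>I. if k = i then y else \<zero>\<^bsub>M k\<^esub>)"

locale module_family =
  fixes R :: "('a, 'e) ring_scheme" and I :: "'i set" and M :: "'i \<Rightarrow> ('a, 'm) module"
  assumes ring: "ring R" and summand: "i \<in> I \<Longrightarrow> left_module R (M i)"
begin

abbreviation S :: "('a, 'i \<Rightarrow> 'm) module" where "S \<equiv> direct_sum I M"

lemma left_module_sum: "left_module R S"
  by (rule left_module_direct_sum[OF ring summand])

lemma summand_simps:
  assumes "i \<in> I"
  shows "\<zero>\<^bsub>M i\<^esub> \<in> carrier (M i)" "x \<in> carrier (M i) \<Longrightarrow> x \<oplus>\<^bsub>M i\<^esub> \<zero>\<^bsub>M i\<^esub> = x"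
    "x \<in> carrier (M i) \<Longrightarrow> \<zero>\<^bsub>M i\<^esub> \<oplus>\<^bsub>M i\<^esub> x = x" "a \<in> carrier R \<Longrightarrow> a \<odot>\<^bsub>M i\<^esub> \<zero>\<^bsub>M i\<^esub> = \<zero>\<^bsub>M i\<^esub>"
proof -
  interpret left_module R "M i" by (rule summand[OF assms])
  show "\<zero>\<^bsub>M i\<^esub> \<in> carrier (M i)" "x \<in> carrier (M i) \<Longrightarrow> x \<oplus>\<^bsub>M i\<^esub> \<zero>\<^bsub>M i\<^esub> = x"
    "x \<in> carrier (M i) \<Longrightarrow> \<zero>\<^bsub>M i\<^esub> \<oplus>\<^bsub>M i\<^esub> x = x" "a \<in> carrier R \<Longrightarrow> a \<odot>\<^bsub>M i\<^esub> \<zero>\<^bsub>M i\<^esub> = \<zero>\<^bsub>M i\<^esub>"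
    by (simp_all add: smult_r_null)
qed

lemma component: "x \<in> carrier S \<Longrightarrow> i \<in> I \<Longrightarrow> x i \<in> carrier (M i)"
  by (auto simp: direct_sum_simps)

lemma sum_ext: "x \<in> carrier S \<Longrightarrow> y \<in> carrier S \<Longrightarrow> (\<And>i. i \<in> I \<Longrightarrow> x i = y i) \<Longrightarrow> x = y"
  by (auto simp: direct_sum_simps PiE_iff intro: extensionalityI)

lemma inclusion_linear:
  assumes i: "i \<in> I"
  shows "linear_map R (M i) S (inclusion I M i)"
proof -
  have "finite {k \<in> I. k = i \<and> P}" for P by simp
  then show ?thesis using i
    by (auto simp: linear_map_def inclusion_def direct_sum_simps summand_simps fun_eq_iff
        intro: finite_subset[of _ "{i}"])
qed

lemma sum_of_inclusions:
  assumes x: "x \<in> carrier S"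
  shows "x = (\<Oplus>\<^bsub>S\<^esub>i\<in>{i \<in> I. x i \<noteq> \<zero>\<^bsub>M i\<^esub>}. inclusion I M i (x i))"
proof -
  interpret S: left_module R S by (rule left_module_sum)
  have incl: "inclusion I M i (x i) \<in> carrier S" if "i \<in> I" for i
    using linear_mapD(1)[OF inclusion_linear[OF that]] component[OF x that] .
  have "(\<Oplus>\<^bsub>S\<^esub>i\<in>T. inclusion I M i (x i)) = (\<lambda>k\<in>I. if k \<in> T then x k else \<zero>\<^bsub>M k\<^esub>)"
    if "finite T" "T \<subseteq> I" for T
    using that
  proof (induction T rule: finite_induct)
    case empty then show ?case by (simp add: direct_sum_simps)
  next
    case (insert t T)
    have "(\<Oplus>\<^bsub>S\<^esub>i\<in>Set.insert t T. inclusion I M i (x i))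
        = inclusion I M t (x t) \<oplus>\<^bsub>S\<^esub> (\<lambda>k\<in>I. if k \<in> T then x k else \<zero>\<^bsub>M k\<^esub>)"
      using insert incl by (subst S.M.finsum_insert) (auto simp: restrict_def)
    also have "\<dots> = (\<lambda>k\<in>I. if k \<in> Set.insert t T then x k else \<zero>\<^bsub>M k\<^esub>)"
      using insert(2,4) component[OF x]
      by (auto simp: direct_sum_simps inclusion_def summand_simps intro!: restrict_ext)
    finally show ?case .
  qed
  from this[of "{i \<in> I. x i \<noteq> \<zero>\<^bsub>M i\<^esub>}"] x
  have "(\<Oplus>\<^bsub>S\<^esub>i\<in>{i \<in> I. x i \<noteq> \<zero>\<^bsub>M i\<^esub>}. inclusion I M i (x i))
      = (\<lambda>k\<in>I. if k \<in> {i \<in> I. x i \<noteq> \<zero>\<^bsub>M i\<^esub>} then x k else \<zero>\<^bsub>M k\<^esub>)"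
    by (auto simp: direct_sum_simps)
  also have "\<dots> = x"
    using x by (auto simp: direct_sum_simps PiE_iff extensional_def fun_eq_iff)
  finally show ?thesis by (rule sym)
qed

text \<open>Uniqueness in the universal property of the coproduct: every element is a finite sum of
  included components.\<close>

lemma linear_map_sum_ext:
  assumes N: "left_module R N" and f: "linear_map R S N f" and g: "linear_map R S N g"
    and eq: "\<And>i y. i \<in> I \<Longrightarrow> y \<in> carrier (M i) \<Longrightarrow> f (inclusion I M i y) = g (inclusion I M i y)"
    and x: "x \<in> carrier S"
  shows "f x = g x"
proof -
  interpret N: left_module R N by (rule N)
  let ?T = "{i \<in> I. x i \<noteq> \<zero>\<^bsub>M i\<^esub>}"
  have fin: "finite ?T" using x by (simp add: direct_sum_simps)
  have incl: "inclusion I M i (x i) \<in> carrier S" if "i \<in> I" for i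
    using linear_mapD(1)[OF inclusion_linear[OF that]] component[OF x that] .
  then have cl: "(\<lambda>i. inclusion I M i (x i)) \<in> ?T \<rightarrow> carrier S" by auto
  have sum: "h x = (\<Oplus>\<^bsub>N\<^esub>i\<in>?T. h (inclusion I M i (x i)))" if "linear_map R S N h" for h
    using arg_cong[OF sum_of_inclusions[OF x], of h] linear_map_finsum[OF left_module_sum N that fin cl]
    by (rule trans)
  have "f x = (\<Oplus>\<^bsub>N\<^esub>i\<in>?T. f (inclusion I M i (x i)))"
    by (rule sum[OF f])
  also have "\<dots> = (\<Oplus>\<^bsub>N\<^esub>i\<in>?T. g (inclusion I M i (x i)))"
    by (rule N.M.finsum_cong')
      (use eq component[OF x] linear_mapD(1)[OF g incl] in auto)
  also have "\<dots> = g x"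
    by (rule sum[OF g, symmetric])
  finally show ?thesis .
qed

text \<open>Existence in the universal property of the coproduct. The defining sum over the support
  may be taken over any larger finite set, which is how the supports of x, y and x + y are brought
  together.\<close>

lemma linear_map_from_sum:
  assumes N: "left_module R N" and g: "\<And>i. i \<in> I \<Longrightarrow> linear_map R (M i) N (g i)"
  shows "\<exists>f. linear_map R S N f \<and> (\<forall>i\<in>I. \<forall>y\<in>carrier (M i). f (inclusion I M i y) = g i y)"
proof -
  interpret N: left_module R N by (rule N)
  interpret S: left_module R S by (rule left_module_sum)
  define f where "f x = (\<Oplus>\<^bsub>N\<^esub>i\<in>{i \<in> I. x i \<noteq> \<zero>\<^bsub>M i\<^esub>}. g i (x i))" for x
  note gD = linear_mapD[OF g]
  have g0: "g i \<zero>\<^bsub>M i\<^esub> = \<zero>\<^bsub>N\<^esub>" if "i \<in> I" for i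
    by (rule linear_map_zero[OF summand[OF that] N g[OF that]])
  have f_eq: "f x = (\<Oplus>\<^bsub>N\<^esub>i\<in>T. g i (x i))"
    if "finite T" "T \<subseteq> I" "{i \<in> I. x i \<noteq> \<zero>\<^bsub>M i\<^esub>} \<subseteq> T" "x \<in> carrier S" for x T
    unfolding f_def
    by (rule N.M.add.finprod_mono_neutral_cong_left)
      (use that g0 gD(1) component[OF that(4)] in auto)
  have fin: "finite {i \<in> I. x i \<noteq> \<zero>\<^bsub>M i\<^esub>}" if "x \<in> carrier S" for x
    using that by (simp add: direct_sum_simps)
  have gc: "(\<lambda>i. g i (x i)) \<in> T \<rightarrow> carrier N" if "x \<in> carrier S" "T \<subseteq> I" for x T
    using gD(1) component[OF that(1)] that(2) by auto
  have "linear_map R S N f"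
    unfolding linear_map_def
  proof (intro conjI ballI Pi_I)
    show "f x \<in> carrier N" if "x \<in> carrier S" for x
      unfolding f_def by (rule N.M.finsum_closed[OF gc[OF that]]) auto
  next
    fix x y assume x: "x \<in> carrier S" and y: "y \<in> carrier S"
    let ?T = "{i \<in> I. x i \<noteq> \<zero>\<^bsub>M i\<^esub>} \<union> {i \<in> I. y i \<noteq> \<zero>\<^bsub>M i\<^esub>}"
    have T: "finite ?T" "?T \<subseteq> I" using fin x y by auto
    have "f (x \<oplus>\<^bsub>S\<^esub> y) = (\<Oplus>\<^bsub>N\<^esub>i\<in>?T. g i ((x \<oplus>\<^bsub>S\<^esub> y) i))"
      by (rule f_eq[OF T _ S.M.a_closed[OF x y]]) (auto simp: direct_sum_simps summand_simps)
    also have "\<dots> = (\<Oplus>\<^bsub>N\<^esub>i\<in>?T. g i (x i) \<oplus>\<^bsub>N\<^esub> g i (y i))"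
      by (rule N.M.finsum_cong')
        (use gD(1,2) component[OF x] component[OF y] T(2) in \<open>auto simp: direct_sum_simps subset_iff\<close>)
    also have "\<dots> = (\<Oplus>\<^bsub>N\<^esub>i\<in>?T. g i (x i)) \<oplus>\<^bsub>N\<^esub> (\<Oplus>\<^bsub>N\<^esub>i\<in>?T. g i (y i))"
      by (rule N.M.finsum_addf[OF gc[OF x T(2)] gc[OF y T(2)]])
    also have "\<dots> = f x \<oplus>\<^bsub>N\<^esub> f y"
      by (simp only: f_eq[OF T _ x] f_eq[OF T _ y] Un_upper1 Un_upper2)
    finally show "f (x \<oplus>\<^bsub>S\<^esub> y) = f x \<oplus>\<^bsub>N\<^esub> f y" .
  next
    fix a x assume a: "a \<in> carrier R" and x: "x \<in> carrier S"
    let ?T = "{i \<in> I. x i \<noteq> \<zero>\<^bsub>M i\<^esub>}"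
    have T: "finite ?T" "?T \<subseteq> I" using fin x by auto
    have "f (a \<odot>\<^bsub>S\<^esub> x) = (\<Oplus>\<^bsub>N\<^esub>i\<in>?T. g i ((a \<odot>\<^bsub>S\<^esub> x) i))"
      by (rule f_eq[OF T _ S.smult_closed[OF a x]]) (use a in \<open>auto simp: direct_sum_simps summand_simps\<close>)
    also have "\<dots> = (\<Oplus>\<^bsub>N\<^esub>i\<in>?T. a \<odot>\<^bsub>N\<^esub> g i (x i))"
      by (rule N.M.finsum_cong')
        (use a gD(1,3) component[OF x] in \<open>auto simp: direct_sum_simps\<close>)
    also have "\<dots> = a \<odot>\<^bsub>N\<^esub> f x"
      unfolding f_def by (rule N.finsum_smult[OF T(1) a gc[OF x T(2)], symmetric])
    finally show "f (a \<odot>\<^bsub>S\<^esub> x) = a \<odot>\<^bsub>N\<^esub> f x" .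
  qed
  moreover have "f (inclusion I M i y) = g i y" if i: "i \<in> I" and y: "y \<in> carrier (M i)" for i y
  proof -
    have "f (inclusion I M i y) = (\<Oplus>\<^bsub>N\<^esub>k\<in>{i}. g k (inclusion I M i y k))"
      by (rule f_eq) (use i linear_mapD(1)[OF inclusion_linear[OF i] y] in \<open>auto simp: inclusion_def\<close>)
    also have "\<dots> = g i y" using i gD(1)[OF i y] by (simp add: inclusion_def)
    finally show ?thesis .
  qed
  ultimately show ?thesis by blast
qed

text \<open>Each inclusion of a summand lifts through the surjection from the free module on the
  elements of the sum; the universal property assembles these lifts into a section, which exhibits
  the sum as a retract of the very free module that the definition asks for.\<close>

lemma projective_sum:
  assumes P: "\<And>i. i \<in> I \<Longrightarrow> projective_module R (M i)"
  shows "projective_module R S"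
proof -
  interpret S: left_module R S by (rule left_module_sum)
  let ?F = "free_module R (carrier S)" and ?r = "S.lin_ext (carrier S) (\<lambda>x. x)"
  have F: "left_module R ?F" by (rule S.R.left_module_free)
  have r: "linear_map R ?F S ?r" by (rule linear_map_lin_ext[OF left_module_sum]) auto
  have "generates R S ((\<lambda>x. x) ` carrier S) (carrier S)" by (auto simp: generates_def)
  from lin_ext_image[OF left_module_sum submodule_carrier[OF left_module_sum] this]
  have onto: "?r ` carrier ?F = carrier S" .
  have "\<exists>h. linear_map R (M i) ?F h \<and> (\<forall>y\<in>carrier (M i). ?r (h y) = inclusion I M i y)" if "i \<in> I" for i
    by (rule lift_projective[OF P[OF that] F left_module_sum inclusion_linear[OF that] r])
      (use onto linear_mapD(1)[OF inclusion_linear[OF that]] in auto)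
  then have "\<forall>i\<in>I. \<exists>h. linear_map R (M i) ?F h \<and> (\<forall>y\<in>carrier (M i). ?r (h y) = inclusion I M i y)"
    by blast
  from bchoice[OF this] obtain h where h: "\<And>i. i \<in> I \<Longrightarrow> linear_map R (M i) ?F (h i)"
    "\<And>i y. i \<in> I \<Longrightarrow> y \<in> carrier (M i) \<Longrightarrow> ?r (h i y) = inclusion I M i y" by blast
  from linear_map_from_sum[OF F h(1)] obtain k where k: "linear_map R S ?F k"
    "\<And>i y. i \<in> I \<Longrightarrow> y \<in> carrier (M i) \<Longrightarrow> k (inclusion I M i y) = h i y" by blast
  have "?r (k x) = x" if "x \<in> carrier S" for x
    by (rule linear_map_sum_ext[OF left_module_sum linear_map_comp[OF k(1) r] linear_map_id _ that])
      (simp add: k(2) h(2))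
  then show ?thesis
    unfolding projective_module_def
    using left_module_sum mod_hom_restrict[OF left_module_sum k(1)] mod_hom_restrict[OF F r] linear_mapD(1)[OF k(1)]
    by (intro conjI bexI[of _ "restrict k (carrier S)"] bexI[of _ "restrict ?r (carrier ?F)"]) auto
qed

end

section \<open>Direct sums of maps and of resolutions\<close>

definition sum_map ::
  "'i set \<Rightarrow> ('i \<Rightarrow> ('a, 'm) module) \<Rightarrow> ('i \<Rightarrow> 'm \<Rightarrow> 'n) \<Rightarrow> ('i \<Rightarrow> 'm) \<Rightarrow> 'i \<Rightarrow> 'n" where
  "sum_map I M f = (\<lambda>x\<in>carrier (direct_sum I M). \<lambda>i\<in>I. f i (x i))"

lemma sum_map_hom:
  assumes M: "module_family R I M" and N: "module_family R I N"
    and f: "\<And>i. i \<in> I \<Longrightarrow> linear_map R (M i) (N i) (f i)"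
  shows "sum_map I M f \<in> mod_hom R (direct_sum I M) (direct_sum I N)"
proof -
  interpret M: module_family R I M by (rule M)
  interpret N: module_family R I N by (rule N)
  note fD = linear_mapD[OF f]
  have f0: "f i \<zero>\<^bsub>M i\<^esub> = \<zero>\<^bsub>N i\<^esub>" if "i \<in> I" for i
    by (rule linear_map_zero[OF M.summand[OF that] N.summand[OF that] f[OF that]])
  have fin: "finite {i \<in> I. f i (x i) \<noteq> \<zero>\<^bsub>N i\<^esub>}" if "finite {i \<in> I. x i \<noteq> \<zero>\<^bsub>M i\<^esub>}" for x
    by (rule finite_subset[OF _ that]) (auto simp: f0)
  have "linear_map R (direct_sum I M) (direct_sum I N) (\<lambda>x. \<lambda>i\<in>I. f i (x i))"
    by (auto simp: linear_map_def direct_sum_simps PiE_iff fD fin intro!: restrict_ext cong: conj_cong)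
  then show ?thesis
    unfolding sum_map_def by (rule mod_hom_restrict[OF M.left_module_sum])
qed

lemma sum_map_image:
  assumes M: "module_family R I M" and N: "module_family R I N"
    and f: "\<And>i. i \<in> I \<Longrightarrow> linear_map R (M i) (N i) (f i)"
  shows "sum_map I M f ` carrier (direct_sum I M) =
    {y \<in> carrier (direct_sum I N). \<forall>i\<in>I. y i \<in> f i ` carrier (M i)}"
proof
  interpret M: module_family R I M by (rule M)
  interpret N: module_family R I N by (rule N)
  have sm: "linear_map R (direct_sum I M) (direct_sum I N) (sum_map I M f)"
    using sum_map_hom[OF M N f] by (simp add: mod_hom_iff)
  show "sum_map I M f ` carrier (direct_sum I M) \<subseteq> {y \<in> carrier (direct_sum I N). \<forall>i\<in>I. y i \<in> f i ` carrier (M i)}"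
    using linear_mapD(1)[OF sm] M.component by (auto simp: sum_map_def)
  show "{y \<in> carrier (direct_sum I N). \<forall>i\<in>I. y i \<in> f i ` carrier (M i)} \<subseteq> sum_map I M f ` carrier (direct_sum I M)"
  proof
    fix y assume "y \<in> {y \<in> carrier (direct_sum I N). \<forall>i\<in>I. y i \<in> f i ` carrier (M i)}"
    then have y: "y \<in> carrier (direct_sum I N)" "\<And>i. i \<in> I \<Longrightarrow> y i \<in> f i ` carrier (M i)" by auto
    have f0: "f i \<zero>\<^bsub>M i\<^esub> = \<zero>\<^bsub>N i\<^esub>" if "i \<in> I" for i
      by (rule linear_map_zero[OF M.summand[OF that] N.summand[OF that] f[OF that]])
    \<comment> \<open>A zero component gets the preimage zero; otherwise the chosen preimages might
      have infinite support.\<close>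
    have "\<forall>i\<in>I. \<exists>z. z \<in> carrier (M i) \<and> f i z = y i \<and> (y i = \<zero>\<^bsub>N i\<^esub> \<longrightarrow> z = \<zero>\<^bsub>M i\<^esub>)"
    proof
      fix i assume i: "i \<in> I"
      show "\<exists>z. z \<in> carrier (M i) \<and> f i z = y i \<and> (y i = \<zero>\<^bsub>N i\<^esub> \<longrightarrow> z = \<zero>\<^bsub>M i\<^esub>)"
      proof (cases "y i = \<zero>\<^bsub>N i\<^esub>")
        case True
        then show ?thesis using M.summand_simps(1)[OF i] f0[OF i] by auto
      next
        case False
        then show ?thesis using y(2)[OF i] by auto
      qed
    qed
    from bchoice[OF this] obtain z where z: "\<And>i. i \<in> I \<Longrightarrow> z i \<in> carrier (M i)"
      "\<And>i. i \<in> I \<Longrightarrow> f i (z i) = y i" "\<And>i. i \<in> I \<Longrightarrow> y i = \<zero>\<^bsub>N i\<^esub> \<Longrightarrow> z i = \<zero>\<^bsub>M i\<^esub>" by blast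
    have "finite {i \<in> I. y i \<noteq> \<zero>\<^bsub>N i\<^esub>}" using y(1) by (simp add: direct_sum_simps)
    then have "finite {i \<in> I. restrict z I i \<noteq> \<zero>\<^bsub>M i\<^esub>}"
      by (rule rev_finite_subset) (auto dest: z(3))
    then have zc: "restrict z I \<in> carrier (direct_sum I M)" using z(1) by (simp add: direct_sum_simps)
    have "sum_map I M f (restrict z I) = y"
      by (rule N.sum_ext[OF linear_mapD(1)[OF sm zc] y(1)]) (simp add: sum_map_def zc z(2))
    then show "y \<in> sum_map I M f ` carrier (direct_sum I M)" using zc by (metis image_eqI)
  qed
qed

lemma sum_map_kernel:
  "{x \<in> carrier (direct_sum I M). sum_map I M f x = \<zero>\<^bsub>direct_sum I N\<^esub>} =
    {x \<in> carrier (direct_sum I M). \<forall>i\<in>I. x i \<in> {y \<in> carrier (M i). f i y = \<zero>\<^bsub>N i\<^esub>}}"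
  by (auto simp: sum_map_def direct_sum_simps fun_eq_iff restrict_def PiE_iff)

text \<open>Images and kernels of a direct sum of maps are computed componentwise, so exactness is
  inherited from the summands.\<close>

lemma projective_resolution_direct_sum:
  assumes N: "module_family R I N" and P: "\<And>i. i \<in> I \<Longrightarrow> projective_resolution R (N i) (P i) (d i) (e i)"
  shows "projective_resolution R (direct_sum I N) (\<lambda>n. direct_sum I (\<lambda>i. P i n))
    (\<lambda>n. sum_map I (\<lambda>i. P i (Suc n)) (\<lambda>i. d i n)) (sum_map I (\<lambda>i. P i 0) e)"
proof -
  interpret N: module_family R I N by (rule N)
  note PD = projective_resolutionD[OF P]
  have fam: "module_family R I (\<lambda>i. P i n)" for n
    using PD(2) N.ring by (simp add: module_family_def)
  have image: "sum_map I (\<lambda>i. P i (Suc n)) (\<lambda>i. d i n) ` carrier (direct_sum I (\<lambda>i. P i (Suc n))) =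
      {y \<in> carrier (direct_sum I (\<lambda>i. P i n)). \<forall>i\<in>I. y i \<in> d i n ` carrier (P i (Suc n))}" for n
    by (rule sum_map_image[OF fam fam PD(3)])
  show ?thesis
    unfolding projective_resolution_def
  proof (intro conjI allI)
    show "projective_module R (direct_sum I (\<lambda>i. P i n))" for n
      by (rule module_family.projective_sum[OF fam PD(1)])
    show "sum_map I (\<lambda>i. P i (Suc n)) (\<lambda>i. d i n) \<in>
        mod_hom R (direct_sum I (\<lambda>i. P i (Suc n))) (direct_sum I (\<lambda>i. P i n))" for n
      by (rule sum_map_hom[OF fam fam PD(3)])
    show "sum_map I (\<lambda>i. P i 0) e \<in> mod_hom R (direct_sum I (\<lambda>i. P i 0)) (direct_sum I N)"
      by (rule sum_map_hom[OF fam N PD(4)])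
    show "sum_map I (\<lambda>i. P i 0) e ` carrier (direct_sum I (\<lambda>i. P i 0)) = carrier (direct_sum I N)"
    proof -
      have "sum_map I (\<lambda>i. P i 0) e ` carrier (direct_sum I (\<lambda>i. P i 0)) =
          {y \<in> carrier (direct_sum I N). \<forall>i\<in>I. y i \<in> e i ` carrier (P i 0)}"
        by (rule sum_map_image[OF fam N PD(4)])
      then show ?thesis using N.component PD(5) by auto
    qed
    show "sum_map I (\<lambda>i. P i (Suc 0)) (\<lambda>i. d i 0) ` carrier (direct_sum I (\<lambda>i. P i (Suc 0))) =
        {x \<in> carrier (direct_sum I (\<lambda>i. P i 0)). sum_map I (\<lambda>i. P i 0) e x = \<zero>\<^bsub>direct_sum I N\<^esub>}"
      unfolding image sum_map_kernel using PD(6) by auto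
    show "sum_map I (\<lambda>i. P i (Suc (Suc n))) (\<lambda>i. d i (Suc n)) ` carrier (direct_sum I (\<lambda>i. P i (Suc (Suc n)))) =
        {x \<in> carrier (direct_sum I (\<lambda>i. P i (Suc n))).
         sum_map I (\<lambda>i. P i (Suc n)) (\<lambda>i. d i n) x = \<zero>\<^bsub>direct_sum I (\<lambda>i. P i n)\<^esub>}" for n
      unfolding image sum_map_kernel using PD(7) by auto
  qed
qed

lemma sum_map_inclusion:
  assumes M: "module_family R I M" and N: "module_family R I N"
    and f: "\<And>i. i \<in> I \<Longrightarrow> linear_map R (M i) (N i) (f i)" and i: "i \<in> I" and y: "y \<in> carrier (M i)"
  shows "sum_map I M f (inclusion I M i y) = inclusion I N i (f i y)"
proof -
  interpret M: module_family R I M by (rule M)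
  interpret N: module_family R I N by (rule N)
  have "inclusion I M i y \<in> carrier (direct_sum I M)"
    using linear_mapD(1)[OF M.inclusion_linear[OF i] y] .
  moreover have "f k \<zero>\<^bsub>M k\<^esub> = \<zero>\<^bsub>N k\<^esub>" if "k \<in> I" for k
    by (rule linear_map_zero[OF M.summand[OF that] N.summand[OF that] f[OF that]])
  ultimately show ?thesis by (auto simp: sum_map_def inclusion_def intro!: restrict_ext)
qed

text \<open>Hom out of a coproduct is a product: a cocycle on the sum restricts to a cocycle on each
  summand, these are bounded separately, and the bounding maps are glued by the universal
  property.\<close>

lemma cocycles_bound_direct_sum:
  assumes L: "left_module R L" and N: "module_family R I N"
    and P: "\<And>i. i \<in> I \<Longrightarrow> projective_resolution R (N i) (P i) (d i) (e i)"
    and bound: "\<And>i. i \<in> I \<Longrightarrow> cocycles_bound R (P i) (d i) L s"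
  shows "cocycles_bound R (\<lambda>n. direct_sum I (\<lambda>i. P i n))
    (\<lambda>n. sum_map I (\<lambda>i. P i (Suc n)) (\<lambda>i. d i n)) L s"
  unfolding cocycles_bound_def
proof (intro allI impI, elim conjE)
  let ?P = "\<lambda>n i. P i n" and ?d = "\<lambda>n. sum_map I (\<lambda>i. P i (Suc n)) (\<lambda>i. d i n)"
  note PD = projective_resolutionD[OF P]
  have fam: "module_family R I (?P n)" for n
    using PD(2) N by (simp add: module_family_def)
  note incl = module_family.inclusion_linear[OF fam]
  fix f assume f: "linear_map R (direct_sum I (?P (Suc s))) L f"
    and cocycle: "\<forall>x\<in>carrier (direct_sum I (?P (Suc (Suc s)))). f (?d (Suc s) x) = \<zero>\<^bsub>L\<^esub>"
  have "\<forall>i\<in>I. \<exists>g. linear_map R (P i s) L g \<and>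
      (\<forall>y\<in>carrier (P i (Suc s)). f (inclusion I (?P (Suc s)) i y) = g (d i s y))"
  proof
    fix i assume i: "i \<in> I"
    have "f (inclusion I (?P (Suc s)) i (d i (Suc s) y)) = \<zero>\<^bsub>L\<^esub>" if y: "y \<in> carrier (P i (Suc (Suc s)))" for y
      using cocycle linear_mapD(1)[OF incl[OF i] y] sum_map_inclusion[OF fam fam PD(3) i y] by force
    with bound[OF i] linear_map_comp[OF incl[OF i] f]
    show "\<exists>g. linear_map R (P i s) L g \<and>
        (\<forall>y\<in>carrier (P i (Suc s)). f (inclusion I (?P (Suc s)) i y) = g (d i s y))"
      unfolding cocycles_bound_def by blast
  qed
  from bchoice[OF this] obtain g where g: "\<And>i. i \<in> I \<Longrightarrow> linear_map R (P i s) L (g i)"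
    "\<And>i y. i \<in> I \<Longrightarrow> y \<in> carrier (P i (Suc s)) \<Longrightarrow> f (inclusion I (?P (Suc s)) i y) = g i (d i s y)"
    by blast
  from module_family.linear_map_from_sum[OF fam L, of s g] g(1)
  obtain k where k: "linear_map R (direct_sum I (?P s)) L k"
    "\<And>i y. i \<in> I \<Longrightarrow> y \<in> carrier (P i s) \<Longrightarrow> k (inclusion I (?P s) i y) = g i y" by blast
  have "linear_map R (direct_sum I (?P (Suc s))) (direct_sum I (?P s)) (?d s)"
    using sum_map_hom[OF fam fam PD(3)] by (simp add: mod_hom_iff)
  from linear_map_comp[OF this k(1)]
  have "f x = k (?d s x)" if "x \<in> carrier (direct_sum I (?P (Suc s)))" for x
    by (rule module_family.linear_map_sum_ext[OF fam L f _ _ that])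
      (simp add: g(2) k(2) linear_mapD(1)[OF PD(3)] sum_map_inclusion[OF fam fam PD(3)])
  with k(1) show "\<exists>g. linear_map R (direct_sum I (?P s)) L g \<and>
      (\<forall>x\<in>carrier (direct_sum I (?P (Suc s))). f x = g (?d s x))" by blast
qed

text \<open>Only the augmentation changes. A given resolution of a module isomorphic to a direct sum
  thus becomes one of the sum itself, ready for comparison with the sum of resolutions.\<close>

lemma projective_resolution_iso:
  assumes M: "left_module R M" and N: "left_module R N"
    and f: "f \<in> mod_hom R M N" and bij: "bij_betw f (carrier M) (carrier N)"
    and PR: "projective_resolution R M P d e"
  shows "projective_resolution R N P d (restrict (\<lambda>x. f (e x)) (carrier (P 0)))"
proof -
  note P = projective_resolutionD[OF PR]
  have fl: "linear_map R M N f" using f by (simp add: mod_hom_iff)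
  have f0: "f \<zero>\<^bsub>M\<^esub> = \<zero>\<^bsub>N\<^esub>" by (rule linear_map_zero[OF M N fl])
  interpret M: left_module R M by (rule M)
  have iff: "f (e x) = \<zero>\<^bsub>N\<^esub> \<longleftrightarrow> e x = \<zero>\<^bsub>M\<^esub>" if "x \<in> carrier (P 0)" for x
    using bij_betw_imp_inj_on[OF bij] linear_mapD(1)[OF P(4) that] f0 by (metis M.zero_closed inj_on_eq_iff)
  have "(\<lambda>x. f (e x)) ` carrier (P 0) = carrier N"
    using P(5) bij_betw_imp_surj_on[OF bij] by (metis image_image)
  then show ?thesis
    using PR mod_hom_restrict[OF P(2) linear_map_comp[OF P(4) fl]] iff
    unfolding projective_resolution_def by auto
qed

section \<open>Coherence, resolutions and extension of maps\<close>

text \<open>Enumerating the generators gives the index sets \<open>{..<n}\<close> that finite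
  presentations and the resolutions below are built on.\<close>

lemma finite_free_cover:
  assumes M: "left_module R M" and H: "submodule H R M" and G: "finite G" "generates R M G H"
  shows "\<exists>(n::nat) h. h \<in> mod_hom R (free_module R {..<n}) M \<and> h ` carrier (free_module R {..<n}) = H"
proof -
  interpret M: left_module R M by fact
  obtain e where "bij_betw e {0..<card G} G"
    using ex_bij_betw_nat_finite[OF G(1)] by blast
  then have e: "e ` {..<card G} = G" by (auto simp: bij_betw_def atLeast0LessThan)
  then have "e \<in> {..<card G} \<rightarrow> carrier M"
    using G(2) submoduleD(1)[OF H] by (auto simp: generates_def)
  from M.lin_ext_hom[OF this] lin_ext_image[OF M H, of e "{..<card G}"] G(2) e
  show ?thesis by auto
qed

text \<open>The homomorphism theorem without forming a quotient: \<open>k\<close> is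
  \<open>h\<close> at some preimage, and the inclusion of kernels makes the choice
  immaterial.\<close>

lemma linear_map_factor:
  assumes L: "left_module R L" and V: "left_module R V" and N: "left_module R N"
    and p: "linear_map R L V p" "p ` carrier L = carrier V" and h: "linear_map R L N h"
    and ker: "\<And>x. x \<in> carrier L \<Longrightarrow> p x = \<zero>\<^bsub>V\<^esub> \<Longrightarrow> h x = \<zero>\<^bsub>N\<^esub>"
  shows "\<exists>k. linear_map R V N k \<and> (\<forall>x\<in>carrier L. k (p x) = h x)"
proof -
  interpret L: left_module R L by fact
  interpret V: left_module R V by fact
  interpret N: left_module R N by fact
  note pD = linear_mapD[OF p(1)] and hD = linear_mapD[OF h]
  define k where "k v = h (inv_into (carrier L) p v)" for v
  have k: "k (p x) = h x" if x: "x \<in> carrier L" for x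
  proof -
    let ?y = "inv_into (carrier L) p (p x)"
    have y: "?y \<in> carrier L" "p ?y = p x" using x by (auto intro: inv_into_into f_inv_into_f)
    have "p (?y \<ominus>\<^bsub>L\<^esub> x) = \<zero>\<^bsub>V\<^esub>"
      using linear_map_minus[OF L V p(1) y(1) x] y(2) pD(1)[OF x] by (simp add: V.M.r_neg a_minus_def)
    then have "h (?y \<ominus>\<^bsub>L\<^esub> x) = \<zero>\<^bsub>N\<^esub>" using ker[of "?y \<ominus>\<^bsub>L\<^esub> x"] y(1) x by simp
    then have "h ?y \<ominus>\<^bsub>N\<^esub> h x = \<zero>\<^bsub>N\<^esub>" using linear_map_minus[OF L N h y(1) x] by simp
    then show ?thesis
      unfolding k_def using hD(1)[OF y(1)] hD(1)[OF x]
      by (metis N.M.minus_equality N.M.minus_minus a_minus_def N.M.a_inv_closed)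
  qed
  have "linear_map R V N k"
    unfolding linear_map_def
  proof (intro conjI ballI Pi_I)
    show "k v \<in> carrier N" if "v \<in> carrier V" for v
      using that k hD(1) by (force simp flip: p(2))
  next
    fix v w assume "v \<in> carrier V" "w \<in> carrier V"
    then obtain x y where "x \<in> carrier L" "v = p x" "y \<in> carrier L" "w = p y"
      by (auto simp flip: p(2))
    then show "k (v \<oplus>\<^bsub>V\<^esub> w) = k v \<oplus>\<^bsub>N\<^esub> k w"
      using k[of "x \<oplus>\<^bsub>L\<^esub> y"] by (simp add: k pD hD)
  next
    fix a v assume a: "a \<in> carrier R" and "v \<in> carrier V"
    then obtain x where "x \<in> carrier L" "v = p x" by (auto simp flip: p(2))
    then show "k (a \<odot>\<^bsub>V\<^esub> v) = a \<odot>\<^bsub>N\<^esub> k v"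
      using k[of "a \<odot>\<^bsub>L\<^esub> x"] a by (simp add: k pD hD)
  qed
  with k show ?thesis by blast
qed

text \<open>Finite presentation comes from pseudo-coherence applied to the module as a finitely
  generated submodule of itself.\<close>

lemma coherentD:
  assumes "coherent R M"
  shows "left_module R M" "finitely_presented R M" "\<exists>G. finite G \<and> generates R M G (carrier M)"
proof -
  show M: "left_module R M" using assms by (simp add: coherent_def)
  have [simp]: "M\<lparr>carrier := carrier M\<rparr> = M" by simp
  have fg: "finitely_generated R M" using assms by (simp add: coherent_def)
  then show "finitely_presented R M"
    using assms submodule_carrier[OF M] unfolding coherent_def pseudo_coherent_def by force
  show "\<exists>G. finite G \<and> generates R M G (carrier M)"
    using finitely_generated_iff[OF M submodule_carrier[OF M]] fg by simp
qed

lemma finitely_presentedE: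
  assumes M: "left_module R M" and "finitely_presented R M"
  obtains n :: nat and f G where "f \<in> mod_hom R (free_module R {..<n}) M"
    "f ` carrier (free_module R {..<n}) = carrier M" "finite G"
    "generates R (free_module R {..<n}) G {x \<in> carrier (free_module R {..<n}). f x = \<zero>\<^bsub>M\<^esub>}"
proof -
  interpret M: left_module R M by fact
  obtain n :: nat and f where f: "f \<in> mod_hom R (free_module R {..<n}) M"
    "f ` carrier (free_module R {..<n}) = carrier M"
    "finitely_generated R ((free_module R {..<n})
          \<lparr>carrier := {x \<in> carrier (free_module R {..<n}). f x = \<zero>\<^bsub>M\<^esub>}\<rparr>)"
    using assms(2) unfolding finitely_presented_def by blast
  have F: "left_module R (free_module R {..<n})" by (rule M.R.left_module_free)
  have "linear_map R (free_module R {..<n}) M f" using f(1) by (simp add: mod_hom_iff)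
  from finitely_generated_iff[OF F submodule_ker[OF F M this]] f(3)
  obtain G where "finite G"
    "generates R (free_module R {..<n}) G {x \<in> carrier (free_module R {..<n}). f x = \<zero>\<^bsub>M\<^esub>}" by blast
  with f(1,2) show thesis by (rule that)
qed

text \<open>The working hypothesis for all homological conclusions. It holds for a locally Frobenius
  algebra and for its opposite alike, so left and right modules need no separate arguments.\<close>

locale ring_with_frobenius_subalgebras =
  fixes K :: "('k, 'e) ring_scheme" and R :: "('k, 'a) module"
  assumes enough: "finite Y \<Longrightarrow> Y \<subseteq> carrier R \<Longrightarrow> \<exists>B \<theta> G. Y \<subseteq> B \<and> frobenius_subalgebra K R B \<theta> G"
begin

lemma ring: "ring R"
proof -
  obtain B \<theta> G where "frobenius_subalgebra K R B \<theta> G" using enough[of "{}"] by blast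
  then interpret frobenius_subalgebra K R B \<theta> G .
  show ?thesis by (rule ring)
qed

sublocale R: ring R by (rule ring)

lemma left_module_free: "left_module R (free_module R I)"
  by (rule R.left_module_free)

lemma regular: "left_module R (regular R)"
  by (rule left_module_regular[OF ring])

lemma kernel_finitely_generated:
  assumes I: "finite I" and J: "finite J" and \<phi>: "linear_map R (free_module R I) (free_module R J) \<phi>"
  shows "\<exists>H. finite H \<and> generates R (free_module R I) H
    {x \<in> carrier (free_module R I). \<phi> x = \<zero>\<^bsub>free_module R J\<^esub>}"
proof -
  let ?X = "(\<lambda>(i, j). \<phi> (single R I i) j) ` (I \<times> J)"
  have "\<phi> (single R I i) j \<in> carrier R" if "j \<in> J" for i j
    using linear_mapD(1)[OF \<phi> R.single_closed] that by (auto simp: free_module_simps)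
  then have sub: "?X \<subseteq> carrier R" by auto
  have fin: "finite ?X" using I J by simp
  from enough[OF fin sub] obtain B \<theta> G where B: "?X \<subseteq> B" "frobenius_subalgebra K R B \<theta> G"
    by (elim exE conjE)
  interpret frobenius_subalgebra K R B \<theta> G by (rule B(2))
  show ?thesis by (rule kernel_finitely_generated[OF I \<phi>]) (use B(1) in auto)
qed

lemma extension_along:
  assumes I: "finite I" and J: "finite J" and \<phi>: "linear_map R (free_module R I) (free_module R J) \<phi>"
    and c: "linear_map R (free_module R I) (regular R) c"
    and ker: "\<And>x. x \<in> carrier (free_module R I) \<Longrightarrow> \<phi> x = \<zero>\<^bsub>free_module R J\<^esub> \<Longrightarrow> c x = \<zero>\<^bsub>R\<^esub>"
  shows "\<exists>h. linear_map R (free_module R J) (regular R) h \<and> (\<forall>x\<in>carrier (free_module R I). h (\<phi> x) = c x)"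
proof -
  let ?X = "(\<lambda>(i, j). \<phi> (single R I i) j) ` (I \<times> J)" and ?Y = "(\<lambda>i. c (single R I i)) ` I"
  have "\<phi> (single R I i) j \<in> carrier R" if "j \<in> J" for i j
    using linear_mapD(1)[OF \<phi> R.single_closed] that by (auto simp: free_module_simps)
  moreover have "c (single R I i) \<in> carrier R" for i
    using linear_mapD(1)[OF c R.single_closed] by simp
  ultimately have sub: "?X \<union> ?Y \<subseteq> carrier R" by auto
  have fin: "finite (?X \<union> ?Y)" using I J by simp
  from enough[OF fin sub] obtain B \<theta> G where B: "?X \<union> ?Y \<subseteq> B" "frobenius_subalgebra K R B \<theta> G"
    by (elim exE conjE)
  interpret frobenius_subalgebra K R B \<theta> G by (rule B(2))
  show ?thesis by (rule extension_along[OF I J \<phi> _ c _ ker]) (use B(1) in auto)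
qed

lemma finitely_generated_regular: "finitely_generated R (regular R)"
proof -
  have "\<one>\<^bsub>R\<^esub> \<in> U \<Longrightarrow> carrier R \<subseteq> U" if "submodule U R (regular R)" for U
    using submoduleD(4)[OF that] by fastforce
  then have "generates R (regular R) {\<one>\<^bsub>R\<^esub>} (carrier (regular R))" by (auto simp: generates_def)
  then have "finitely_generated R ((regular R)\<lparr>carrier := carrier (regular R)\<rparr>)"
    unfolding finitely_generated_iff[OF regular submodule_carrier[OF regular]] by blast
  moreover have "(regular R)\<lparr>carrier := carrier (regular R)\<rparr> = regular R" by (simp add: regular_def)
  ultimately show ?thesis by (simp only:)
qed

text \<open>A finitely generated left ideal is the image of a map from a finite free module to
  \<open>R\<close>, whose kernel is finitely generated.\<close>

lemma coherent_regular: "coherent R (regular R)"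
  unfolding coherent_def pseudo_coherent_def
proof (intro conjI allI impI regular finitely_generated_regular, elim conjE)
  fix H assume H: "submodule H R (regular R)" and "finitely_generated R ((regular R)\<lparr>carrier := H\<rparr>)"
  then obtain G where G: "finite G" "generates R (regular R) G H"
    using finitely_generated_iff[OF regular H] by blast
  from finite_free_cover[OF regular H G] obtain n :: nat and h
    where h: "h \<in> mod_hom R (free_module R {..<n}) (regular R)" "h ` carrier (free_module R {..<n}) = H"
    by blast
  let ?F = "free_module R {..<n}"
  have hl: "linear_map R ?F (regular R) h" using h(1) by (simp add: mod_hom_iff)
  \<comment> \<open>The result on kernels is about maps between free modules, so \<open>R\<close> is
    replaced by the free module of rank one on the unit type.\<close>
  have "linear_map R ?F (free_module R {()}) (\<lambda>x. \<lambda>_\<in>{()}. h x)"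
    using linear_mapD[OF hl] by (auto simp: linear_map_def free_module_simps)
  from kernel_finitely_generated[OF _ _ this]
  have "\<exists>H. finite H \<and> generates R ?F H {x \<in> carrier ?F. h x = \<zero>\<^bsub>R\<^esub>}"
    by (simp add: free_module_simps(2) restrict_def fun_eq_iff)
  then have fg: "finitely_generated R (?F\<lparr>carrier := {x \<in> carrier ?F. h x = \<zero>\<^bsub>R\<^esub>}\<rparr>)"
    using finitely_generated_iff[OF left_module_free submodule_ker[OF left_module_free regular hl]] by simp
  have "h \<in> mod_hom R ?F ((regular R)\<lparr>carrier := H\<rparr>)"
    using h by (auto simp: mod_hom_def PiE_iff)
  with h(2) fg show "finitely_presented R ((regular R)\<lparr>carrier := H\<rparr>)"
    unfolding finitely_presented_def by (intro exI[of _ n] exI[of _ h]) simp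
qed

text \<open>Finite presentation of \<open>M\<close> supplies the first two free modules; after that
  only kernels of maps between finite free modules occur, and these are always finitely
  generated.\<close>

lemma finite_free_resolution:
  assumes M: "left_module R M" and fp: "finitely_presented R M"
  shows "\<exists>(k :: nat \<Rightarrow> nat) d e. projective_resolution R M (\<lambda>n. free_module R {..<k n}) d e"
proof -
  let ?F = "\<lambda>n::nat. free_module R {..<n}"
  let ?ker = "\<lambda>m n h. {x \<in> carrier (?F n). h x = \<zero>\<^bsub>?F m\<^esub>}"
  obtain n0 e G where e: "e \<in> mod_hom R (?F n0) M" "e ` carrier (?F n0) = carrier M"
    and G: "finite G" "generates R (?F n0) G {x \<in> carrier (?F n0). e x = \<zero>\<^bsub>M\<^esub>}"
    by (rule finitely_presentedE[OF M fp])
  have "linear_map R (?F n0) M e" using e(1) by (simp add: mod_hom_iff)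
  from finite_free_cover[OF left_module_free submodule_ker[OF left_module_free M this] G]
  obtain n1 d0 where d0: "d0 \<in> mod_hom R (?F n1) (?F n0)"
      "d0 ` carrier (?F n1) = {x \<in> carrier (?F n0). e x = \<zero>\<^bsub>M\<^esub>}" by blast
  define good where "good = (\<lambda>(i::nat) (m, n, h). h \<in> mod_hom R (?F n) (?F m) \<and>
     (i = 0 \<longrightarrow> m = n0 \<and> h ` carrier (?F n) = {x \<in> carrier (?F n0). e x = \<zero>\<^bsub>M\<^esub>}))"
  define step where "step = (\<lambda>(i::nat) (m, n, h) (m', n', h').
     m' = n \<and> h' ` carrier (?F n') = ?ker m n h)"
  have "\<exists>s. \<forall>i. good i (s i) \<and> step i (s i) (s (Suc i))"
  proof (rule dependent_nat_choice)
    show "\<exists>x. good 0 x" using d0 by (auto simp: good_def)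
    fix x i assume x: "good i x"
    obtain m n h where [simp]: "x = (m, n, h)" by (cases x)
    have "h \<in> mod_hom R (?F n) (?F m)" using x by (simp add: good_def)
    then have h: "linear_map R (?F n) (?F m) h" by (simp add: mod_hom_iff)
    obtain G where G: "finite G" "generates R (?F n) G (?ker m n h)"
      using kernel_finitely_generated[OF _ _ h] by auto
    from finite_free_cover[OF left_module_free submodule_ker[OF left_module_free left_module_free h] G]
    obtain n' h' where "h' \<in> mod_hom R (?F n') (?F n)" "h' ` carrier (?F n') = ?ker m n h" by blast
    then have "good (Suc i) (n, n', h') \<and> step i x (n, n', h')"
      by (simp add: good_def step_def)
    then show "\<exists>y. good (Suc i) y \<and> step i x y" by blast
  qed
  then obtain s where s: "\<And>i. good i (s i)" "\<And>i. step i (s i) (s (Suc i))" by blast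
  define k where "k i = fst (s i)" for i
  define d where "d i = snd (snd (s i))" for i
  have si: "s i = (k i, k (Suc i), d i)" for i
    using s(2)[of i] by (cases "s i"; cases "s (Suc i)") (auto simp: step_def k_def d_def)
  have "projective_resolution R M (\<lambda>i. ?F (k i)) d e"
    using s e unfolding si good_def step_def projective_resolution_def
    by (auto simp: R.projective_free)
  then show ?thesis by blast
qed

text \<open>A cocycle vanishes on the image of the incoming differential, which by exactness is the
  kernel of \<open>d s\<close>; hence it factors through \<open>d s\<close>.\<close>

lemma cocycles_bound_finite_free:
  assumes res: "projective_resolution R M (\<lambda>n. free_module R {..<k n :: nat}) d e"
  shows "cocycles_bound R (\<lambda>n. free_module R {..<k n}) d (regular R) s"
  unfolding cocycles_bound_def
proof (intro allI impI, elim conjE)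
  let ?F = "\<lambda>n. free_module R {..<k n}"
  note D = projective_resolutionD[OF res]
  fix f assume f: "linear_map R (?F (Suc s)) (regular R) f"
    and cocycle: "\<forall>x\<in>carrier (?F (Suc (Suc s))). f (d (Suc s) x) = \<zero>\<^bsub>regular R\<^esub>"
  have "f x = \<zero>\<^bsub>R\<^esub>" if "x \<in> carrier (?F (Suc s))" "d s x = \<zero>\<^bsub>?F s\<^esub>" for x
  proof -
    have "x \<in> d (Suc s) ` carrier (?F (Suc (Suc s)))" using that D(7) by blast
    then show ?thesis using cocycle by auto
  qed
  from extension_along[OF _ _ D(3) f this]
  show "\<exists>g. linear_map R (?F s) (regular R) g \<and> (\<forall>x\<in>carrier (?F (Suc s)). f x = g (d s x))"
    by fastforce
qed

theorem trivial_Ext_coherent: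
  assumes M: "coherent R M" and res: "projective_resolution R M P d e" and s: "s > 0"
  shows "trivial_group (Ext_group R P d (regular R) s)"
proof -
  obtain t where t: "s = Suc t" using s by (cases s) auto
  obtain k :: "nat \<Rightarrow> nat" and \<delta> \<epsilon> where Q: "projective_resolution R M (\<lambda>n. free_module R {..<k n}) \<delta> \<epsilon>"
    using finite_free_resolution[OF coherentD(1,2)[OF M]] by blast
  show ?thesis unfolding t
    by (rule trivial_Ext_group[OF regular res
          cocycles_bound_transfer[OF coherentD(1)[OF M] regular res Q cocycles_bound_finite_free[OF Q]]])
qed

theorem trivial_Ext_coproduct:
  assumes N: "\<And>i. i \<in> I \<Longrightarrow> coherent R (N i)" and M: "left_module R M"
    and iso: "mod_iso R M (direct_sum I N)"
    and res: "projective_resolution R M P d e" and s: "s > 0"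
  shows "trivial_group (Ext_group R P d (regular R) s)"
proof -
  obtain t where t: "s = Suc t" using s by (cases s) auto
  have fam: "module_family R I N" using coherentD(1)[OF N] ring by (simp add: module_family_def)
  have S: "left_module R (direct_sum I N)" by (rule module_family.left_module_sum[OF fam])
  obtain f where f: "f \<in> mod_hom R M (direct_sum I N)" "bij_betw f (carrier M) (carrier (direct_sum I N))"
    using iso by (auto simp: mod_iso_def)
  have "\<forall>i\<in>I. \<exists>(k :: nat \<Rightarrow> nat) \<delta> \<epsilon>. projective_resolution R (N i) (\<lambda>n. free_module R {..<k n}) \<delta> \<epsilon>"
    using finite_free_resolution coherentD(1,2)[OF N] by blast
  then obtain k :: "_ \<Rightarrow> nat \<Rightarrow> nat" and \<delta> \<epsilon>
    where Q: "\<And>i. i \<in> I \<Longrightarrow> projective_resolution R (N i) (\<lambda>n. free_module R {..<k i n}) (\<delta> i) (\<epsilon> i)"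
    by metis
  note QS = projective_resolution_direct_sum[OF fam Q]
    and bound = cocycles_bound_direct_sum[OF regular fam Q cocycles_bound_finite_free[OF Q]]
  show ?thesis unfolding t
    by (rule trivial_Ext_group[OF regular res
          cocycles_bound_transfer[OF S regular projective_resolution_iso[OF M S f res] QS bound]])
qed

text \<open>With V = F / ker p, the preimage of f(U) in the finite free module F is the image of a
  map \<phi> from a finite free module E. The composite E -> U -> R vanishes on ker \<phi> and
  extends along \<phi> to F; this extension kills ker p and so descends to V.\<close>

theorem injective_coherent:
  assumes U: "coherent R U" and V: "coherent R V" and f: "f \<in> mod_hom R U V" and inj: "inj_on f (carrier U)"
    and g: "g \<in> mod_hom R U (regular R)"
  shows "\<exists>h\<in>mod_hom R V (regular R). \<forall>x\<in>carrier U. h (f x) = g x"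
proof -
  note Um = coherentD(1)[OF U] and Vm = coherentD(1)[OF V]
  interpret U: left_module R U by (rule Um)
  interpret V: left_module R V by (rule Vm)
  interpret RR: left_module R "regular R" by (rule regular)
  have fl: "linear_map R U V f" and gl: "linear_map R U (regular R) g" using f g by (simp_all add: mod_hom_iff)
  obtain n :: nat and p G where p: "p \<in> mod_hom R (free_module R {..<n}) V"
    "p ` carrier (free_module R {..<n}) = carrier V" and G: "finite G"
    "generates R (free_module R {..<n}) G {x \<in> carrier (free_module R {..<n}). p x = \<zero>\<^bsub>V\<^esub>}"
    by (rule finitely_presentedE[OF Vm coherentD(2)[OF V]])
  let ?F = "free_module R {..<n}"
  interpret F: left_module R ?F by (rule left_module_free)
  have pl: "linear_map R ?F V p" using p(1) by (simp add: mod_hom_iff)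
  obtain T where T: "finite T" "generates R U T (carrier U)" using coherentD(3)[OF U] by blast
  have TU: "u \<in> carrier U" if "u \<in> T" for u using T(2) that by (auto simp: generates_def)
  have "\<forall>u\<in>T. \<exists>x. x \<in> carrier ?F \<and> p x = f u"
  proof
    fix u assume "u \<in> T"
    then have "f u \<in> p ` carrier ?F" using linear_mapD(1)[OF fl TU] p(2) by simp
    then show "\<exists>x. x \<in> carrier ?F \<and> p x = f u" by (elim imageE) auto
  qed
  from bchoice[OF this] obtain x where x: "\<And>u. u \<in> T \<Longrightarrow> x u \<in> carrier ?F" "\<And>u. u \<in> T \<Longrightarrow> p (x u) = f u" by blast
  \<comment> \<open>Generators of the preimage of f(U) under \<open>p\<close>: the relations
    \<open>G\<close> of the presentation, together with a lift of the image of each generator of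
    \<open>U\<close>.\<close>
  define J where "J = G \<union> x ` T"
  let ?E = "free_module R J"
  define \<phi> where "\<phi> = F.lin_ext J (\<lambda>y. y)"
  have J: "finite J" using G(1) T(1) by (simp add: J_def)
  have G0: "G \<subseteq> {x \<in> carrier ?F. p x = \<zero>\<^bsub>V\<^esub>}" using G(2) by (simp add: generates_def)
  have JF: "(\<lambda>y. y) \<in> J \<rightarrow> carrier ?F" using G0 x(1) by (auto simp: J_def)
  have \<phi>: "linear_map R ?E ?F \<phi>" unfolding \<phi>_def by (rule linear_map_lin_ext[OF left_module_free JF])
  have \<phi>_single: "\<phi> (single R J y) = y" if "y \<in> J" for y
    unfolding \<phi>_def by (rule F.lin_ext_single[OF JF that])
  have fU: "submodule (f ` carrier U) R V" by (rule submodule_image[OF Um Vm fl submodule_carrier[OF Um]])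
  have "(\<lambda>y. y) \<in> J \<rightarrow> {z \<in> carrier ?F. p z \<in> f ` carrier U}"
    using G0 x TU submoduleD(2)[OF fU] by (auto simp: J_def)
  from lin_ext_in_submodule[OF left_module_free submodule_vimage[OF left_module_free Vm pl fU] this]
  have "(\<lambda>y. p (\<phi> y)) ` carrier ?E \<subseteq> f ` carrier U" by (auto simp: \<phi>_def)
  \<comment> \<open>As \<open>f\<close> is injective, \<open>l\<close> is just p \<circ> \<phi> read
    inside \<open>U\<close>.\<close>
  from lift_free[OF Um Vm linear_map_comp[OF \<phi> pl] fl this] obtain l
    where l: "linear_map R ?E U l" "\<And>y. y \<in> carrier ?E \<Longrightarrow> f (l y) = p (\<phi> y)" by blast
  have f0: "f \<zero>\<^bsub>U\<^esub> = \<zero>\<^bsub>V\<^esub>" by (rule linear_map_zero[OF Um Vm fl])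
  \<comment> \<open>This is used twice: for y in ker \<phi> it permits the extension along
    \<open>\<phi>\<close>, and for y with \<phi> y in ker p it makes the extension vanish on ker
    p.\<close>
  have gl0: "g (l y) = \<zero>\<^bsub>R\<^esub>" if y: "y \<in> carrier ?E" and 0: "p (\<phi> y) = \<zero>\<^bsub>V\<^esub>" for y
  proof -
    have "l y = \<zero>\<^bsub>U\<^esub>"
      using inj_onD[OF inj, of "l y" "\<zero>\<^bsub>U\<^esub>"] l(2)[OF y] 0 f0 linear_mapD(1)[OF l(1) y] by simp
    then show ?thesis using linear_map_zero[OF Um regular gl] by simp
  qed
  have "g (l y) = \<zero>\<^bsub>R\<^esub>" if "y \<in> carrier ?E" "\<phi> y = \<zero>\<^bsub>?F\<^esub>" for y
    using gl0[OF that(1)] that(2) linear_map_zero[OF left_module_free Vm pl] by simp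
  from extension_along[OF J finite_lessThan \<phi> linear_map_comp[OF l(1) gl] this]
  obtain h where h: "linear_map R ?F (regular R) h" "\<And>y. y \<in> carrier ?E \<Longrightarrow> h (\<phi> y) = g (l y)" by blast
  have im: "submodule (\<phi> ` carrier ?E) R ?F"
    by (rule submodule_image[OF left_module_free left_module_free \<phi> submodule_carrier[OF left_module_free]])
  have "G \<subseteq> \<phi> ` carrier ?E"
  proof
    fix y assume "y \<in> G"
    then have "y \<in> J" by (simp add: J_def)
    then have "y = \<phi> (single R J y)" by (simp add: \<phi>_single)
    then show "y \<in> \<phi> ` carrier ?E" using R.single_closed by (rule image_eqI)
  qed
  note ker_im = generatesD[OF G(2) im this]
  have "h z = \<zero>\<^bsub>regular R\<^esub>" if z: "z \<in> carrier ?F" "p z = \<zero>\<^bsub>V\<^esub>" for z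
  proof -
    have "z \<in> \<phi> ` carrier ?E" using subsetD[OF ker_im] z by simp
    then obtain y where "y \<in> carrier ?E" "z = \<phi> y" by (elim imageE)
    then show ?thesis using h(2) gl0 z(2) by simp
  qed
  from linear_map_factor[OF left_module_free Vm regular pl p(2) h(1) this]
  obtain k where k: "linear_map R V (regular R) k" "\<And>z. z \<in> carrier ?F \<Longrightarrow> k (p z) = h z" by blast
  \<comment> \<open>The elements of \<open>U\<close> where \<open>k\<close> after \<open>f\<close>
    agrees with \<open>g\<close> form a submodule, so agreement needs checking on the generators
    \<open>T\<close> alone.\<close>
  let ?D = "{u \<in> carrier U. k (f u) \<ominus>\<^bsub>regular R\<^esub> g u = \<zero>\<^bsub>regular R\<^esub>}"
  have D: "submodule ?D R U"
    by (rule submodule_ker[OF Um regular linear_map_diff[OF Um regular linear_map_comp[OF fl k(1)] gl]])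
  have "u \<in> ?D" if u: "u \<in> T" for u
  proof -
    have xu: "x u \<in> J" using u by (simp add: J_def)
    let ?s = "single R J (x u)"
    have s: "?s \<in> carrier ?E" by (rule R.single_closed)
    have "f (l ?s) = f u" using l(2)[OF s] \<phi>_single[OF xu] x(2)[OF u] by simp
    then have "l ?s = u" using inj_onD[OF inj] linear_mapD(1)[OF l(1) s] TU[OF u] by blast
    then have "h (x u) = g u" using h(2)[OF s] \<phi>_single[OF xu] by simp
    then have "k (f u) = g u" using k(2)[OF x(1)[OF u]] x(2)[OF u] by simp
    then show ?thesis using TU[OF u] linear_mapD(1)[OF gl TU[OF u]]
      by (simp only: mem_Collect_eq a_minus_def RR.M.r_neg)
  qed
  then have "T \<subseteq> ?D" by blast
  from generatesD[OF T(2) D this] have *: "u \<in> ?D" if "u \<in> carrier U" for u using that by blast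
  have "k (f u) = g u" if u: "u \<in> carrier U" for u
  proof -
    have ku: "k (f u) \<in> carrier (regular R)" using linear_mapD(1)[OF k(1) linear_mapD(1)[OF fl u]] .
    have gu: "g u \<in> carrier (regular R)" using linear_mapD(1)[OF gl u] .
    have "k (f u) \<oplus>\<^bsub>regular R\<^esub> (\<ominus>\<^bsub>regular R\<^esub> g u) = \<zero>\<^bsub>regular R\<^esub>"
      using *[OF u] by (simp only: mem_Collect_eq a_minus_def)
    from RR.M.minus_equality[OF this] ku gu show ?thesis
      by (metis RR.M.a_inv_closed RR.M.minus_minus)
  qed
  then have "\<forall>u\<in>carrier U. restrict k (carrier V) (f u) = g u" using linear_mapD(1)[OF fl] by simp
  then show ?thesis using mod_hom_restrict[OF Vm k(1)] by (intro bexI[of _ "restrict k (carrier V)"])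
qed

end

section \<open>Locally Frobenius algebras and their opposites\<close>

lemma opposite_simps [simp]:
  "carrier (opposite A) = carrier A" "\<one>\<^bsub>opposite A\<^esub> = \<one>\<^bsub>A\<^esub>" "x \<otimes>\<^bsub>opposite A\<^esub> y = y \<otimes>\<^bsub>A\<^esub> x"
  by (simp_all add: opposite_def)

lemma opposite_add_simps [simp]:
  fixes A :: "('a, 'e) ring_scheme"
  shows "\<zero>\<^bsub>opposite A\<^esub> = \<zero>\<^bsub>A\<^esub>" "x \<oplus>\<^bsub>opposite A\<^esub> y = x \<oplus>\<^bsub>A\<^esub> y"
  by (simp_all add: opposite_def)

lemma opposite_smult [simp]:
  fixes A :: "('k, 'a) module"
  shows "a \<odot>\<^bsub>opposite A\<^esub> x = a \<odot>\<^bsub>A\<^esub> x"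
  by (simp add: opposite_def)

lemma ring_opposite:
  assumes "ring A"
  shows "ring (opposite A)"
proof -
  interpret ring A by fact
  have "abelian_group (opposite A)"
    by (rule abelian_groupI) (auto simp: a_ac intro: l_neg)
  moreover have "monoid (opposite A)"
    by (rule monoidI) (auto simp: m_assoc)
  ultimately show ?thesis
    by (rule ringI) (auto simp: l_distr r_distr)
qed

lemma k_algebra_opposite:
  fixes A :: "('k, 'a) module"
  assumes "k_algebra K A"
  shows "k_algebra K (opposite A)"
proof -
  interpret A: k_algebra K A by fact
  interpret opp: ring "opposite A" by (rule ring_opposite) (rule A.ring_axioms)
  show ?thesis
    by (intro k_algebra.intro module.intro k_algebra_axioms.intro module_axioms.intro
        A.K.field_axioms A.K.is_cring opp.abelian_group_axioms opp.ring_axioms)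
      (auto simp: A.smult_l_distr A.smult_r_distr A.smult_assoc1 A.smult_mult_left A.smult_mult_right)
qed

text \<open>Finitely many elements involve finitely many basis elements: \<open>E\<close> is the
  union of the supports, with coefficients extended by zero.\<close>

lemma basis_decomposition:
  assumes N: "left_module B N" and basis: "is_basis B N H" and Y: "finite Y" "Y \<subseteq> carrier N"
  shows "\<exists>E c. finite E \<and> E \<subseteq> carrier N \<and> c \<in> Y \<rightarrow> E \<rightarrow> carrier B \<and>
    (\<forall>y\<in>Y. y = (\<Oplus>\<^bsub>N\<^esub>e\<in>E. c y e \<odot>\<^bsub>N\<^esub> e)) \<and>
    (\<forall>b\<in>E \<rightarrow> carrier B. (\<Oplus>\<^bsub>N\<^esub>e\<in>E. b e \<odot>\<^bsub>N\<^esub> e) = \<zero>\<^bsub>N\<^esub> \<longrightarrow> (\<forall>e\<in>E. b e = \<zero>\<^bsub>B\<^esub>))"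
proof -
  interpret N: left_module B N by fact
  have HN: "H \<subseteq> carrier N" and span: "lin_span B N H = carrier N"
    and indep: "\<And>F c. finite F \<Longrightarrow> F \<subseteq> H \<Longrightarrow> c \<in> F \<rightarrow> carrier B \<Longrightarrow>
      (\<Oplus>\<^bsub>N\<^esub>x\<in>F. c x \<odot>\<^bsub>N\<^esub> x) = \<zero>\<^bsub>N\<^esub> \<Longrightarrow> \<forall>x\<in>F. c x = \<zero>\<^bsub>B\<^esub>"
    using basis by (simp_all add: is_basis_def)
  have "\<forall>y\<in>Y. \<exists>q. case q of (F, c) \<Rightarrow> finite F \<and> F \<subseteq> H \<and> c \<in> F \<rightarrow> carrier B \<and> y = (\<Oplus>\<^bsub>N\<^esub>x\<in>F. c x \<odot>\<^bsub>N\<^esub> x)"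
  proof
    fix y assume "y \<in> Y"
    then have "y \<in> lin_span B N H" using Y(2) span by auto
    then show "\<exists>q. case q of (F, c) \<Rightarrow> finite F \<and> F \<subseteq> H \<and> c \<in> F \<rightarrow> carrier B \<and> y = (\<Oplus>\<^bsub>N\<^esub>x\<in>F. c x \<odot>\<^bsub>N\<^esub> x)"
      by (auto simp: lin_span_def)
  qed
  from bchoice[OF this] obtain p where "\<forall>y\<in>Y. case p y of (F, c) \<Rightarrow>
      finite F \<and> F \<subseteq> H \<and> c \<in> F \<rightarrow> carrier B \<and> y = (\<Oplus>\<^bsub>N\<^esub>x\<in>F. c x \<odot>\<^bsub>N\<^esub> x)" by (elim exE)
  then have p: "finite (fst (p y))" "fst (p y) \<subseteq> H" "snd (p y) \<in> fst (p y) \<rightarrow> carrier B"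
    "y = (\<Oplus>\<^bsub>N\<^esub>x\<in>fst (p y). snd (p y) x \<odot>\<^bsub>N\<^esub> x)" if "y \<in> Y" for y
    using that by (auto simp: case_prod_unfold)
  define E where "E = (\<Union>y\<in>Y. fst (p y))"
  define c where "c y e = (if e \<in> fst (p y) then snd (p y) e else \<zero>\<^bsub>B\<^esub>)" for y e
  have E: "finite E" "E \<subseteq> H" using p(1,2) Y(1) by (auto simp: E_def)
  have c: "c \<in> Y \<rightarrow> E \<rightarrow> carrier B" using Pi_mem[OF p(3)] by (auto simp: c_def)
  have "y = (\<Oplus>\<^bsub>N\<^esub>e\<in>E. c y e \<odot>\<^bsub>N\<^esub> e)" if y: "y \<in> Y" for y
  proof -
    have "(\<Oplus>\<^bsub>N\<^esub>x\<in>fst (p y). snd (p y) x \<odot>\<^bsub>N\<^esub> x) = (\<Oplus>\<^bsub>N\<^esub>e\<in>E. c y e \<odot>\<^bsub>N\<^esub> e)"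
      by (rule N.M.add.finprod_mono_neutral_cong_left)
        (use y E HN Pi_mem[OF p(3)[OF y]] in
          \<open>auto simp: E_def c_def N.smult_l_null subset_iff\<close>)
    then show ?thesis using p(4)[OF y] by simp
  qed
  moreover have "E \<subseteq> carrier N" using E(2) HN by auto
  ultimately show ?thesis
    by (intro exI[of _ E] exI[of _ c] conjI ballI impI E(1) c indep[OF E, rule_format])
qed

text \<open>One argument for both algebras. Passing to the opposite exchanges the two halves of
  nondegeneracy of the form and the two halves of freeness, and both halves are available on each
  count.\<close>

lemma frobenius_subalgebra_in:
  fixes A R :: "('k, 'a) module"
  assumes A: "k_algebra K A" and R: "R \<in> {A, opposite A}"
    and B: "B \<subseteq> carrier A" "symmetric_frobenius K (A\<lparr>carrier := B\<rparr>)"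
    and ext: "\<And>Y. finite Y \<Longrightarrow> Y \<subseteq> carrier A \<Longrightarrow> \<exists>C. Y \<subseteq> C \<and> C \<subseteq> carrier A \<and>
      free_frobenius_extension K (\<lambda>x. x) (A\<lparr>carrier := B\<rparr>) (A\<lparr>carrier := C\<rparr>)"
  shows "\<exists>\<theta> G. frobenius_subalgebra K R B \<theta> G"
proof -
  let ?B = "A\<lparr>carrier := B\<rparr>"
  have Bsym: "k_algebra K ?B" "finite_dimensional K ?B" "\<exists>\<theta>. frobenius_form K ?B \<theta>"
    using B(2) by (auto simp: symmetric_frobenius_def)
  interpret B: k_algebra K ?B by (rule Bsym(1))
  interpret A: k_algebra K A by (rule A)
  have BA: "b \<in> carrier A" if "b \<in> B" for b using B(1) that by auto
  have closed: "\<zero>\<^bsub>A\<^esub> \<in> B" "\<And>x y. x \<in> B \<Longrightarrow> y \<in> B \<Longrightarrow> x \<oplus>\<^bsub>A\<^esub> y \<in> B" "\<And>x y. x \<in> B \<Longrightarrow> y \<in> B \<Longrightarrow> x \<otimes>\<^bsub>A\<^esub> y \<in> B"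
    "\<And>a x. a \<in> carrier K \<Longrightarrow> x \<in> B \<Longrightarrow> a \<odot>\<^bsub>A\<^esub> x \<in> B"
    using B.zero_closed B.a_closed B.m_closed B.smult_closed by simp_all
  have mults: "(\<forall>x y. x \<otimes>\<^bsub>R\<^esub> y = x \<otimes>\<^bsub>A\<^esub> y) \<or> (\<forall>x y. x \<otimes>\<^bsub>R\<^esub> y = y \<otimes>\<^bsub>A\<^esub> x)"
    and simps: "carrier R = carrier A" "\<zero>\<^bsub>R\<^esub> = \<zero>\<^bsub>A\<^esub>" "\<And>x y. x \<oplus>\<^bsub>R\<^esub> y = x \<oplus>\<^bsub>A\<^esub> y" "\<And>a x. a \<odot>\<^bsub>R\<^esub> x = a \<odot>\<^bsub>A\<^esub> x"
    using R by auto
  have Ralg: "k_algebra K R" using R A k_algebra_opposite by auto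
  interpret R: k_algebra K R by (rule Ralg)
  have RK: "left_module K R" by (rule k_algebra_left_module[OF Ralg])
  have sub: "submodule B K R"
    by (rule left_module_submoduleI[OF RK]) (use closed B(1) in \<open>auto simp: simps\<close>)
  have mult_closed: "x \<otimes>\<^bsub>R\<^esub> y \<in> B" if "x \<in> B" "y \<in> B" for x y
    using mults closed(3) that by auto
  obtain \<theta> where \<theta>: "frobenius_form K ?B \<theta>" using Bsym(3) by blast
  have form: "linear_map K (R\<lparr>carrier := B\<rparr>) (regular K) \<theta>"
    using \<theta> by (auto simp: frobenius_form_def mod_hom_def linear_map_def simps)
  note \<theta>D = linear_mapD[OF form, simplified]
  \<comment> \<open>Stated for either variable, so that it does not depend on which of the two
    multiplications \<open>R\<close> carries.\<close>
  have nondeg: "x = \<zero>\<^bsub>R\<^esub>" if "x \<in> B" "(\<forall>b\<in>B. \<theta> (x \<otimes>\<^bsub>R\<^esub> b) = \<zero>\<^bsub>K\<^esub>) \<or> (\<forall>b\<in>B. \<theta> (b \<otimes>\<^bsub>R\<^esub> x) = \<zero>\<^bsub>K\<^esub>)" for x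
    using \<theta> mults that by (auto simp: frobenius_form_def simps)
  have "finitely_generated K ?B"
    using Bsym(2) by (auto simp: finite_dimensional_def finitely_generated_def is_basis_def)
  moreover have "submodule B K A"
    by (rule left_module_submoduleI[OF k_algebra_left_module[OF A]]) (use closed B(1) in auto)
  ultimately obtain G where G: "finite G" "generates K A G B"
    using finitely_generated_iff[OF k_algebra_left_module[OF A]] by blast
  \<comment> \<open>For fixed \<open>y\<close> the zeros b of \<open>\<theta> (b * y)\<close> form a
    K-subspace of \<open>B\<close>; if it contains the generators \<open>G\<close>, it is all of
    \<open>B\<close>, and nondegeneracy applies.\<close>
  have separating: "y = \<zero>\<^bsub>R\<^esub>" if y: "y \<in> B" and 0: "\<And>b. b \<in> G \<Longrightarrow> \<theta> (b \<otimes>\<^bsub>R\<^esub> y) = \<zero>\<^bsub>K\<^esub>" for y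
  proof -
    have yR: "y \<in> carrier R" using y BA by (simp add: simps)
    have BR: "b \<in> carrier R" if "b \<in> B" for b using that BA by (simp add: simps)
    have "submodule {b \<in> B. \<theta> (b \<otimes>\<^bsub>R\<^esub> y) = \<zero>\<^bsub>K\<^esub>} K R"
    proof (rule left_module_submoduleI[OF RK])
      have "\<theta> \<zero>\<^bsub>R\<^esub> = \<zero>\<^bsub>K\<^esub>"
        using linear_map_zero[OF left_module_submodule[OF RK sub] left_module_regular[OF B.K.ring_axioms] form] by simp
      then show "\<zero>\<^bsub>R\<^esub> \<in> {b \<in> B. \<theta> (b \<otimes>\<^bsub>R\<^esub> y) = \<zero>\<^bsub>K\<^esub>}"
        using yR submoduleD(2)[OF sub] by simp
    qed (use submoduleD[OF sub] y BR yR mult_closed \<theta>D in \<open>auto simp: R.l_distr R.smult_mult_left\<close>)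
    then have "submodule {b \<in> B. \<theta> (b \<otimes>\<^bsub>R\<^esub> y) = \<zero>\<^bsub>K\<^esub>} K A"
      by (intro left_module_submoduleI[OF k_algebra_left_module[OF A]])
        (use submoduleD[of _ K R] in \<open>fastforce simp: simps\<close>)+
    from generatesD[OF G(2) this] 0 have "\<forall>b\<in>B. \<theta> (b \<otimes>\<^bsub>R\<^esub> y) = \<zero>\<^bsub>K\<^esub>"
      using G(2) by (auto simp: generates_def)
    then show ?thesis using nondeg[OF y] by blast
  qed
  have decomposition: "\<exists>E c. finite E \<and> E \<subseteq> carrier R \<and> c \<in> Y \<rightarrow> E \<rightarrow> B \<and>
        (\<forall>y\<in>Y. y = (\<Oplus>\<^bsub>R\<^esub>e\<in>E. e \<otimes>\<^bsub>R\<^esub> c y e)) \<and>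
        (\<forall>b\<in>E \<rightarrow> B. (\<Oplus>\<^bsub>R\<^esub>e\<in>E. e \<otimes>\<^bsub>R\<^esub> b e) = \<zero>\<^bsub>R\<^esub> \<longrightarrow> (\<forall>e\<in>E. b e = \<zero>\<^bsub>R\<^esub>))"
    if Y: "finite Y" "Y \<subseteq> carrier R" for Y
  proof -
    obtain C where C: "Y \<subseteq> C" "C \<subseteq> carrier A"
      "free_frobenius_extension K (\<lambda>x. x) ?B (A\<lparr>carrier := C\<rparr>)"
      using ext[OF Y[unfolded simps(1)]] by (elim exE conjE)
    \<comment> \<open>\<open>N\<close> is the overalgebra \<open>C\<close> with \<open>B\<close>
      acting by multiplication in \<open>R\<close> from the right. For \<open>R = A\<close> this is
      the right restriction over the opposite of \<open>B\<close>; in the opposite algebra,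
      multiplying from the right is multiplying from the left in \<open>A\<close>, so it is the left
      restriction.\<close>
    obtain B' :: "('k, 'a) module" and N :: "('a, 'a) module" and H where N: "left_module B' N" "is_basis B' N H" "carrier N = C" "carrier B' = B"
      "\<zero>\<^bsub>N\<^esub> = \<zero>\<^bsub>R\<^esub>" "\<zero>\<^bsub>B'\<^esub> = \<zero>\<^bsub>R\<^esub>" "\<And>x y. x \<oplus>\<^bsub>N\<^esub> y = x \<oplus>\<^bsub>R\<^esub> y" "\<And>b x. b \<odot>\<^bsub>N\<^esub> x = x \<otimes>\<^bsub>R\<^esub> b"
    proof -
      let ?C = "A\<lparr>carrier := C\<rparr>"
      consider "R = A" | "R = opposite A" using R by auto
      then show thesis
      proof cases
        case 1
        obtain H where "left_module (opposite ?B) (right_restriction (\<lambda>x. x) ?C)"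
          "is_basis (opposite ?B) (right_restriction (\<lambda>x. x) ?C) H"
          using C(3) by (auto simp: free_frobenius_extension_def is_free_def)
        then show thesis by (rule that) (simp_all add: right_restriction_def 1)
      next
        case 2
        obtain H where "left_module ?B (left_restriction (\<lambda>x. x) ?C)"
          "is_basis ?B (left_restriction (\<lambda>x. x) ?C) H"
          using C(3) by (auto simp: free_frobenius_extension_def is_free_def)
        then show thesis by (rule that) (simp_all add: left_restriction_def 2)
      qed
    qed
    interpret N: left_module B' N by (rule N(1))
    have sum: "(\<Oplus>\<^bsub>N\<^esub>e\<in>E. b e \<odot>\<^bsub>N\<^esub> e) = (\<Oplus>\<^bsub>R\<^esub>e\<in>E. e \<otimes>\<^bsub>R\<^esub> b e)"
      if "finite E" "E \<subseteq> carrier N" "b \<in> E \<rightarrow> carrier B'" for E b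
    proof -
      have "(\<lambda>e. b e \<odot>\<^bsub>N\<^esub> e) \<in> E \<rightarrow> carrier N"
        by (intro Pi_I N.smult_closed) (use that in auto)
      from finsum_same_add[OF N.M.abelian_monoid_axioms R.M.abelian_monoid_axioms _ _ _ that(1) this]
      show ?thesis using C(2) N(3) by (simp add: N(5,7,8) simps)
    qed
    have "Y \<subseteq> carrier N" using C(1) N(3) by simp
    from basis_decomposition[OF N(1,2) Y(1) this] obtain E c where E: "finite E" "E \<subseteq> carrier N"
      and c: "c \<in> Y \<rightarrow> E \<rightarrow> carrier B'" and dec: "\<forall>y\<in>Y. y = (\<Oplus>\<^bsub>N\<^esub>e\<in>E. c y e \<odot>\<^bsub>N\<^esub> e)"
      and ind: "\<forall>b\<in>E \<rightarrow> carrier B'. (\<Oplus>\<^bsub>N\<^esub>e\<in>E. b e \<odot>\<^bsub>N\<^esub> e) = \<zero>\<^bsub>N\<^esub> \<longrightarrow> (\<forall>e\<in>E. b e = \<zero>\<^bsub>B'\<^esub>)"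
      by (elim exE conjE)
    have "y = (\<Oplus>\<^bsub>R\<^esub>e\<in>E. e \<otimes>\<^bsub>R\<^esub> c y e)" if y: "y \<in> Y" for y
    proof -
      have "c y \<in> E \<rightarrow> carrier B'" using c y by auto
      from sum[OF E this] show ?thesis using bspec[OF dec y] by (rule trans[rotated])
    qed
    moreover have "\<forall>e\<in>E. b e = \<zero>\<^bsub>R\<^esub>" if b: "b \<in> E \<rightarrow> B" and 0: "(\<Oplus>\<^bsub>R\<^esub>e\<in>E. e \<otimes>\<^bsub>R\<^esub> b e) = \<zero>\<^bsub>R\<^esub>" for b
    proof -
      have b': "b \<in> E \<rightarrow> carrier B'" using b by (simp only: N(4))
      show ?thesis using bspec[OF ind b'] 0 by (simp only: sum[OF E b'] N(5,6) simp_thms)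
    qed
    moreover have "E \<subseteq> carrier R" using E(2) N(3) C(2) by (simp add: simps)
    moreover have "c \<in> Y \<rightarrow> E \<rightarrow> B" using c by (simp only: N(4))
    ultimately show ?thesis using E(1)
      by (intro exI[of _ E] exI[of _ c] conjI ballI impI) simp_all
  qed
  have "frobenius_subalgebra K R B \<theta> G"
  proof (rule frobenius_subalgebra.intro[OF Ralg sub mult_closed form G(1) _ separating _ decomposition])
    show "G \<subseteq> B" using G(2) by (simp add: generates_def)
    show "x = \<zero>\<^bsub>R\<^esub>" if "x \<in> B" "\<And>b. b \<in> B \<Longrightarrow> \<theta> (x \<otimes>\<^bsub>R\<^esub> b) = \<zero>\<^bsub>K\<^esub>" for x
      using nondeg that by blast
  qed
  then show ?thesis by blast
qed

lemma locally_frobenius_enough: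
  fixes A R :: "('k, 'a) module"
  assumes lf: "locally_frobenius K \<Lambda> r l0 A" and R: "R \<in> {A, opposite A}"
  shows "ring_with_frobenius_subalgebras K R"
proof
  obtain S \<epsilon> where A: "k_algebra K A" and shape: "is_shape \<Lambda> r l0"
    and union: "carrier A = (\<Union>l\<in>\<Lambda>. S l)"
    and frob: "\<forall>l\<in>\<Lambda>. symmetric_frobenius K (A\<lparr>carrier := S l\<rparr>) \<and>
                \<epsilon> l \<in> alg_hom K (A\<lparr>carrier := S l\<rparr>) (regular K)"
    and ext: "\<forall>l\<in>\<Lambda>. \<forall>l'\<in>\<Lambda>. (l, l') \<in> r \<and> l \<noteq> l' \<longrightarrow> S l \<subset> S l' \<and> (\<forall>x\<in>S l. \<epsilon> l' x = \<epsilon> l x) \<and>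
           free_frobenius_extension K (\<lambda>x. x) (A\<lparr>carrier := S l\<rparr>) (A\<lparr>carrier := S l'\<rparr>)"
    using lf unfolding locally_frobenius_def by (elim exE conjE)
  have mono: "S l \<subseteq> S l'" if "l \<in> \<Lambda>" "l' \<in> \<Lambda>" "(l, l') \<in> r" for l l'
    using ext that by (cases "l = l'") auto
  have upper: "\<exists>l\<in>\<Lambda>. (l1, l) \<in> r \<and> (l2, l) \<in> r" if "l1 \<in> \<Lambda>" "l2 \<in> \<Lambda>" for l1 l2
    using shape that unfolding is_shape_def by blast
  have bigger: "\<exists>l'\<in>\<Lambda>. (l, l') \<in> r \<and> l \<noteq> l'" if "l \<in> \<Lambda>" for l
    using shape that unfolding is_shape_def by blast
  have finite_in: "\<exists>l\<in>\<Lambda>. Y \<subseteq> S l" if "finite Y" "Y \<subseteq> carrier A" for Y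
    using that
  proof (induction Y rule: finite_induct)
    case empty
    then show ?case using shape unfolding is_shape_def by blast
  next
    case (insert y Y)
    then obtain l1 l2 where l: "l1 \<in> \<Lambda>" "Y \<subseteq> S l1" "l2 \<in> \<Lambda>" "y \<in> S l2" using union by auto
    then obtain l where "l \<in> \<Lambda>" "(l1, l) \<in> r" "(l2, l) \<in> r" using upper by blast
    then show ?case using l mono by blast
  qed
  fix Y assume "finite Y" "Y \<subseteq> carrier R"
  moreover have "carrier R = carrier A" using R by auto
  ultimately obtain l where l: "l \<in> \<Lambda>" "Y \<subseteq> S l" using finite_in by blast
  have "\<exists>\<theta> G. frobenius_subalgebra K R (S l) \<theta> G"
  proof (rule frobenius_subalgebra_in[OF A R])
    show "S l \<subseteq> carrier A" using union l by auto
    show "symmetric_frobenius K (A\<lparr>carrier := S l\<rparr>)" using frob l by blast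
    fix Z assume "finite Z" "Z \<subseteq> carrier A"
    then obtain l2 where l2: "l2 \<in> \<Lambda>" "Z \<subseteq> S l2" using finite_in by blast
    obtain l3 where l3: "l3 \<in> \<Lambda>" "(l, l3) \<in> r" "(l2, l3) \<in> r" using upper[OF l(1) l2(1)] by blast
    obtain l4 where l4: "l4 \<in> \<Lambda>" "(l3, l4) \<in> r" "l3 \<noteq> l4" using bigger[OF l3(1)] by blast
    \<comment> \<open>The extension property is given for distinct indices only. If the common upper
      bound \<open>l3\<close> happens to be \<open>l\<close> itself, a strictly larger index takes
      its place; the shape has no maximal elements.\<close>
    have "\<exists>l'\<in>\<Lambda>. (l, l') \<in> r \<and> l \<noteq> l' \<and> Z \<subseteq> S l'"
    proof (cases "l = l3")
      case True
      then show ?thesis using l4 mono[OF l3(1) l4(1,2)] mono[OF l2(1) l3(1,3)] l2(2) by blast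
    next
      case False
      then show ?thesis using l3 mono[OF l2(1) l3(1,3)] l2(2) by blast
    qed
    then obtain l' where "l' \<in> \<Lambda>" "(l, l') \<in> r" "l \<noteq> l'" "Z \<subseteq> S l'" by blast
    then show "\<exists>C. Z \<subseteq> C \<and> C \<subseteq> carrier A \<and>
        free_frobenius_extension K (\<lambda>x. x) (A\<lparr>carrier := S l\<rparr>) (A\<lparr>carrier := C\<rparr>)"
      using ext l(1) union by (intro exI[of _ "S l'"]) auto
  qed
  with l(2) show "\<exists>B \<theta> G. Y \<subseteq> B \<and> frobenius_subalgebra K R B \<theta> G" by blast
qed

text \<open>Right modules over \<open>A\<close> are left modules over its opposite, so
  \<open>R\<close> ranges over both. Injectivity in the category of coherent modules is spelled out:
  \<open>A\<close> is an object of it, and maps to \<open>A\<close> extend along injective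
  homomorphisms between its objects. The types of the modules and resolutions in the three claims
  are independent of one another.\<close>

theorem lemma4p14:
  fixes K :: "('k, 'e) ring_scheme"
    and \<Lambda> :: "'l set" and r :: "'l rel" and l0 :: 'l
    and A :: "('k, 'a) module" and R :: "('k, 'a) module"
  assumes "locally_frobenius K \<Lambda> r l0 A"
    and "R \<in> {A, opposite A}"
  shows
    "(\<forall>(M :: ('a, 'm) module) (P :: nat \<Rightarrow> ('a, 'p) module) d e s.
        coherent R M \<and> projective_resolution R M P d e \<and> s > 0
          \<longrightarrow> trivial_group (Ext_group R P d (regular R) s)) \<and>
     (coherent R (regular R) \<and>
      (\<forall>(U :: ('a, 'u) module) (V :: ('a, 'v) module) f g.
         coherent R U \<and> coherent R V \<and>
         f \<in> mod_hom R U V \<and> inj_on f (carrier U) \<and> g \<in> mod_hom R U (regular R)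
           \<longrightarrow> (\<exists>h\<in>mod_hom R V (regular R). \<forall>x\<in>carrier U. h (f x) = g x))) \<and>
     (\<forall>(I :: 'i set) (N :: 'i \<Rightarrow> ('a, 'n) module) (M :: ('a, 'c) module)
        (P :: nat \<Rightarrow> ('a, 'q) module) d e s.
        (\<forall>i\<in>I. coherent R (N i)) \<and> left_module R M \<and> mod_iso R M (direct_sum I N) \<and>
        projective_resolution R M P d e \<and> s > 0
          \<longrightarrow> trivial_group (Ext_group R P d (regular R) s))"
proof -
  interpret ring_with_frobenius_subalgebras K R
    by (rule locally_frobenius_enough[OF assms])
  show ?thesis
    by (intro conjI allI impI; (elim conjE)?)
      (rule trivial_Ext_coherent coherent_regular injective_coherent trivial_Ext_coproduct; blast)+
qed

end
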